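(* Let $X=(X(t))_{t\ge 0}$ be an almost surely nondecreasing and right-continuous stochastic process. Suppose that there exist functions $a,b$ and a stochastic process $W=(W(u))_{u\ge 0}$ such that - $a$ is a positive function with $\lim_{t\to\infty}a(t)=\infty$; - $b$ is a positive nondecreasing right-continuous function which varies regularly at $\infty$ of index $\alpha>0$ and satisfies $\lim_{t\to\infty}(b(t)/a(t))=\infty$; - $W$ is almost surely locally H\"older continuous, that is, for some $\gamma\in(0,1]$ and all $T>0$ there is an almost surely finite positive random variable $V_T$ such that, almost surely, $|W(x)-W(y)|\le V_T|x-y|^\gamma$ for all $x,y\in[0,T]$; - as $t\to\infty$, $$\Big(\frac{X(ut)-b(ut)}{a(t)}\Big)_{u\ge 0}\ \Rightarrow\ (W(u))_{u\ge 0}$$ weakly on $D$ with the $J_1$-topology. Let $X_j=X^{\ast(j)}$ for $j\ge 1$. Put $b_0(t)=1$ and $b_1(t)=b(t)$ for $t>0$ and, for $j\ge 2$, $b_j=b^{\ast(j)}$. Put $W_1=W$ and, for $j\ge 2$, $$W_j(u)=j\int_0^u W(u-y)\,{\rm d}y^{\alpha(j-1)},\quad u\ge 0.$$ Then, as $t\to\infty$, $$\Big(\Big(\frac{X_j(ut)-b_j(ut)}{a(t)\,b_{j-1}(t)}\Big)_{u\ge 0}\Big)_{j\ge 1}\ \Rightarrow\ \big((W_j(u))_{u\ge 0}\big)_{j\ge 1}$$ weakly in the product $J_1$-topology on $D^{\mathbb N}$.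
   Context: $D$ is the Skorokhod space of c\`adl\`ag functions defined on $[0,\infty)$, endowed with the $J_1$-topology, and $\Rightarrow$ denotes weak convergence in a function space. $D^{\mathbb N}$ carries the product topology. A positive function $f$ is regularly varying at $\infty$ of index $\alpha\in\mathbb R$ if $\lim_{t\to\infty}f(\lambda t)/f(t)=\lambda^\alpha$ for each $\lambda>0$. For a nondecreasing right-continuous function $g$ on $[0,\infty)$, the $j$-fold Lebesgue-Stieltjes convolution of $g$ with itself is defined by $g^{\ast(1)}=g$ and, for $j\ge 2$, $$g^{\ast(j)}(t)=\int_{[0,t]}g(t-y)\,{\rm d}g^{\ast(j-1)}(y)=\int_{[0,t]}g^{\ast(j-1)}(t-y)\,{\rm d}g(y),\quad t\ge 0.$$ Here integration with respect to ${\rm d}h$ is with respect to the measure on $[0,\infty)$ assigning mass $h(y)$ to $[0,y]$ for every $y\ge0$ (so there is an atom of mass $h(0)$ at $0$). For the stochastic process $X$, the convolutions are taken pathwise. The notation ${\rm d}y^{q}$ with $q>0$ means $q y^{q-1}{\rm d}y$. *)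

theory Defs
  imports "HOL-Probability.Probability"
begin

definition cadlag :: "(real \<Rightarrow> real) \<Rightarrow> bool" where
  "cadlag x \<longleftrightarrow>
     (\<forall>t\<ge>0. continuous (at_right t) x) \<and> (\<forall>t>0. \<exists>l. (x \<longlongrightarrow> l) (at_left t))"

text \<open>
  Functions on the half-line are represented by functions on \<^typ>\<open>real\<close> that take the fixed
  value \<^const>\<open>undefined\<close> at negative arguments.
\<close>

definition skorokhod_space :: "(real \<Rightarrow> real) set" where
  "skorokhod_space = {x \<in> extensional {0..}. cadlag x}"

definition time_changes :: "real \<Rightarrow> (real \<Rightarrow> real) set" where
  "time_changes m =
     {l. strict_mono_on {0..m} l \<and> continuous_on {0..m} l \<and> l ` {0..m} = {0..m}}"

definition skorokhod_admissible :: "real \<Rightarrow> (real \<Rightarrow> real) \<Rightarrow> (real \<Rightarrow> real) \<Rightarrow> real \<Rightarrow> bool" where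
  "skorokhod_admissible m x y e \<longleftrightarrow>
     0 < e \<and> (\<exists>l\<in>time_changes m. \<forall>s\<in>{0..m}. \<bar>l s - s\<bar> \<le> e \<and> \<bar>x s - y (l s)\<bar> \<le> e)"

text \<open>The \<open>J\<^sub>1\<close>-metric on the compact interval \<open>[0, m]\<close> (Billingsley, Convergence of
  Probability Measures, 2nd ed., Section 12).\<close>

definition skorokhod_dist_upto :: "real \<Rightarrow> (real \<Rightarrow> real) \<Rightarrow> (real \<Rightarrow> real) \<Rightarrow> real" where
  "skorokhod_dist_upto m x y = Inf {e. skorokhod_admissible m x y e}"

text \<open>
  The \<open>J\<^sub>1\<close>-metric on the half-line (Billingsley, Section 16).  The taper equals 1 up to
  time \<open>m - 1\<close> and decreases linearly to 0 at time \<open>m\<close>; it removes the exceptional role that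
  the right end point of \<open>[0, m]\<close> plays in \<^const>\<open>skorokhod_dist_upto\<close>.
\<close>

definition taper :: "real \<Rightarrow> (real \<Rightarrow> real) \<Rightarrow> real \<Rightarrow> real" where
  "taper m x s = max 0 (min 1 (m - s)) * x s"

text \<open>
  Outside the space the value 0 is a convention, needed because \<^locale>\<open>Metric_space\<close> asks for
  nonnegativity everywhere.
\<close>

definition skorokhod_dist :: "(real \<Rightarrow> real) \<Rightarrow> (real \<Rightarrow> real) \<Rightarrow> real" where
  "skorokhod_dist x y =
     (if x \<in> skorokhod_space \<and> y \<in> skorokhod_space
      then \<Sum>n. (1/2) ^ Suc n *
             min 1 (skorokhod_dist_upto (real (Suc n)) (taper (real (Suc n)) x) (taper (real (Suc n)) y))
      else 0)"

lemma id_time_change: "(\<lambda>s. s) \<in> time_changes m"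
  unfolding time_changes_def by (simp add: strict_mono_onI)

lemma comp_time_change:
  assumes "k \<in> time_changes m" "l \<in> time_changes m"
  shows "(\<lambda>s. k (l s)) \<in> time_changes m"
proof -
  have k: "strict_mono_on {0..m} k" "continuous_on {0..m} k" "k ` {0..m} = {0..m}"
    and l: "strict_mono_on {0..m} l" "continuous_on {0..m} l" "l ` {0..m} = {0..m}"
    using assms unfolding time_changes_def by blast+
  have lin: "l s \<in> {0..m}" if "s \<in> {0..m}" for s
    using l(3) that by blast
  have 1: "strict_mono_on {0..m} (\<lambda>s. k (l s))"
  proof (rule strict_mono_onI)
    fix r s assume rs: "r \<in> {0..m}" "s \<in> {0..m}" "r < s"
    show "k (l r) < k (l s)"
      by (rule strict_mono_onD[OF k(1) lin lin strict_mono_onD[OF l(1)]]) (fact rs)+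
  qed
  have 2: "continuous_on {0..m} (\<lambda>s. k (l s))"
    by (rule continuous_on_compose2[OF k(2) l(2)]) (simp add: l(3))
  have "(\<lambda>s. k (l s)) ` {0..m} = k ` (l ` {0..m})" by (simp only: image_image)
  then have 3: "(\<lambda>s. k (l s)) ` {0..m} = {0..m}"
    by (simp only: l(3) k(3))
  from 1 2 3 show ?thesis unfolding time_changes_def by blast
qed

lemma inv_time_change:
  assumes "l \<in> time_changes m"
  obtains k where "k \<in> time_changes m" "\<And>s. s \<in> {0..m} \<Longrightarrow> l (k s) = s"
proof -
  let ?k = "the_inv_into {0..m} l"
  have sm: "strict_mono_on {0..m} l" and im: "l ` {0..m} = {0..m}" and c: "continuous_on {0..m} l"
    using assms unfolding time_changes_def by auto
  have inj: "inj_on l {0..m}" using sm by (rule strict_mono_on_imp_inj_on)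
  have lk: "l (?k s) = s" if "s \<in> {0..m}" for s
    using f_the_inv_into_f[OF inj] that im by simp
  have kin: "?k s \<in> {0..m}" if "s \<in> {0..m}" for s
    using the_inv_into_into[OF inj, of s "{0..m}"] that im by auto
  have "strict_mono_on {0..m} ?k"
  proof (rule strict_mono_onI)
    fix r s assume rs: "r \<in> {0..m}" "s \<in> {0..m}" "r < s"
    show "?k r < ?k s"
    proof (rule ccontr)
      assume "\<not> ?k r < ?k s"
      then have "?k s \<le> ?k r" by simp
      then have "l (?k s) \<le> l (?k r)"
        using strict_mono_onD[OF sm kin[OF rs(2)] kin[OF rs(1)]] by (cases "?k s = ?k r") auto
      then show False using lk rs by simp
    qed
  qed
  moreover have "continuous_on {0..m} ?k"
    using continuous_on_inv_into[OF c _ inj] im by simp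
  moreover have "?k ` {0..m} = {0..m}"
    using the_inv_into_onto[OF inj] im by simp
  ultimately have "?k \<in> time_changes m" unfolding time_changes_def by blast
  then show thesis using that lk by blast
qed

lemma time_change_in: "l \<in> time_changes m \<Longrightarrow> s \<in> {0..m} \<Longrightarrow> l s \<in> {0..m}"
  unfolding time_changes_def by blast

lemma admissible_sym:
  assumes "skorokhod_admissible m x y e"
  shows "skorokhod_admissible m y x e"
proof -
  obtain l where l: "l \<in> time_changes m" "0 < e"
      "\<And>s. s \<in> {0..m} \<Longrightarrow> \<bar>l s - s\<bar> \<le> e \<and> \<bar>x s - y (l s)\<bar> \<le> e"
    using assms unfolding skorokhod_admissible_def by blast
  obtain k where k: "k \<in> time_changes m" "\<And>s. s \<in> {0..m} \<Longrightarrow> l (k s) = s"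
    using inv_time_change[OF l(1)] by blast
  have "\<bar>k s - s\<bar> \<le> e \<and> \<bar>y s - x (k s)\<bar> \<le> e" if "s \<in> {0..m}" for s
    using l(3)[OF time_change_in[OF k(1) that]] k(2)[OF that] by (simp add: abs_minus_commute)
  then show ?thesis using k(1) l(2) unfolding skorokhod_admissible_def by blast
qed

lemma admissible_trans:
  assumes "skorokhod_admissible m x y d" "skorokhod_admissible m y z e"
  shows "skorokhod_admissible m x z (d + e)"
proof -
  obtain l where l: "l \<in> time_changes m" "0 < d"
      "\<And>s. s \<in> {0..m} \<Longrightarrow> \<bar>l s - s\<bar> \<le> d \<and> \<bar>x s - y (l s)\<bar> \<le> d"
    using assms unfolding skorokhod_admissible_def by blast
  obtain k where k: "k \<in> time_changes m" "0 < e"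
      "\<And>s. s \<in> {0..m} \<Longrightarrow> \<bar>k s - s\<bar> \<le> e \<and> \<bar>y s - z (k s)\<bar> \<le> e"
    using assms unfolding skorokhod_admissible_def by blast
  have "\<bar>k (l s) - s\<bar> \<le> d + e \<and> \<bar>x s - z (k (l s))\<bar> \<le> d + e" if "s \<in> {0..m}" for s
    using l(3)[OF that] k(3)[OF time_change_in[OF l(1) that]] by linarith
  then have "\<exists>r\<in>time_changes m. \<forall>s\<in>{0..m}. \<bar>r s - s\<bar> \<le> d + e \<and> \<bar>x s - z (r s)\<bar> \<le> d + e"
    using comp_time_change[OF k(1) l(1)] by (intro bexI[of _ "\<lambda>s. k (l s)"] ballI)
  moreover have "0 < d + e" using l(2) k(2) by simp
  ultimately show ?thesis unfolding skorokhod_admissible_def by (rule conjI[rotated])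
qed

lemma cadlag_bounded:
  assumes "cadlag x" "0 \<le> m"
  shows "\<exists>B. \<forall>s\<in>{0..m}. \<bar>x s\<bar> \<le> B"
proof -
  define P where "P = (\<lambda>u v. \<exists>B. \<forall>s\<in>{max 0 u..v}. \<bar>x s\<bar> \<le> B)"
  have "P 0 m"
  proof (rule Bolzano[of 0 m P, OF assms(2)])
    fix a b c assume ab: "P a b" and bc: "P b c"
    obtain B where B: "\<forall>s\<in>{max 0 a..b}. \<bar>x s\<bar> \<le> B" using ab unfolding P_def ..
    obtain C where C: "\<forall>s\<in>{max 0 b..c}. \<bar>x s\<bar> \<le> C" using bc unfolding P_def ..
    have "\<bar>x s\<bar> \<le> max B C" if "s \<in> {max 0 a..c}" for s
    proof (cases "s \<le> b")
      case True
      then have "\<bar>x s\<bar> \<le> B" using B that by simp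
      then show ?thesis by simp
    next
      case False
      then have "\<bar>x s\<bar> \<le> C" using C that by simp
      then show ?thesis by simp
    qed
    then have "\<forall>s\<in>{max 0 a..c}. \<bar>x s\<bar> \<le> max B C" by blast
    then show "P a c" unfolding P_def by blast
  next
    fix t assume t: "0 \<le> t" "t \<le> m"
    have "(x \<longlongrightarrow> x t) (at_right t)"
      using assms(1) t unfolding cadlag_def by (simp add: continuous_within)
    then have "\<forall>\<^sub>F s in at_right t. dist (x s) (x t) < 1" by (rule tendstoD) simp
    then obtain r where r: "t < r" "\<And>s. t < s \<Longrightarrow> s < r \<Longrightarrow> dist (x s) (x t) < 1"
      unfolding eventually_at_right_field by blast
    obtain l q where q: "q < t" "\<And>s. 0 \<le> s \<Longrightarrow> q < s \<Longrightarrow> s < t \<Longrightarrow> dist (x s) l < 1"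
    proof (cases "t = 0")
      case True
      then show thesis using that[of "-1" 0] by auto
    next
      case False
      then obtain l where "(x \<longlongrightarrow> l) (at_left t)"
        using assms(1) t unfolding cadlag_def by force
      then have "\<forall>\<^sub>F s in at_left t. dist (x s) l < 1" by (rule tendstoD) simp
      then show thesis using that unfolding eventually_at_left_field by blast
    qed
    have bd: "\<bar>x s\<bar> \<le> \<bar>x t\<bar> + \<bar>l\<bar> + 1" if "0 \<le> s" "q < s" "s < r" for s
      using r(2)[of s] q(2)[of s] that by (cases s t rule: linorder_cases) (auto simp: dist_real_def)
    show "\<exists>d>0. \<forall>u v. u \<le> t \<and> t \<le> v \<and> v - u < d \<longrightarrow> P u v"
    proof (intro exI[of _ "min (t - q) (r - t)"] conjI allI impI)
      fix u v assume uv: "u \<le> t \<and> t \<le> v \<and> v - u < min (t - q) (r - t)"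
      show "P u v" unfolding P_def
        using uv by (intro exI[of _ "\<bar>x t\<bar> + \<bar>l\<bar> + 1"] ballI bd) auto
    qed (use q r in auto)
  qed
  then show ?thesis by (simp add: P_def)
qed

lemma admissible_nonempty:
  assumes "cadlag x" "cadlag y" "0 \<le> m"
  shows "\<exists>e. skorokhod_admissible m (taper m x) (taper m y) e"
proof -
  obtain B where B: "\<forall>s\<in>{0..m}. \<bar>x s\<bar> \<le> B"
    using cadlag_bounded[OF assms(1,3)] ..
  obtain C where C: "\<forall>s\<in>{0..m}. \<bar>y s\<bar> \<le> C"
    using cadlag_bounded[OF assms(2,3)] ..
  have t: "\<bar>taper m z s\<bar> \<le> \<bar>z s\<bar>" for z s
    unfolding taper_def abs_mult by (rule mult_left_le_one_le) auto
  have "\<bar>taper m x s - taper m y s\<bar> \<le> \<bar>B\<bar> + \<bar>C\<bar> + 1" if "s \<in> {0..m}" for s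
    using t[of x s] t[of y s] bspec[OF B that] bspec[OF C that] by linarith
  then have "skorokhod_admissible m (taper m x) (taper m y) (\<bar>B\<bar> + \<bar>C\<bar> + 1)"
    unfolding skorokhod_admissible_def using id_time_change[of m]
    by (intro conjI bexI[of _ "\<lambda>s. s"]) auto
  then show ?thesis by blast
qed

lemma skorokhod_dist_upto_le:
  "skorokhod_admissible m x y e \<Longrightarrow> skorokhod_dist_upto m x y \<le> e"
  unfolding skorokhod_dist_upto_def
  by (rule cInf_lower) (auto intro!: bdd_belowI[of _ 0] simp: skorokhod_admissible_def)

lemma skorokhod_dist_upto_lessD:
  assumes "skorokhod_admissible m x y e'" "skorokhod_dist_upto m x y < e"
  obtains d where "d < e" "skorokhod_admissible m x y d"
  using cInf_lessD[of "{e. skorokhod_admissible m x y e}" e] assms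
  unfolding skorokhod_dist_upto_def by blast

lemma skorokhod_dist_upto_nonneg:
  assumes "skorokhod_admissible m x y e"
  shows "0 \<le> skorokhod_dist_upto m x y"
  unfolding skorokhod_dist_upto_def using assms
  by (intro cInf_greatest) (auto simp: skorokhod_admissible_def)

lemma skorokhod_dist_upto_commute: "skorokhod_dist_upto m x y = skorokhod_dist_upto m y x"
proof -
  have "skorokhod_admissible m x y = skorokhod_admissible m y x"
    using admissible_sym by blast
  then show ?thesis by (simp add: skorokhod_dist_upto_def)
qed

lemma skorokhod_dist_upto_triangle:
  assumes "skorokhod_admissible m x y d" "skorokhod_admissible m y z e"
  shows "skorokhod_dist_upto m x z \<le> skorokhod_dist_upto m x y + skorokhod_dist_upto m y z"
proof (rule field_le_epsilon)
  fix r :: real assume r: "0 < r"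
  obtain d' where "d' < skorokhod_dist_upto m x y + r/2" "skorokhod_admissible m x y d'"
    using skorokhod_dist_upto_lessD[OF assms(1), of "skorokhod_dist_upto m x y + r/2"] r by auto
  moreover obtain e' where "e' < skorokhod_dist_upto m y z + r/2" "skorokhod_admissible m y z e'"
    using skorokhod_dist_upto_lessD[OF assms(2), of "skorokhod_dist_upto m y z + r/2"] r by auto
  ultimately show
    "skorokhod_dist_upto m x z \<le> skorokhod_dist_upto m x y + skorokhod_dist_upto m y z + r"
    using skorokhod_dist_upto_le[OF admissible_trans[of m x y d' z e']] by linarith
qed

lemma skorokhod_metric: "Metric_space skorokhod_space skorokhod_dist"
proof -
  define D where "D = skorokhod_space"
  define c where "c x y n = (1/2::real) ^ Suc n *
      min 1 (skorokhod_dist_upto (real (Suc n)) (taper (real (Suc n)) x) (taper (real (Suc n)) y))"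
    for x y n
  have dist: "skorokhod_dist x y = (if x \<in> D \<and> y \<in> D then suminf (c x y) else 0)" for x y
    unfolding skorokhod_dist_def D_def c_def ..
  have ne: "\<exists>e. skorokhod_admissible (real (Suc n)) (taper (real (Suc n)) x) (taper (real (Suc n)) y) e"
    if "x \<in> D" "y \<in> D" for x y n
    using that admissible_nonempty[of x y "real (Suc n)"] by (auto simp: D_def skorokhod_space_def)
  have c0: "0 \<le> c x y n" if "x \<in> D" "y \<in> D" for x y n
    using ne[OF that, of n] skorokhod_dist_upto_nonneg unfolding c_def
    by (intro mult_nonneg_nonneg) auto
  have c1: "c x y n \<le> (1/2) ^ Suc n" for x y n
    unfolding c_def by (intro mult_left_le) auto
  have geo: "summable (\<lambda>n. (1/2::real) ^ Suc n)"
    using summable_geometric[of "1/2::real"] summable_Suc_iff by fastforce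
  have sc: "summable (c x y)" if "x \<in> D" "y \<in> D" for x y
    by (rule summable_comparison_test'[OF geo, of 0]) (use c0[OF that] c1 in auto)
  have comm: "c x y = c y x" for x y
    unfolding c_def by (subst skorokhod_dist_upto_commute) (rule refl)
  have tri: "c x z n \<le> c x y n + c y z n" if xyz: "x \<in> D" "y \<in> D" "z \<in> D" for x y z n
  proof -
    obtain d where d:
      "skorokhod_admissible (real (Suc n)) (taper (real (Suc n)) x) (taper (real (Suc n)) y) d"
      using ne[OF xyz(1,2)] ..
    obtain e where e:
      "skorokhod_admissible (real (Suc n)) (taper (real (Suc n)) y) (taper (real (Suc n)) z) e"
      using ne[OF xyz(2,3)] ..
    note de = skorokhod_dist_upto_triangle[OF d e] d[THEN skorokhod_dist_upto_nonneg]
      e[THEN skorokhod_dist_upto_nonneg]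
    show ?thesis unfolding c_def distrib_left[symmetric]
      by (rule mult_left_mono) (use de in linarith, simp)
  qed
  have zero: "x = y" if xy: "x \<in> D" "y \<in> D" and s0: "suminf (c x y) = 0" for x y
  proof
    fix t :: real
    have cx: "cadlag x" "cadlag y" and ex: "x \<in> extensional {0..}" "y \<in> extensional {0..}"
      using xy by (auto simp: D_def skorokhod_space_def)
    have cz: "c x y n = 0" for n
      using suminf_eq_zero_iff[OF sc[OF xy] c0[OF xy]] s0 by simp
    have dz: "skorokhod_dist_upto (real (Suc n)) (taper (real (Suc n)) x) (taper (real (Suc n)) y) = 0" for n
      using cz[of n] unfolding c_def by (auto simp: min_def split: if_splits)
    show "x t = y t"
    proof (cases "0 \<le> t")
      case False
      then show ?thesis using ex by (simp add: extensional_def)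
    next
      case t: True
      have "\<bar>x t - y t\<bar> \<le> 0 + r" if r: "0 < r" for r
      proof -
        have xt: "(x \<longlongrightarrow> x t) (at_right t)" and yt: "(y \<longlongrightarrow> y t) (at_right t)"
          using cx t unfolding cadlag_def by (simp_all add: continuous_within)
        have "\<forall>\<^sub>F s in at_right t. dist (x s) (x t) < r/3"
          by (rule tendstoD[OF xt]) (use r in simp)
        moreover have "\<forall>\<^sub>F s in at_right t. dist (y s) (y t) < r/3"
          by (rule tendstoD[OF yt]) (use r in simp)
        ultimately have "\<forall>\<^sub>F s in at_right t. dist (x s) (x t) < r/3 \<and> dist (y s) (y t) < r/3"
          by (rule eventually_conj)
        then obtain q where q: "t < q"
            "\<And>s. t < s \<Longrightarrow> s < q \<Longrightarrow> dist (x s) (x t) < r/3 \<and> dist (y s) (y t) < r/3"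
          unfolding eventually_at_right_field by blast
        define s where "s = (t + q) / 2"
        obtain n where n: "q < real n" using reals_Archimedean2 by blast
        obtain e' where
          "skorokhod_admissible (real (Suc n)) (taper (real (Suc n)) x) (taper (real (Suc n)) y) e'"
          using ne[OF xy] by blast
        then obtain e where e: "e < min (r/3) ((q - t)/2)"
          "skorokhod_admissible (real (Suc n)) (taper (real (Suc n)) x) (taper (real (Suc n)) y) e"
          using skorokhod_dist_upto_lessD[of "real (Suc n)" "taper (real (Suc n)) x"
              "taper (real (Suc n)) y" e' "min (r/3) ((q - t)/2)"] dz[of n] r q(1) by auto
        have sin: "s \<in> {0..real (Suc n)}" using t q(1) n by (auto simp: s_def)
        then obtain l where l: "\<bar>l s - s\<bar> \<le> e"
            "\<bar>taper (real (Suc n)) x s - taper (real (Suc n)) y (l s)\<bar> \<le> e"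
          using e(2) unfolding skorokhod_admissible_def by blast
        have ls: "t < l s" "l s < q" "t < s" "s < q"
          using l(1) e(1) q(1) by (auto simp: s_def field_simps abs_le_iff)
        then have "taper (real (Suc n)) x s = x s" "taper (real (Suc n)) y (l s) = y (l s)"
          using n by (auto simp: taper_def)
        then show ?thesis
          using l(2) e(1) q(2)[OF ls(1,2)] q(2)[OF ls(3,4)]
          unfolding dist_real_def min_less_iff_conj by linarith
      qed
      then have "\<bar>x t - y t\<bar> \<le> 0" by (rule field_le_epsilon)
      then show ?thesis by simp
    qed
  qed
  have refl: "suminf (c x x) = 0" if "x \<in> D" for x
  proof -
    have "skorokhod_dist_upto m z z \<le> 0" for m z
    proof (rule field_le_epsilon)
      fix e :: real assume "0 < e"
      then have "skorokhod_admissible m z z e"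
        unfolding skorokhod_admissible_def using id_time_change
        by (intro conjI bexI[of _ "\<lambda>s. s"]) auto
      then show "skorokhod_dist_upto m z z \<le> 0 + e" using skorokhod_dist_upto_le by fastforce
    qed
    then have "c x x n \<le> 0" for n
      unfolding c_def by (intro mult_nonneg_nonpos) (auto simp: min_le_iff_disj)
    then have "c x x n = 0" for n using c0[OF that that, of n] by (meson antisym)
    then have "c x x = (\<lambda>n. 0)" by (rule ext)
    then show ?thesis by simp
  qed
  have "Metric_space D skorokhod_dist"
  proof
    show "0 \<le> skorokhod_dist x y" for x y
      using c0 sc by (auto simp: dist intro!: suminf_nonneg)
    show "skorokhod_dist x y = skorokhod_dist y x" for x y
      using comm[of x y] by (auto simp: dist)
    show "skorokhod_dist x y = 0 \<longleftrightarrow> x = y" if "x \<in> D" "y \<in> D" for x y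
      using that zero refl by (auto simp: dist)
    show "skorokhod_dist x z \<le> skorokhod_dist x y + skorokhod_dist y z"
      if "x \<in> D" "y \<in> D" "z \<in> D" for x y z
      using that tri sc by (auto simp: dist suminf_add intro!: suminf_le summable_add)
  qed
  then show ?thesis by (simp add: D_def)
qed

definition J1_topology :: "(real \<Rightarrow> real) topology" where
  "J1_topology = Metric_space.mtopology skorokhod_space skorokhod_dist"


definition borel_of :: "'s topology \<Rightarrow> 's measure" where
  "borel_of T = sigma (topspace T) {U. openin T U}"

text \<open>
  The processes of interest have paths in the space only almost surely, so a random element
  is allowed to differ on a null set from a genuinely measurable map.
\<close>

definition random_element :: "'w measure \<Rightarrow> 's topology \<Rightarrow> ('w \<Rightarrow> 's) \<Rightarrow> bool" where
  "random_element M T Y \<longleftrightarrow> (\<exists>Y' \<in> M \<rightarrow>\<^sub>M borel_of T. AE \<omega> in M. Y \<omega> = Y' \<omega>)"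

text \<open>
  The expectations are taken with respect to the completed measures, because \<open>f \<circ> Y\<close> is only
  almost everywhere equal to a measurable function.  The random elements may be defined on
  different probability spaces.
\<close>

definition converges_weakly ::
  "'s topology \<Rightarrow> 'w measure \<Rightarrow> ('i \<Rightarrow> 'w \<Rightarrow> 's) \<Rightarrow> 'v measure \<Rightarrow> ('v \<Rightarrow> 's) \<Rightarrow> 'i filter \<Rightarrow> bool" where
  "converges_weakly T M Y N Z F \<longleftrightarrow>
     (\<forall>\<^sub>F i in F. random_element M T (Y i)) \<and> random_element N T Z \<and>
     (\<forall>f. continuous_map T euclideanreal f \<and> bounded (f ` topspace T) \<longrightarrow>
        ((\<lambda>i. \<integral>\<omega>. f (Y i \<omega>) \<partial>completion M) \<longlongrightarrow> (\<integral>\<omega>. f (Z \<omega>) \<partial>completion N)) F)"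


definition regularly_varying :: "(real \<Rightarrow> real) \<Rightarrow> real \<Rightarrow> bool" where
  "regularly_varying f \<alpha> \<longleftrightarrow> (\<forall>c>0. ((\<lambda>t. f (c * t) / f t) \<longlongrightarrow> c powr \<alpha>) at_top)"

text \<open>
  The integral of \<open>f (t - y)\<close> over \<open>y \<in> [0, t]\<close> with respect to \<open>dg(y)\<close>, where \<open>dg\<close> gives
  mass \<open>g y\<close> to \<open>[0, y]\<close>.  The atom of mass \<open>g 0\<close> at 0 is written separately, so that
  \<open>g 0 < 0\<close> is not excluded; \<open>max 0\<close> makes \<open>g\<close> nondecreasing and right-continuous on the
  whole line without changing it on the half-line.
\<close>

definition ls_convolution :: "(real \<Rightarrow> real) \<Rightarrow> (real \<Rightarrow> real) \<Rightarrow> real \<Rightarrow> real" where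
  "ls_convolution f g t =
     f t * g 0 + (LINT y:{0<..t}|interval_measure (\<lambda>y. g (max 0 y)). f (t - y))"

text \<open>The 0-fold convolution is the distribution function 1 of the unit mass at 0.\<close>

fun conv_power :: "(real \<Rightarrow> real) \<Rightarrow> nat \<Rightarrow> real \<Rightarrow> real" where
  "conv_power g 0 = (\<lambda>t. 1)"
| "conv_power g (Suc 0) = g"
| "conv_power g (Suc (Suc n)) = ls_convolution (conv_power g (Suc n)) g"

definition locally_hoelder :: "'v measure \<Rightarrow> (real \<Rightarrow> 'v \<Rightarrow> real) \<Rightarrow> bool" where
  "locally_hoelder N W \<longleftrightarrow>
     (\<exists>\<gamma>. 0 < \<gamma> \<and> \<gamma> \<le> 1 \<and>
       (\<forall>T>0. \<exists>V \<in> borel_measurable N. (AE \<omega> in N. 0 < V \<omega>) \<and>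
          (AE \<omega> in N. \<forall>x\<in>{0..T}. \<forall>y\<in>{0..T}.
             \<bar>W x \<omega> - W y \<omega>\<bar> \<le> V \<omega> * \<bar>x - y\<bar> powr \<gamma>)))"

definition limit_path :: "real \<Rightarrow> (real \<Rightarrow> real) \<Rightarrow> nat \<Rightarrow> real \<Rightarrow> real" where
  "limit_path \<alpha> w j u =
     (if j = 1 then w u
      else real j *
        (LINT y:{0..u}|lborel. w (u - y) * (\<alpha> * real (j - 1) * y powr (\<alpha> * real (j - 1) - 1))))"

end

theory Submission
  imports Defs
begin

text \<open>
  The convergence of the normalised convolution powers is a deterministic fact about paths,
  transferred to laws by a continuous mapping argument.

  Paths.  Let \<open>p\<close> be a nondecreasing path such that \<open>x\<^sub>t(u) = (p(ut) - b(ut)) / a(t)\<close> converges, uniformly on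
  compact sets, to a continuous \<open>x\<close>, and let \<open>p\<^sub>j\<close>, \<open>b\<^sub>j\<close> be the \<open>j\<close>-fold powers.  Commutativity of the convolution
  gives \<open>p\<^sub>j\<^sub>+\<^sub>1 - b\<^sub>j\<^sub>+\<^sub>1 = (p\<^sub>j - b\<^sub>j) * p + (p - b) * b\<^sub>j\<close> (\<open>conv_power_difference\<close>).  After division by
  \<open>a(t) b(t)^j\<close> the integrators on the right are \<open>p(ut)/b(t)\<close> and \<open>b\<^sub>j(ut)/b(t)^j\<close>.  The first tends to \<open>u^\<alpha>\<close>,
  because \<open>b\<close> is regularly varying and \<open>a/b\<close> tends to 0; the second tends to \<open>c\<^sub>j u^(\<alpha>j)\<close> for a constant \<open>c\<^sub>j\<close>.
  Convolution is jointly continuous under uniform convergence if the limit integrand is continuous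
  (\<open>ls_convolution_uniform_limit\<close>), so the limits satisfy \<open>V\<^sub>1 = x\<close> and
  \<open>V\<^sub>j\<^sub>+\<^sub>1 = V\<^sub>j * u^\<alpha> + x * c\<^sub>j u^(\<alpha>j)\<close>.  By associativity (\<open>ls_convolution_assoc\<close>) the solution is
  \<open>V\<^sub>j\<^sub>+\<^sub>1 = (j + 1) c\<^sub>j x * u^(\<alpha>j)\<close>, and normalising with \<open>b\<^sub>j(t) \<sim> c\<^sub>j b(t)^j\<close> instead of \<open>b(t)^j\<close> cancels the
  constant (\<open>conv_power_uniform_limit\<close>).

  The algebra of convolutions is obtained from Riemann sums: linearity and scaling are evident for the
  sums, and commutativity is Abel summation.

  Laws.  A sequence that converges in the \<open>J\<^sub>1\<close>-metric to a continuous path converges locally uniformly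
  (\<open>skorokhod_close_to_continuous\<close>).  Hence the maps that send a normalised path to the sequence of its
  normalised convolution powers, which depend on \<open>t\<close>, converge continuously at every continuous path, and
  almost every path of \<open>W\<close> is continuous.  An extended continuous mapping theorem
  (\<open>extended_mapping\<close>) then transfers the weak convergence.  It is proved by squeezing the test functions
  between Lipschitz envelopes on the Skorokhod space, to which the assumed weak convergence applies.

  Measurability.  Open sets of the product space are not described by finitely many coordinates.  A cadlag path
  is however the \<open>J\<^sub>1\<close>-limit of its discretisations on the grids of mesh \<open>1/n\<close>
  (\<open>grid_step_tendsto_skorokhod\<close>), and these depend continuously on countably many real coordinates
  (\<open>measurable_J1_product\<close>).
\<close>

section \<open>Riemann sums of Stieltjes convolutions\<close>

text \<open>
  The integrand is evaluated at \<open>t - kt/n\<close> on the cell \<open>y \<in> (kt/n, (k+1)t/n]\<close>, hence to the right of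
  \<open>t - y\<close>: right-continuity of \<open>f\<close> then gives convergence, and on this grid the sum is symmetric in \<open>f\<close>
  and \<open>g\<close> (\<open>riemann_sum_commute\<close>).  The first summand is the atom of mass \<open>g 0\<close> at 0.
\<close>
definition riemann_sum :: "(real \<Rightarrow> real) \<Rightarrow> (real \<Rightarrow> real) \<Rightarrow> nat \<Rightarrow> real \<Rightarrow> real" where
  "riemann_sum f g n t = f t * g 0 +
     (\<Sum>k<n. f (t - real k * t / real n) * (g (real (Suc k) * t / real n) - g (real k * t / real n)))"

definition mono_rc :: "(real \<Rightarrow> real) \<Rightarrow> bool" where
  "mono_rc g \<longleftrightarrow> mono_on {0..} g \<and> (\<forall>t\<ge>0. continuous (at_right t) g)"

definition stieltjes :: "(real \<Rightarrow> real) \<Rightarrow> real measure" where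
  "stieltjes g = interval_measure (\<lambda>y. g (max 0 y))"

lemma mono_rcD: "mono_rc g \<Longrightarrow> 0 \<le> s \<Longrightarrow> s \<le> t \<Longrightarrow> g s \<le> g t"
  unfolding mono_rc_def by (auto intro: mono_onD)

lemma sets_stieltjes [simp, measurable_cong]: "sets (stieltjes g) = sets borel"
  and space_stieltjes [simp]: "space (stieltjes g) = UNIV"
  by (simp_all add: stieltjes_def)

lemma continuous_at_right_max0:
  assumes "\<forall>t\<ge>0. continuous (at_right t) (g :: real \<Rightarrow> real)"
  shows "continuous (at_right a) (\<lambda>y. g (max 0 y))"
proof (cases "0 \<le> a")
  case True
  have "(g \<longlongrightarrow> g a) (at_right a)"
    using assms True by (auto simp: continuous_within)
  moreover have "\<forall>\<^sub>F y in at_right a. g (max 0 y) = g y"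
    using True by (auto simp: eventually_at_filter)
  ultimately show ?thesis
    using True by (simp add: continuous_within tendsto_cong)
next
  case False
  have "\<forall>\<^sub>F y in at_right a. y < 0"
    using False by (intro eventually_at_rightI[of a 0]) auto
  then have "\<forall>\<^sub>F y in at_right a. g (max 0 y) = g 0"
    by eventually_elim (simp add: max_def)
  then show ?thesis
    using False by (simp add: continuous_within tendsto_cong max_def)
qed

lemma emeasure_stieltjes_Ioc:
  assumes "mono_rc g" "0 \<le> a" "a \<le> b"
  shows "emeasure (stieltjes g) {a<..b} = ennreal (g b - g a)"
proof -
  have "emeasure (stieltjes g) {a<..b} = g (max 0 b) - g (max 0 a)"
    unfolding stieltjes_def using assms(1)
    by (intro emeasure_interval_measure_Ioc[OF assms(3)] continuous_at_right_max0)
       (auto simp: mono_rc_def intro!: mono_onD[of "{0..}" g])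
  then show ?thesis using assms by simp
qed

lemma measure_stieltjes_Ioc:
  assumes "mono_rc g" "0 \<le> a" "a \<le> b"
  shows "measure (stieltjes g) {a<..b} = g b - g a"
  using emeasure_stieltjes_Ioc[OF assms] mono_rcD[OF assms] by (simp add: measure_def)

lemma ls_convolution_altdef:
  "ls_convolution f g t = f t * g 0 + (\<integral>y. indicator {0<..t} y * f (t - y) \<partial>stieltjes g)"
  by (simp add: ls_convolution_def stieltjes_def set_lebesgue_integral_def)

text \<open>The step function in \<open>y\<close> whose Stieltjes integral is the Riemann sum.\<close>
definition grid_fun :: "(real \<Rightarrow> real) \<Rightarrow> nat \<Rightarrow> real \<Rightarrow> real \<Rightarrow> real" where
  "grid_fun f n t y =
     (\<Sum>k<n. f (t - real k * t / real n) * indicator {real k * t / real n<..real (Suc k) * t / real n} y)"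

lemma grid_fun_eq:
  assumes t: "0 < t" and n: "0 < n" and y: "0 < y" "y \<le> t"
  obtains k where "k < n" "real k * t / real n < y" "y \<le> real (Suc k) * t / real n"
    "grid_fun f n t y = f (t - real k * t / real n)"
proof -
  have cell: "real k * t / real n < y \<and> y \<le> real (Suc k) * t / real n \<longleftrightarrow>
      real k < y * real n / t \<and> y * real n / t \<le> real (Suc k)" for k
    using t n by (simp add: field_simps)
  \<comment> \<open>The cells are open on the left, hence the ceiling minus one instead of the floor.\<close>
  define k where "k = nat (\<lceil>y * real n / t\<rceil> - 1)"
  have pos: "0 < y * real n / t" using t n y by simp
  have le: "y * real n / t \<le> real n" using t n y by (simp add: field_simps)
  have c1: "1 \<le> \<lceil>y * real n / t\<rceil>" using pos by linarith
  have cn: "\<lceil>y * real n / t\<rceil> \<le> int n" using le by (simp add: ceiling_le_iff)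
  have rk: "real k = of_int \<lceil>y * real n / t\<rceil> - 1" using c1 by (simp add: k_def)
  have "int k < int n" using c1 cn unfolding k_def by linarith
  then have k: "k < n" by simp
  have kc: "real k < y * real n / t \<and> y * real n / t \<le> real (Suc k)"
    using rk by simp linarith
  have "grid_fun f n t y = (\<Sum>i<n. if i = k then f (t - real k * t / real n) else 0)"
    unfolding grid_fun_def
  proof (rule sum.cong[OF refl])
    fix i
    have "i = k" if "real i < y * real n / t \<and> y * real n / t \<le> real (Suc i)"
    proof -
      have "real i < real (Suc k)" "real k < real (Suc i)" using that kc by linarith+
      then show ?thesis by simp
    qed
    then show "f (t - real i * t / real n) * indicator {real i * t / real n<..real (Suc i) * t / real n} y
        = (if i = k then f (t - real k * t / real n) else 0)"
      using kc cell[of i] cell[of k] by (auto simp: indicator_def)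
  qed
  also have "\<dots> = f (t - real k * t / real n)" using k by simp
  finally show thesis using that k kc cell[of k] by blast
qed

lemma grid_fun_outside:
  assumes "0 < t" "0 < n" "y \<notin> {0<..t}"
  shows "grid_fun f n t y = 0"
  unfolding grid_fun_def
proof (rule sum.neutral, rule ballI)
  fix k assume "k \<in> {..<n}"
  then have "real (Suc k) * t \<le> real n * t"
    using assms by (intro mult_right_mono) auto
  then have "real (Suc k) * t / real n \<le> t" "0 \<le> real k * t / real n"
    using assms by (auto simp: field_simps)
  then have "y \<notin> {real k * t / real n<..real (Suc k) * t / real n}" using assms(3) by auto
  then show "f (t - real k * t / real n) * indicator {real k * t / real n<..real (Suc k) * t / real n} y = 0"
    by simp
qed

lemma grid_fun_integral:
  assumes g: "mono_rc g" and t: "0 < t" and n: "0 < n"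
  shows "integrable (stieltjes g) (grid_fun f n t)"
    and "riemann_sum f g n t = f t * g 0 + (\<integral>y. grid_fun f n t y \<partial>stieltjes g)"
proof -
  define I where "I k = {real k * t / real n<..real (Suc k) * t / real n}" for k
  have I: "real k * t / real n \<le> real (Suc k) * t / real n" "0 \<le> real k * t / real n" for k
    using t n by (auto simp: divide_right_mono)
  have em: "emeasure (stieltjes g) (I k) < \<infinity>" for k
    unfolding I_def by (subst emeasure_stieltjes_Ioc[OF g I(2) I(1)]) simp
  have int: "integrable (stieltjes g) (\<lambda>y. c * indicator (I k) y :: real)" for k c
    using em by (intro integrable_mult_right integrable_real_indicator) (auto simp: I_def)
  show "integrable (stieltjes g) (grid_fun f n t)"
    unfolding grid_fun_def using int by (intro Bochner_Integration.integrable_sum) (simp add: I_def)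
  have "(\<integral>y. grid_fun f n t y \<partial>stieltjes g) =
      (\<Sum>k<n. \<integral>y. f (t - real k * t / real n) * indicator (I k) y \<partial>stieltjes g)"
    unfolding grid_fun_def I_def[symmetric] using int by (intro Bochner_Integration.integral_sum) auto
  also have "\<dots> = (\<Sum>k<n. f (t - real k * t / real n) *
      (g (real (Suc k) * t / real n) - g (real k * t / real n)))"
    by (simp add: I_def measure_stieltjes_Ioc[OF g I(2) I(1)] del: of_nat_Suc)
  finally show "riemann_sum f g n t = f t * g 0 + (\<integral>y. grid_fun f n t y \<partial>stieltjes g)"
    by (simp add: riemann_sum_def)
qed

lemma grid_fun_tendsto:
  assumes f: "cadlag f" and t: "0 < t"
  shows "(\<lambda>n. grid_fun f (Suc n) t y) \<longlonglongrightarrow> indicator {0<..t} y * f (t - y)"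
proof (cases "y \<in> {0<..t}")
  case False
  then show ?thesis using grid_fun_outside[OF t _ False] by simp
next
  case True
  have "(f \<longlongrightarrow> f (t - y)) (at_right (t - y))"
    using f True by (auto simp: cadlag_def continuous_within)
  show ?thesis
  proof (rule tendstoI)
    fix e :: real assume e: "0 < e"
    have "\<forall>\<^sub>F s in at_right (t - y). dist (f s) (f (t - y)) < e"
      using \<open>(f \<longlongrightarrow> _) _\<close> e by (rule tendstoD)
    then obtain r where r: "t - y < r" "\<And>s. t - y < s \<Longrightarrow> s < r \<Longrightarrow> dist (f s) (f (t - y)) < e"
      unfolding eventually_at_right_field by blast
    have "(\<lambda>n. t * (1 / real (Suc n))) \<longlonglongrightarrow> t * 0"
      by (intro tendsto_intros LIMSEQ_Suc lim_1_over_n)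
    then have "\<forall>\<^sub>F n in sequentially. t * (1 / real (Suc n)) < r - (t - y)"
      using r(1) by (intro order_tendstoD(2)) auto
    then show "\<forall>\<^sub>F n in sequentially. dist (grid_fun f (Suc n) t y) (indicator {0<..t} y * f (t - y)) < e"
    proof eventually_elim
      case (elim n)
      obtain k where k: "k < Suc n" "real k * t / real (Suc n) < y" "y \<le> real (Suc k) * t / real (Suc n)"
        "grid_fun f (Suc n) t y = f (t - real k * t / real (Suc n))"
        using grid_fun_eq[OF t, of "Suc n" y f] True by auto
      have "real (Suc k) * t / real (Suc n) = real k * t / real (Suc n) + t * (1 / real (Suc n))"
        by (simp add: add_divide_distrib distrib_right)
      then have "t - y < t - real k * t / real (Suc n)" "t - real k * t / real (Suc n) < r"
        using k elim by linarith+
      then show ?case using k(4) True r(2) by simp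
    qed
  qed
qed

text \<open>
  The step functions \<open>grid_fun\<close> converge pointwise by right-continuity and are bounded by a constant on the
  bounded interval, so that measurability of the integrand, its integrability and the convergence of the
  integrals all follow by dominated convergence.
\<close>
lemma cadlag_integrand:
  assumes f: "cadlag f" and g: "mono_rc g" and t: "0 < t"
  shows "integrable (stieltjes g) (\<lambda>y. indicator {0<..t} y * f (t - y))"
    and "(\<lambda>n. \<integral>y. grid_fun f (Suc n) t y \<partial>stieltjes g)
           \<longlonglongrightarrow> (\<integral>y. indicator {0<..t} y * f (t - y) \<partial>stieltjes g)"
proof -
  have [measurable]: "grid_fun f n t \<in> borel_measurable (stieltjes g)" for n
    unfolding grid_fun_def by measurable
  have [measurable]: "(\<lambda>y. indicator {0<..t} y * f (t - y)) \<in> borel_measurable (stieltjes g)"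
    by (rule borel_measurable_LIMSEQ_real[OF grid_fun_tendsto[OF f t]]) simp
  obtain B where B: "\<forall>s\<in>{0..t}. \<bar>f s\<bar> \<le> B" using cadlag_bounded[OF f] t by force
  have i: "integrable (stieltjes g) (\<lambda>y. B * indicator {0<..t} y :: real)"
    using emeasure_stieltjes_Ioc[OF g order_refl less_imp_le[OF t]]
    by (intro integrable_mult_right integrable_real_indicator) auto
  have ae: "AE y in stieltjes g. norm (grid_fun f (Suc n) t y) \<le> B * indicator {0<..t} y" for n
  proof (rule AE_I2)
    fix y
    show "norm (grid_fun f (Suc n) t y) \<le> B * indicator {0<..t} y"
    proof (cases "y \<in> {0<..t}")
      case True
      obtain k where k: "k < Suc n" "real k * t / real (Suc n) < y"
        "grid_fun f (Suc n) t y = f (t - real k * t / real (Suc n))"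
        using grid_fun_eq[OF t, of "Suc n" y f] True by auto
      have "t - real k * t / real (Suc n) \<in> {0..t}" using k True t by auto
      then show ?thesis using B k(3) True by simp
    qed (use grid_fun_outside[OF t] in simp)
  qed
  have lim: "AE y in stieltjes g. (\<lambda>n. grid_fun f (Suc n) t y) \<longlonglongrightarrow> indicator {0<..t} y * f (t - y)"
    using grid_fun_tendsto[OF f t] by simp
  show "integrable (stieltjes g) (\<lambda>y. indicator {0<..t} y * f (t - y))"
    by (rule integrable_dominated_convergence[OF _ _ i lim ae]) measurable
  show "(\<lambda>n. \<integral>y. grid_fun f (Suc n) t y \<partial>stieltjes g)
           \<longlonglongrightarrow> (\<integral>y. indicator {0<..t} y * f (t - y) \<partial>stieltjes g)"
    by (rule integral_dominated_convergence[OF _ _ i lim ae]) measurable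
qed

lemma riemann_sum_at_0 [simp]: "riemann_sum f g n 0 = f 0 * g 0"
  by (simp add: riemann_sum_def)

lemma ls_convolution_at_0 [simp]: "ls_convolution f g 0 = f 0 * g 0"
  by (simp add: ls_convolution_def set_lebesgue_integral_def)

text \<open>This characterisation of the convolution carries its algebra: identities are checked for the sums.\<close>
lemma riemann_sum_tendsto:
  assumes f: "cadlag f" and g: "mono_rc g" and t: "0 \<le> t"
  shows "(\<lambda>n. riemann_sum f g (Suc n) t) \<longlonglongrightarrow> ls_convolution f g t"
proof (cases "t = 0")
  case False
  then show ?thesis
    using grid_fun_integral(2)[OF g, of t] t cadlag_integrand(2)[OF f g, of t]
    by (auto simp: ls_convolution_altdef intro!: tendsto_intros)
qed simp

text \<open>
  The two integrands differ by at most \<open>w\<close>.  The estimate depends on the integrator through its total mass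
  only, which makes it uniform over convergent sequences of integrators.
\<close>
lemma riemann_sum_error:
  assumes f: "cadlag f" and g: "mono_rc g" and t: "0 \<le> t" and n: "0 < n"
    and w: "\<And>x y. x \<in> {0..t} \<Longrightarrow> y \<in> {0..t} \<Longrightarrow> \<bar>x - y\<bar> \<le> t / real n \<Longrightarrow> \<bar>f x - f y\<bar> \<le> w"
  shows "\<bar>ls_convolution f g t - riemann_sum f g n t\<bar> \<le> w * (g t - g 0)"
proof (cases "t = 0")
  case False
  then have t: "0 < t" using t by simp
  let ?F = "\<lambda>y. indicator {0<..t} y * f (t - y)"
  note i1 = cadlag_integrand(1)[OF f g t] and i2 = grid_fun_integral(1)[OF g t n, of f]
  have iw: "integrable (stieltjes g) (\<lambda>y. w * indicator {0<..t} y :: real)"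
    using emeasure_stieltjes_Ioc[OF g order_refl less_imp_le[OF t]]
    by (intro integrable_mult_right integrable_real_indicator) auto
  have "ls_convolution f g t - riemann_sum f g n t = (\<integral>y. ?F y - grid_fun f n t y \<partial>stieltjes g)"
    using i1 i2 grid_fun_integral(2)[OF g t n, of f]
    by (simp add: ls_convolution_altdef Bochner_Integration.integral_diff)
  also have "norm \<dots> \<le> (\<integral>y. w * indicator {0<..t} y \<partial>stieltjes g)"
  proof (rule Bochner_Integration.integral_norm_bound_integral[OF _ iw])
    fix y
    show "norm (?F y - grid_fun f n t y) \<le> w * indicator {0<..t} y"
    proof (cases "y \<in> {0<..t}")
      case True
      obtain k where k: "k < n" "real k * t / real n < y" "y \<le> real (Suc k) * t / real n"
        "grid_fun f n t y = f (t - real k * t / real n)"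
        using grid_fun_eq[OF t n, of y f] True by auto
      have "real (Suc k) * t / real n = real k * t / real n + t / real n"
        by (simp add: add_divide_distrib distrib_right)
      then have "\<bar>f (t - y) - f (t - real k * t / real n)\<bar> \<le> w"
        using k True t by (intro w) auto
      then show ?thesis using True k(4) by simp
    qed (use grid_fun_outside[OF t n] in simp)
  qed (use i1 i2 in simp)
  also have "\<dots> = w * (g t - g 0)"
    using measure_stieltjes_Ioc[OF g order_refl less_imp_le[OF t]] by simp
  finally show ?thesis by simp
qed simp

lemma grid_in: "0 \<le> t \<Longrightarrow> k \<le> n \<Longrightarrow> real k * t / real n \<in> {0..t}"
  using mult_right_mono[of "real k" "real n" t]
  by (cases "n = 0") (auto simp: field_simps)

lemma grid_diff_in: "0 \<le> t \<Longrightarrow> k \<le> n \<Longrightarrow> t - real k * t / real n \<in> {0..t}"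
  using grid_in[of t k n] by auto

lemma riemann_sum_telescope:
  fixes g :: "real \<Rightarrow> real"
  assumes "0 < n"
  shows "(\<Sum>k<n. g (real (Suc k) * t / real n) - g (real k * t / real n)) = g t - g 0"
  using sum_lessThan_telescope[of "\<lambda>k. g (real k * t / real n)" n] assms by simp

lemma grid_increment_nonneg:
  assumes "mono_rc g" "0 \<le> t"
  shows "0 \<le> g (real (Suc k) * t / real n) - g (real k * t / real n)"
  using mono_rcD[OF assms(1), of "real k * t / real n" "real (Suc k) * t / real n"] assms(2)
  by (simp add: divide_right_mono mult_right_mono)

lemma ls_convolution_bound:
  assumes f: "cadlag f" and g: "mono_rc g" and t: "0 \<le> t"
    and F: "\<And>s. s \<in> {0..t} \<Longrightarrow> \<bar>f s\<bar> \<le> F"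
  shows "\<bar>ls_convolution f g t\<bar> \<le> F * (\<bar>g 0\<bar> + (g t - g 0))"
proof (rule LIMSEQ_le_const2[OF tendsto_rabs[OF riemann_sum_tendsto[OF f g t]]])
  have F0: "0 \<le> F" using F[of 0] t by simp
  show "\<exists>N. \<forall>n\<ge>N. \<bar>riemann_sum f g (Suc n) t\<bar> \<le> F * (\<bar>g 0\<bar> + (g t - g 0))"
  proof (intro exI allI impI)
    fix n
    let ?d = "\<lambda>k. g (real (Suc k) * t / real (Suc n)) - g (real k * t / real (Suc n))"
    have "\<bar>\<Sum>k<Suc n. f (t - real k * t / real (Suc n)) * ?d k\<bar> \<le> (\<Sum>k<Suc n. F * ?d k)"
    proof (rule order_trans[OF sum_abs sum_mono])
      fix k assume "k \<in> {..<Suc n}"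
      then have "\<bar>f (t - real k * t / real (Suc n))\<bar> \<le> F"
        by (intro F grid_diff_in t) auto
      then show "\<bar>f (t - real k * t / real (Suc n)) * ?d k\<bar> \<le> F * ?d k"
        using grid_increment_nonneg[OF g t, of k "Suc n"] by (simp only: abs_mult abs_of_nonneg mult_right_mono)
    qed
    also have "\<dots> = F * (g t - g 0)"
      by (simp only: sum_distrib_left[symmetric] riemann_sum_telescope[OF zero_less_Suc])
    finally have "\<bar>\<Sum>k<Suc n. f (t - real k * t / real (Suc n)) * ?d k\<bar> \<le> F * (g t - g 0)" .
    moreover have "\<bar>f t * g 0\<bar> \<le> F * \<bar>g 0\<bar>"
      using F[of t] t by (simp add: abs_mult mult_right_mono)
    ultimately show "\<bar>riemann_sum f g (Suc n) t\<bar> \<le> F * (\<bar>g 0\<bar> + (g t - g 0))"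
      unfolding riemann_sum_def distrib_left by linarith
  qed
qed

section \<open>Closure properties of cadlag and monotone functions\<close>

lemma cadlag_minus: "cadlag f \<Longrightarrow> cadlag g \<Longrightarrow> cadlag (\<lambda>s. f s - g s)"
  unfolding cadlag_def by (auto intro!: continuous_intros) (metis tendsto_diff)

lemma cadlag_cmult: "cadlag f \<Longrightarrow> cadlag (\<lambda>s. c * f s)"
  unfolding cadlag_def by (auto intro!: continuous_intros) (metis tendsto_mult_left)

lemma cadlag_add: "cadlag f \<Longrightarrow> cadlag g \<Longrightarrow> cadlag (\<lambda>s. f s + g s)"
  unfolding cadlag_def by (auto intro!: continuous_intros) (metis tendsto_add)

lemma cadlag_const [simp]: "cadlag (\<lambda>s. c)"
  unfolding cadlag_def by (auto intro!: continuous_intros)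

lemma continuous_at_right_scale:
  assumes "continuous (at_right (u * t)) f" "0 < (t::real)"
  shows "continuous (at_right u) (\<lambda>s. f (s * t))"
proof -
  have "filterlim (\<lambda>s. s * t) (at_right (u * t)) (at_right u)"
    using assms(2) by (auto simp: filterlim_at eventually_at_filter intro!: tendsto_eq_intros)
  then show ?thesis
    using assms(1) filterlim_compose unfolding continuous_within by blast
qed

lemma cadlag_scale:
  assumes "cadlag f" "0 < t"
  shows "cadlag (\<lambda>s. f (s * t))"
  unfolding cadlag_def
proof (intro conjI allI impI)
  fix u :: real assume "0 \<le> u"
  then show "continuous (at_right u) (\<lambda>s. f (s * t))"
    using assms by (intro continuous_at_right_scale) (auto simp: cadlag_def)
next
  fix u :: real assume "0 < u"
  then obtain l where "(f \<longlongrightarrow> l) (at_left (u * t))"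
    using assms unfolding cadlag_def by force
  moreover have "filterlim (\<lambda>s. s * t) (at_left (u * t)) (at_left u)"
    using assms(2) by (auto simp: filterlim_at eventually_at_filter intro!: tendsto_eq_intros)
  ultimately show "\<exists>l. ((\<lambda>s. f (s * t)) \<longlongrightarrow> l) (at_left u)"
    using filterlim_compose by blast
qed

lemma mono_rc_scale:
  assumes "mono_rc g" "0 < t"
  shows "mono_rc (\<lambda>s. g (s * t))"
  using assms unfolding mono_rc_def
  by (auto intro!: continuous_at_right_scale mono_onI elim!: mono_onD)

lemma mono_rc_cmult: "mono_rc g \<Longrightarrow> 0 \<le> c \<Longrightarrow> mono_rc (\<lambda>s. c * g s)"
  unfolding mono_rc_def by (auto intro!: continuous_intros mono_onI mult_left_mono elim!: mono_onD)

text \<open>The left limit is the supremum of the values to the left.\<close>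
lemma mono_has_left_limit:
  assumes "mono_on {0..} (g :: real \<Rightarrow> real)" "0 < t"
  shows "\<exists>l. (g \<longlongrightarrow> l) (at_left t)"
proof -
  let ?l = "SUP s\<in>{0..<t}. g s"
  have bdd: "bdd_above (g ` {0..<t})"
    using assms by (auto intro!: bdd_aboveI[of _ "g t"] elim!: mono_onD)
  have "(g \<longlongrightarrow> ?l) (at_left t)"
  proof (rule order_tendstoI)
    fix y assume "y < ?l"
    then obtain s where s: "s \<in> {0..<t}" "y < g s"
      using less_cSUP_iff[OF _ bdd] assms(2) by auto
    have "y < g r" if "r \<in> {s<..<t}" for r
      using mono_onD[OF assms(1), of s r] s that by auto
    then show "\<forall>\<^sub>F r in at_left t. y < g r"
      using s by (intro eventually_at_leftI[of s t]) auto
  next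
    fix y assume y: "?l < y"
    have "g r < y" if "r \<in> {0<..<t}" for r
      using cSUP_upper[OF _ bdd, of r] y that by auto
    then show "\<forall>\<^sub>F r in at_left t. g r < y"
      using assms(2) by (intro eventually_at_leftI[of 0 t]) auto
  qed
  then show ?thesis ..
qed

lemma mono_rc_imp_cadlag: "mono_rc g \<Longrightarrow> cadlag g"
  unfolding mono_rc_def cadlag_def using mono_has_left_limit by blast

lemma continuous_on_imp_cadlag:
  assumes "continuous_on {0..} (f :: real \<Rightarrow> real)"
  shows "cadlag f"
  unfolding cadlag_def
proof (intro conjI allI impI)
  fix t :: real assume t: "0 \<le> t"
  then have "continuous (at t within {0..}) f"
    using assms by (simp add: continuous_on_eq_continuous_within)
  then show "continuous (at_right t) f"
    by (rule continuous_within_subset) (use t in auto)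
next
  fix t :: real assume t: "0 < t"
  have "continuous (at t within {0..}) f"
    using assms t by (simp add: continuous_on_eq_continuous_within)
  then have "(f \<longlongrightarrow> f t) (at t)"
    using t by (simp add: continuous_within at_within_interior[of t "{0..}"])
  then have "(f \<longlongrightarrow> f t) (at_left t)" by (rule filterlim_at_split[THEN iffD1, THEN conjunct1])
  then show "\<exists>l. (f \<longlongrightarrow> l) (at_left t)" ..
qed

section \<open>Algebra of Stieltjes convolutions\<close>

lemma riemann_sum_linear:
  "riemann_sum (\<lambda>s. c * f s + d * h s) g n t = c * riemann_sum f g n t + d * riemann_sum h g n t"
  by (simp add: riemann_sum_def algebra_simps sum.distrib sum_distrib_left sum_subtractf)

lemma ls_convolution_linear:
  assumes "cadlag f" "cadlag h" "mono_rc g" "0 \<le> t"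
  shows "ls_convolution (\<lambda>s. c * f s + d * h s) g t = c * ls_convolution f g t + d * ls_convolution h g t"
proof (rule LIMSEQ_unique[OF riemann_sum_tendsto])
  show "(\<lambda>n. riemann_sum (\<lambda>s. c * f s + d * h s) g (Suc n) t)
      \<longlonglongrightarrow> c * ls_convolution f g t + d * ls_convolution h g t"
    unfolding riemann_sum_linear using assms by (intro tendsto_intros riemann_sum_tendsto)
qed (use assms in \<open>auto intro!: cadlag_add cadlag_cmult\<close>)

lemma ls_convolution_minus:
  assumes "cadlag f" "cadlag h" "mono_rc g" "0 \<le> t"
  shows "ls_convolution (\<lambda>s. f s - h s) g t = ls_convolution f g t - ls_convolution h g t"
  using ls_convolution_linear[OF assms, of 1 "-1"] by simp

lemma ls_convolution_cmult_left:
  assumes "cadlag f" "mono_rc g" "0 \<le> t"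
  shows "ls_convolution (\<lambda>s. c * f s) g t = c * ls_convolution f g t"
  using ls_convolution_linear[OF assms(1) assms(1) assms(2,3), of c 0] by simp

lemma ls_convolution_cmult_right:
  assumes "cadlag f" "mono_rc g" "0 \<le> c" "0 \<le> t"
  shows "ls_convolution f (\<lambda>s. c * g s) t = c * ls_convolution f g t"
proof (rule LIMSEQ_unique[OF riemann_sum_tendsto])
  have "riemann_sum f (\<lambda>s. c * g s) n t = c * riemann_sum f g n t" for n
    by (simp add: riemann_sum_def algebra_simps sum_distrib_left)
  then show "(\<lambda>n. riemann_sum f (\<lambda>s. c * g s) (Suc n) t) \<longlonglongrightarrow> c * ls_convolution f g t"
    using assms by (auto intro!: tendsto_intros riemann_sum_tendsto)
qed (use assms in \<open>auto intro!: mono_rc_cmult\<close>)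

text \<open>
  The grid of \<open>[0, ut]\<close> is the grid of \<open>[0, u]\<close> multiplied by \<open>t\<close>, so the Riemann sums agree term by
  term.
\<close>
lemma ls_convolution_scale:
  assumes "cadlag f" "mono_rc g" "0 \<le> u" "0 < t"
  shows "ls_convolution f g (u * t) = ls_convolution (\<lambda>s. f (s * t)) (\<lambda>s. g (s * t)) u"
proof (rule LIMSEQ_unique[OF _ riemann_sum_tendsto])
  have "riemann_sum (\<lambda>s. f (s * t)) (\<lambda>s. g (s * t)) n u = riemann_sum f g n (u * t)" for n
    by (simp add: riemann_sum_def left_diff_distrib mult.assoc)
  then show "(\<lambda>n. riemann_sum (\<lambda>s. f (s * t)) (\<lambda>s. g (s * t)) (Suc n) u) \<longlonglongrightarrow> ls_convolution f g (u * t)"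
    using assms by (auto intro!: riemann_sum_tendsto)
qed (use assms in \<open>auto intro!: mono_rc_scale cadlag_scale\<close>)

lemma ls_convolution_cong:
  assumes "\<And>s. 0 \<le> s \<Longrightarrow> f s = f' s" "\<And>s. 0 \<le> s \<Longrightarrow> g s = g' s" "0 \<le> t"
  shows "ls_convolution f g t = ls_convolution f' g' t"
proof -
  have "(\<lambda>y. g (max 0 y)) = (\<lambda>y. g' (max 0 y))" using assms by auto
  moreover have "(\<lambda>y. indicator {0<..t} y * f (t - y)) = (\<lambda>y. indicator {0<..t} y * f' (t - y))"
    using assms by (auto simp: indicator_def)
  ultimately show ?thesis using assms by (simp add: ls_convolution_altdef stieltjes_def)
qed

text \<open>Abel summation, followed by reversal of the order of summation.\<close>
lemma riemann_sum_commute: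
  assumes "0 < n"
  shows "riemann_sum f g n t = riemann_sum g f n t"
proof -
  define F G where "F k = f (real k * t / real n)" and "G k = g (real k * t / real n)" for k
  have reversed: "t - real k * t / real n = real (n - k) * t / real n" if "k \<le> n" for k
    using that assms by (simp add: field_simps of_nat_diff)
  have rs: "riemann_sum f g n t = F n * G 0 + (\<Sum>k<n. F (n - k) * (G (Suc k) - G k))"
    "riemann_sum g f n t = G n * F 0 + (\<Sum>k<n. G (n - k) * (F (Suc k) - F k))"
    using assms by (auto simp: riemann_sum_def F_def G_def reversed)
  have "F n * G 0 + (\<Sum>k<n. F (n - k) * (G (Suc k) - G k))
      = G n * F 0 + (\<Sum>k<n. G (Suc k) * (F (n - k) - F (n - Suc k)))"
  proof -
    have "(\<Sum>k<n. F (n - k) * (G (Suc k) - G k)) - (\<Sum>k<n. G (Suc k) * (F (n - k) - F (n - Suc k)))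
        = (\<Sum>k<n. G (Suc k) * F (n - Suc k) - G k * F (n - k))"
      by (simp add: sum_subtractf[symmetric] algebra_simps)
    also have "\<dots> = G n * F 0 - G 0 * F n"
      by (simp add: sum_lessThan_telescope[of "\<lambda>k. G k * F (n - k)"])
    finally show ?thesis by (simp add: algebra_simps)
  qed
  also have "(\<Sum>k<n. G (Suc k) * (F (n - k) - F (n - Suc k))) = (\<Sum>k<n. G (n - k) * (F (Suc k) - F k))"
    by (subst sum.nat_diff_reindex[symmetric], intro sum.cong)
       (auto simp: Suc_diff_Suc)
  finally show ?thesis by (simp add: rs)
qed

lemma ls_convolution_commute:
  assumes "mono_rc f" "mono_rc g" "0 \<le> t"
  shows "ls_convolution f g t = ls_convolution g f t"
proof (rule LIMSEQ_unique[OF riemann_sum_tendsto])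
  show "(\<lambda>n. riemann_sum f g (Suc n) t) \<longlonglongrightarrow> ls_convolution g f t"
    using riemann_sum_tendsto[of g f t] assms mono_rc_imp_cadlag
    by (simp add: riemann_sum_commute[OF zero_less_Suc, of f g])
qed (use assms mono_rc_imp_cadlag in auto)

section \<open>Regularity of convolutions\<close>

lemma finite_stieltjes_Ioc: "mono_rc g \<Longrightarrow> 0 \<le> a \<Longrightarrow> a \<le> b \<Longrightarrow> emeasure (stieltjes g) {a<..b} < \<infinity>"
  by (simp add: emeasure_stieltjes_Ioc)

text \<open>
  Along monotone sequences the integrands converge pointwise: to the integrand at \<open>t\<close> from the right, and from the
  left to the integrand made of the left limits of \<open>f\<close>, with the atom at \<open>y = t\<close> removed.
\<close>
lemma cadlag_ls_convolution:
  assumes f: "cadlag f" and g: "mono_rc g"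
  shows "cadlag (ls_convolution f g)"
proof -
  define J where "J t = (\<integral>y. indicator {0<..t} y * f (t - y) \<partial>stieltjes g)" for t
  have eq: "ls_convolution f g = (\<lambda>t. f t * g 0 + J t)"
    by (rule ext) (simp add: ls_convolution_altdef J_def)
  have meas: "(\<lambda>y. indicator {0<..t} y * f (t - y)) \<in> borel_measurable (stieltjes g)" if "0 < t" for t
    using borel_measurable_integrable[OF cadlag_integrand(1)[OF f g that]] .
  have dom: "(\<lambda>n. J (S n)) \<longlonglongrightarrow> (\<integral>y. h y \<partial>stieltjes g)"
    if S: "\<And>n. 0 < S n" "\<And>n. S n \<le> T"
      and lim: "\<And>y. (\<lambda>n. indicator {0<..S n} y * f (S n - y)) \<longlonglongrightarrow> h y" for S h T
  proof -
    have T: "0 \<le> T" using S[of 0] by linarith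
    obtain B where B: "\<forall>s\<in>{0..T}. \<bar>f s\<bar> \<le> B" using cadlag_bounded[OF f T] ..
    have B0: "0 \<le> B" using bspec[OF B, of 0] T by simp
    show ?thesis unfolding J_def
    proof (rule integral_dominated_convergence[where w = "\<lambda>y. B * indicator {0<..T} y"])
      show "h \<in> borel_measurable (stieltjes g)"
        by (rule borel_measurable_LIMSEQ_real[OF lim meas[OF S(1)]])
      show "integrable (stieltjes g) (\<lambda>y. B * indicator {0<..T} y)"
        using finite_stieltjes_Ioc[OF g order_refl T]
        by (intro integrable_mult_right integrable_real_indicator) auto
      have "\<bar>indicator {0<..S n} y * f (S n - y)\<bar> \<le> B * indicator {0<..T} y" for n y
        using B B0 S(2)[of n] by (auto simp: indicator_def)
      then show "AE y in stieltjes g. norm (indicator {0<..S n} y * f (S n - y)) \<le> B * indicator {0<..T} y" for n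
        by simp
    qed (use lim meas[OF S(1)] in auto)
  qed
  have right: "(J \<longlongrightarrow> J t) (at_right t)" if t: "0 \<le> t" for t
  proof (rule tendsto_at_right_sequentially[of t "t + 1"])
    fix S :: "nat \<Rightarrow> real"
    assume S: "\<And>n. t < S n" "\<And>n. S n < t + 1" "decseq S" "S \<longlonglongrightarrow> t"
    have "(\<lambda>n. indicator {0<..S n} y * f (S n - y)) \<longlonglongrightarrow> indicator {0<..t} y * f (t - y)" for y
    proof (cases "t < y")
      case True
      then have "\<forall>\<^sub>F n in sequentially. S n < y" using S(4) by (intro order_tendstoD(2)) auto
      then have "\<forall>\<^sub>F n in sequentially. indicator {0<..S n} y * f (S n - y) = indicator {0<..t} y * f (t - y)"
        by eventually_elim (use True in \<open>auto simp: indicator_def\<close>)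
      then show ?thesis by (rule tendsto_eventually)
    next
      case False
      have "(f \<longlongrightarrow> f (t - y)) (at_right (t - y))"
        using f False by (auto simp: cadlag_def continuous_within)
      moreover have "filterlim (\<lambda>n. S n - y) (at_right (t - y)) sequentially"
        using S(4) S(1)[THEN less_imp_neq] S(1)[THEN less_imp_neq, symmetric]
          by (auto simp: filterlim_at S(1) intro!: tendsto_intros always_eventually)
      ultimately have "(\<lambda>n. f (S n - y)) \<longlonglongrightarrow> f (t - y)" by (rule filterlim_compose)
      moreover have "indicator {0<..S n} y = (indicator {0<..t} y :: real)" for n
        using False S(1)[of n] by (auto simp: indicator_def)
      ultimately show ?thesis by (simp add: tendsto_mult_left)
    qed
    moreover have "0 < S n" for n using S(1)[of n] t by linarith
    ultimately show "(\<lambda>n. J (S n)) \<longlonglongrightarrow> J t"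
      using dom[of S "t + 1"] S(2) by (simp add: J_def less_imp_le)
  qed simp
  have left: "\<exists>l. (J \<longlongrightarrow> l) (at_left t)" if t: "0 < t" for t
  proof -
    have "\<exists>l. 0 < s \<longrightarrow> (f \<longlongrightarrow> l) (at_left s)" for s
      using f unfolding cadlag_def by blast
    then obtain L where L: "\<And>s. 0 < s \<Longrightarrow> (f \<longlongrightarrow> L s) (at_left s)" by metis
    have "(J \<longlongrightarrow> (\<integral>y. indicator {0<..<t} y * L (t - y) \<partial>stieltjes g)) (at_left t)"
    proof (rule tendsto_at_left_sequentially[of 0 t, OF t])
      fix S :: "nat \<Rightarrow> real"
      assume S: "\<And>n. S n < t" "\<And>n. 0 < S n" "incseq S" "S \<longlonglongrightarrow> t"
      have "(\<lambda>n. indicator {0<..S n} y * f (S n - y)) \<longlonglongrightarrow> indicator {0<..<t} y * L (t - y)" for y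
      proof (cases "y < t")
        case False
        then have "indicator {0<..S n} y = (0::real)" "indicator {0<..<t} y = (0::real)" for n
          using S(1)[of n] by (auto simp: indicator_def)
        then show ?thesis by simp
      next
        case True
        have "filterlim (\<lambda>n. S n - y) (at_left (t - y)) sequentially"
          using S(4) S(1)[THEN less_imp_neq] S(1)[THEN less_imp_neq, symmetric]
          by (auto simp: filterlim_at S(1) intro!: tendsto_intros always_eventually)
        then have *: "(\<lambda>n. f (S n - y)) \<longlonglongrightarrow> L (t - y)"
          using L[of "t - y"] True by (auto intro: filterlim_compose)
        have "\<forall>\<^sub>F n in sequentially. y < S n" using S(4) True by (intro order_tendstoD(1)) auto
        then have "\<forall>\<^sub>F n in sequentially. indicator {0<..S n} y * f (S n - y) = indicator {0<..<t} y * f (S n - y)"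
          by eventually_elim (use True in \<open>auto simp: indicator_def\<close>)
        then show ?thesis by (rule tendsto_cong[THEN iffD2]) (intro tendsto_intros *)
      qed
      then show "(\<lambda>n. J (S n)) \<longlonglongrightarrow> (\<integral>y. indicator {0<..<t} y * L (t - y) \<partial>stieltjes g)"
        using S(1,2) by (intro dom[of S t]) (auto intro: less_imp_le)
    qed
    then show ?thesis ..
  qed
  show ?thesis unfolding eq cadlag_def
  proof (intro conjI allI impI)
    fix t :: real assume "0 \<le> t"
    then show "continuous (at_right t) (\<lambda>t. f t * g 0 + J t)"
      using right f by (auto simp: cadlag_def continuous_within intro!: tendsto_intros)
  next
    fix t :: real assume t: "0 < t"
    obtain l l' where "(f \<longlongrightarrow> l) (at_left t)" "(J \<longlongrightarrow> l') (at_left t)"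
      using t left f unfolding cadlag_def by blast
    then have "((\<lambda>t. f t * g 0 + J t) \<longlongrightarrow> l * g 0 + l') (at_left t)" by (intro tendsto_intros)
    then show "\<exists>l. ((\<lambda>t. f t * g 0 + J t) \<longlongrightarrow> l) (at_left t)" ..
  qed
qed

text \<open>Nonnegativity at 0 is essential: a negative atom of \<open>g\<close> at 0 contributes the nonincreasing summand \<open>f t * g 0\<close>.\<close>
lemma mono_rc_ls_convolution:
  assumes f: "mono_rc f" "0 \<le> f 0" and g: "mono_rc g" "0 \<le> g 0"
  shows "mono_rc (ls_convolution f g)"
  unfolding mono_rc_def
proof (intro conjI)
  note cf = mono_rc_imp_cadlag[OF f(1)]
  show "\<forall>t\<ge>0. continuous (at_right t) (ls_convolution f g)"
    using cadlag_ls_convolution[OF cf g(1)] by (simp add: cadlag_def)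
  show "mono_on {0..} (ls_convolution f g)"
  proof (rule mono_onI)
    fix s t :: real assume st: "s \<in> {0..}" "t \<in> {0..}" "s \<le> t"
    have f0: "0 \<le> f r" if "0 \<le> r" for r using mono_rcD[OF f(1) _ that] f(2) by simp
    show "ls_convolution f g s \<le> ls_convolution f g t"
    proof (cases "s = 0")
      case True
      have "0 \<le> (\<integral>y. indicator {0<..t} y * f (t - y) \<partial>stieltjes g)"
        by (rule Bochner_Integration.integral_nonneg) (auto simp: indicator_def f0)
      moreover have "f 0 * g 0 \<le> f t * g 0"
        using mono_rcD[OF f(1), of 0 t] st g(2) by (intro mult_right_mono) auto
      ultimately show ?thesis using True by (simp add: ls_convolution_altdef)
    next
      case False
      then have st': "0 < s" "0 < t" using st by auto
      have "(\<integral>y. indicator {0<..s} y * f (s - y) \<partial>stieltjes g) \<le> (\<integral>y. indicator {0<..t} y * f (t - y) \<partial>stieltjes g)"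
        using cadlag_integrand(1)[OF cf g(1) st'(1)] cadlag_integrand(1)[OF cf g(1) st'(2)] st
        by (intro Bochner_Integration.integral_mono)
           (auto simp: indicator_def f0 intro!: mono_rcD[OF f(1)])
      moreover have "f s * g 0 \<le> f t * g 0"
        using mono_rcD[OF f(1), of s t] st g(2) by (intro mult_right_mono) auto
      ultimately show ?thesis by (simp add: ls_convolution_altdef)
    qed
  qed
qed

section \<open>Uniform convergence of convolutions\<close>

lemma uniform_modulus:
  assumes "continuous_on {0..} (f :: real \<Rightarrow> real)" "0 < e"
  obtains d where "0 < d" "\<And>x y. x \<in> {0..U} \<Longrightarrow> y \<in> {0..U} \<Longrightarrow> \<bar>x - y\<bar> \<le> d \<Longrightarrow> \<bar>f x - f y\<bar> \<le> e"
proof -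
  have "uniformly_continuous_on {0..U} f"
    using assms(1) by (intro compact_uniformly_continuous) (auto intro: continuous_on_subset)
  then obtain d where d: "0 < d"
    "\<And>x y. x \<in> {0..U} \<Longrightarrow> y \<in> {0..U} \<Longrightarrow> dist x y < d \<Longrightarrow> dist (f x) (f y) < e"
    using assms(2) unfolding uniformly_continuous_on_def by (metis dist_commute)
  show thesis by (rule that[of "d/2"]) (use d in \<open>auto simp: dist_real_def intro!: less_imp_le\<close>)
qed

text \<open>One mesh serves all integrators and all arguments in \<open>[0, U]\<close>, by uniform continuity of \<open>f\<close>.\<close>
lemma riemann_sum_uniform:
  assumes f: "continuous_on {0..} f" and e: "0 < e"
  obtains n where "0 < n" "\<And>g u. mono_rc g \<Longrightarrow> u \<in> {0..U} \<Longrightarrow>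
      \<bar>ls_convolution f g u - riemann_sum f g n u\<bar> \<le> e * (g u - g 0)"
proof -
  obtain d where d: "0 < d" "\<And>x y. x \<in> {0..U} \<Longrightarrow> y \<in> {0..U} \<Longrightarrow> \<bar>x - y\<bar> \<le> d \<Longrightarrow> \<bar>f x - f y\<bar> \<le> e"
    using uniform_modulus[OF f e] by blast
  obtain n where "U / d < real n" using reals_Archimedean2 by blast
  then have n: "U / real (Suc n) \<le> d" using d(1) by (simp add: field_simps)
  show thesis
  proof (rule that[of "Suc n"])
    fix g u assume g: "mono_rc g" and u: "u \<in> {0..U}"
    have "u / real (Suc n) \<le> d" using u n by (auto intro: order_trans[OF divide_right_mono])
    then show "\<bar>ls_convolution f g u - riemann_sum f g (Suc n) u\<bar> \<le> e * (g u - g 0)"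
      using u g f by (intro riemann_sum_error d(2) continuous_on_imp_cadlag) auto
  qed simp
qed

lemma continuous_on_riemann_sum:
  assumes f: "continuous_on {0..} f" and g: "continuous_on {0..} g"
  shows "continuous_on {0..} (riemann_sum f g n)"
proof -
  have *: "continuous_on {0..} (\<lambda>t. f (t - real k * t / real n))" if "k < n" for k
  proof (rule continuous_on_compose2[OF f])
    show "continuous_on {0..} (\<lambda>t. t - real k * t / real n)"
      using that by (intro continuous_on_diff continuous_on_divide continuous_on_mult continuous_on_id continuous_on_const) auto
    show "(\<lambda>t. t - real k * t / real n) ` {0..} \<subseteq> {0..}"
      using grid_diff_in[OF _ less_imp_le[OF that]] by (intro image_subsetI) simp
  qed
  have **: "continuous_on {0..} (\<lambda>t. g (real k * t / real n))" if "0 < n" for k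
    using that by (intro continuous_on_compose2[OF g]) (auto intro!: continuous_intros)
  have summand: "continuous_on {0..} (\<lambda>t. f (t - real k * t / real n) *
      (g (real (Suc k) * t / real n) - g (real k * t / real n)))" if "k \<in> {..<n}" for k
  proof -
    have "k < n" "0 < n" using that by auto
    then show ?thesis by (intro continuous_on_mult continuous_on_diff * **)
  qed
  show ?thesis unfolding riemann_sum_def
    by (rule continuous_on_add[OF continuous_on_mult[OF f continuous_on_const] continuous_on_sum[OF summand]])
qed

text \<open>Near \<open>x\<close> the half-line coincides with \<open>[0, x + 1]\<close>.\<close>
lemma continuous_on_half_line:
  assumes "\<And>U. continuous_on {0..U} (f :: real \<Rightarrow> real)"
  shows "continuous_on {0..} f"
  unfolding continuous_on_eq_continuous_within
proof
  fix x :: real assume x: "x \<in> {0..}"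
  have "continuous (at x within {0..x + 1}) f"
    using assms[of "x + 1"] x by (auto simp: continuous_on_eq_continuous_within)
  moreover have "at x within {0..} = at x within {0..x + 1}"
    using x by (intro at_within_nhd[of x "{..<x + 1}"]) auto
  ultimately show "continuous (at x within {0..}) f" by simp
qed

text \<open>The convolution is the uniform limit of its Riemann sums, which are continuous.\<close>
lemma continuous_on_ls_convolution:
  assumes f: "continuous_on {0..} f" and g: "mono_rc g" "continuous_on {0..} g"
  shows "continuous_on {0..} (ls_convolution f g)"
proof (rule continuous_on_half_line)
  fix U :: real
  show "continuous_on {0..U} (ls_convolution f g)"
  proof (cases "0 \<le> U")
    case True
    have gU: "0 \<le> g U - g 0" using mono_rcD[OF g(1) _ True] by simp
    have "\<exists>n. \<forall>u\<in>{0..U}. dist (riemann_sum f g n u) (ls_convolution f g u) \<le> e" if e: "0 < e" for e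
    proof -
      have "0 < e / (g U - g 0 + 1)" using e gU by simp
      then obtain n where n: "\<And>u. u \<in> {0..U} \<Longrightarrow>
          \<bar>ls_convolution f g u - riemann_sum f g n u\<bar> \<le> e / (g U - g 0 + 1) * (g u - g 0)"
        using riemann_sum_uniform[OF f] g(1) by metis
      have "e / (g U - g 0 + 1) * (g u - g 0) \<le> e" if "u \<in> {0..U}" for u
      proof -
        have "g u - g 0 \<le> g U - g 0 + 1" using mono_rcD[OF g(1), of u U] that by auto
        then have "e * (g u - g 0) \<le> e * (g U - g 0 + 1)" using e by (intro mult_left_mono) auto
        then show ?thesis using gU by (simp add: divide_le_eq)
      qed
      then show ?thesis using n by (intro exI[of _ n]) (force simp: dist_real_def abs_minus_commute)
    qed
    then have "\<forall>k. \<exists>n. \<forall>u\<in>{0..U}. dist (riemann_sum f g n u) (ls_convolution f g u) \<le> 1 / real (Suc k)"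
      by simp
    then obtain N where N: "\<And>k u. u \<in> {0..U} \<Longrightarrow> dist (riemann_sum f g (N k) u) (ls_convolution f g u) \<le> 1 / real (Suc k)"
      by metis
    have "uniform_limit {0..U} (\<lambda>k. riemann_sum f g (N k)) (ls_convolution f g) sequentially"
    proof (rule uniform_limitI)
      fix e :: real assume "0 < e"
      then have "\<forall>\<^sub>F k in sequentially. 1 / real (Suc k) < e"
        using LIMSEQ_Suc[OF lim_1_over_n] by (intro order_tendstoD(2)) auto
      then show "\<forall>\<^sub>F k in sequentially. \<forall>u\<in>{0..U}. dist (riemann_sum f g (N k) u) (ls_convolution f g u) < e"
        by eventually_elim (use N le_less_trans in blast)
    qed
    then show ?thesis
      by (intro uniform_limit_theorem[where f = "\<lambda>k. riemann_sum f g (N k)" and F = sequentially])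
         (auto intro!: always_eventually continuous_on_subset[OF continuous_on_riemann_sum[OF f g(2)]])
  qed simp
qed

text \<open>The sum involves the value of the integrator at 0 and \<open>n\<close> of its increments.\<close>
lemma riemann_sum_diff_bound:
  assumes f: "\<And>s. s \<in> {0..U} \<Longrightarrow> \<bar>f s\<bar> \<le> F" and g: "\<And>s. s \<in> {0..U} \<Longrightarrow> \<bar>g s - h s\<bar> \<le> d"
    and u: "u \<in> {0..U}"
  shows "\<bar>riemann_sum f g n u - riemann_sum f h n u\<bar> \<le> F * d * (2 * real n + 1)"
proof -
  define A where "A k = f (u - real k * u / real n)" for k
  define E where "E k = g (real k * u / real n) - h (real k * u / real n)" for k
  have F0: "0 \<le> F" using f[OF u] by linarith
  have A: "\<bar>A k\<bar> \<le> F" and E: "\<bar>E k\<bar> \<le> d" if "k \<le> n" for k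
  proof -
    have u': "0 \<le> u" "u \<le> U" using u by auto
    have "0 \<le> real k * u / real n" "real k * u / real n \<le> u"
      using grid_in[OF u'(1) that] by (simp_all only: atLeastAtMost_iff)
    then have "real k * u / real n \<in> {0..U} \<and> u - real k * u / real n \<in> {0..U}"
      using u' unfolding atLeastAtMost_iff by linarith
    then have "real k * u / real n \<in> {0..U}" "u - real k * u / real n \<in> {0..U}" by blast+
    from f[OF this(2)] g[OF this(1)] show "\<bar>A k\<bar> \<le> F" "\<bar>E k\<bar> \<le> d"
      by (simp_all only: A_def E_def)
  qed
  have "riemann_sum f g n u - riemann_sum f h n u = f u * (g 0 - h 0) +
      ((\<Sum>k<n. A k * (g (real (Suc k) * u / real n) - g (real k * u / real n))) -
       (\<Sum>k<n. A k * (h (real (Suc k) * u / real n) - h (real k * u / real n))))"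
    unfolding riemann_sum_def A_def right_diff_distrib by linarith
  also have "\<dots> = f u * (g 0 - h 0) + (\<Sum>k<n. A k * (E (Suc k) - E k))"
    unfolding sum_subtractf[symmetric] right_diff_distrib[symmetric] E_def
    by (intro arg_cong2[where f = "(+)"] sum.cong refl arg_cong2[where f = "(*)"]) linarith
  finally have eq: "riemann_sum f g n u - riemann_sum f h n u = f u * (g 0 - h 0) + (\<Sum>k<n. A k * (E (Suc k) - E k))" .
  have "\<bar>f u * (g 0 - h 0)\<bar> \<le> F * d"
    unfolding abs_mult using f[OF u] g[of 0] u F0 by (intro mult_mono) auto
  moreover have "\<bar>\<Sum>k<n. A k * (E (Suc k) - E k)\<bar> \<le> (\<Sum>k<n. F * (2 * d))"
  proof (rule order_trans[OF sum_abs sum_mono])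
    fix k assume "k \<in> {..<n}"
    then have k: "k \<le> n" "Suc k \<le> n" by auto
    have "\<bar>E (Suc k) - E k\<bar> \<le> 2 * d" using E[OF k(1)] E[OF k(2)] by linarith
    then show "\<bar>A k * (E (Suc k) - E k)\<bar> \<le> F * (2 * d)"
      unfolding abs_mult using A[OF k(1)] F0 by (intro mult_mono) auto
  qed
  moreover have "F * d + (\<Sum>k<n. F * (2 * d)) = F * d * (2 * real n + 1)" by (simp add: algebra_simps)
  ultimately show ?thesis unfolding eq by linarith
qed

text \<open>
  Joint continuity of the convolution.  Replacing \<open>f n\<close> by \<open>f'\<close> costs the uniform distance times the mass of
  \<open>g n\<close>.  For the continuous \<open>f'\<close> both convolutions are within a small error of Riemann sums with the same mesh,
  and for a fixed mesh the Riemann sums converge.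
\<close>
lemma ls_convolution_uniform_limit:
  assumes f: "\<And>n::nat. cadlag (f n)" and g: "\<And>n. mono_rc (g n)"
    and f': "continuous_on {0..} f'" and g': "mono_rc g'" and U: "0 \<le> U"
    and limf: "uniform_limit {0..U} f f' sequentially"
    and limg: "uniform_limit {0..U} g g' sequentially"
  shows "uniform_limit {0..U} (\<lambda>n. ls_convolution (f n) (g n)) (ls_convolution f' g') sequentially"
proof (rule uniform_limitI)
  fix e :: real assume e: "0 < e"
  note cf' = continuous_on_imp_cadlag[OF f']
  obtain F where F: "\<forall>s\<in>{0..U}. \<bar>f' s\<bar> \<le> F" using cadlag_bounded[OF cf' U] ..
  have F0: "0 \<le> F" using bspec[OF F, of 0] U by simp
  define G where "G = \<bar>g' 0\<bar> + (g' U - g' 0) + 3"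
  have G: "3 \<le> G" using mono_rcD[OF g' _ U] by (simp add: G_def)
  \<comment> \<open>\<open>G\<close> bounds the mass of \<open>g'\<close> and of every \<open>g n\<close> at distance at most 1 from it; each error below is at most \<open>e/4\<close>.\<close>
  define e1 where "e1 = e / (4 * G)"
  have e1: "0 < e1" "e1 * G = e / 4" using e G by (auto simp: e1_def)
  obtain m where m: "0 < m" "\<And>g u. mono_rc g \<Longrightarrow> u \<in> {0..U} \<Longrightarrow>
      \<bar>ls_convolution f' g u - riemann_sum f' g m u\<bar> \<le> e1 * (g u - g 0)"
    using riemann_sum_uniform[OF f' e1(1), of U] by metis
  define d where "d = min 1 (e / (8 * (F + 1) * (2 * real m + 1)))"
  have d: "0 < d" "d \<le> 1" using e F0 by (auto simp: d_def)
  have "F * d * (2 * real m + 1) \<le> (F + 1) * (e / (8 * (F + 1) * (2 * real m + 1))) * (2 * real m + 1)"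
    using F0 e by (intro mult_right_mono mult_mono) (auto simp: d_def)
  also have "\<dots> = e / 8" using F0 by (simp add: divide_simps)
  finally have d8: "F * d * (2 * real m + 1) \<le> e / 8" .
  have "\<forall>\<^sub>F n in sequentially. \<forall>u\<in>{0..U}. dist (f n u) (f' u) < e1"
    using uniform_limitD[OF limf e1(1)] .
  moreover have "\<forall>\<^sub>F n in sequentially. \<forall>u\<in>{0..U}. dist (g n u) (g' u) < d"
    using uniform_limitD[OF limg d(1)] .
  ultimately show "\<forall>\<^sub>F n in sequentially. \<forall>u\<in>{0..U}.
      dist (ls_convolution (f n) (g n) u) (ls_convolution f' g' u) < e"
  proof eventually_elim
    case (elim n)
    show ?case
    proof
      fix u assume u: "u \<in> {0..U}"
      have gd: "\<bar>g n s - g' s\<bar> \<le> d" if "s \<in> {0..U}" for s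
        using elim(2) that by (auto simp: dist_real_def intro: less_imp_le)
      have mono: "g n u \<le> g n U" "g' u \<le> g' U" "g n 0 \<le> g n u" "g' 0 \<le> g' u"
        using mono_rcD[OF g] mono_rcD[OF g'] u by auto
      have b: "\<bar>g n 0\<bar> + (g n u - g n 0) \<le> G" "g n u - g n 0 \<le> G" "g' u - g' 0 \<le> G"
        using mono gd[of 0] gd[of U] U d by (auto simp: G_def)
      have "\<bar>ls_convolution (\<lambda>s. f n s - f' s) (g n) u\<bar> \<le> e1 * (\<bar>g n 0\<bar> + (g n u - g n 0))"
        using u elim(1) by (intro ls_convolution_bound cadlag_minus f cf' g)
          (auto simp: dist_real_def intro!: less_imp_le)
      also have "\<dots> \<le> e / 4" using b(1) e1 by (metis mult_left_mono less_imp_le)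
      finally have 1: "\<bar>ls_convolution (f n) (g n) u - ls_convolution f' (g n) u\<bar> \<le> e / 4"
        using u by (simp add: ls_convolution_minus[OF f cf' g])
      have 2: "\<bar>ls_convolution f' (g n) u - riemann_sum f' (g n) m u\<bar> \<le> e / 4"
        using m(2)[OF g u, of n] b(2) e1 by (smt (verit) mult_left_mono)
      have 3: "\<bar>ls_convolution f' g' u - riemann_sum f' g' m u\<bar> \<le> e / 4"
        using m(2)[OF g' u] b(3) e1 by (smt (verit) mult_left_mono)
      have 4: "\<bar>riemann_sum f' (g n) m u - riemann_sum f' g' m u\<bar> \<le> e / 8"
        using riemann_sum_diff_bound[of U f' F "g n" g' d u m] F gd u d8 by force
      show "dist (ls_convolution (f n) (g n) u) (ls_convolution f' g' u) < e"
        unfolding dist_real_def using 1 2 3 4 e by linarith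
    qed
  qed
qed

section \<open>Associativity\<close>

definition delay :: "real \<Rightarrow> (real \<Rightarrow> real) \<Rightarrow> real \<Rightarrow> real" where
  "delay s f v = (if s \<le> v then f (v - s) else 0)"

text \<open>
  Delays commute with convolution; the delayed constant 1 is the distribution function of a unit mass at
  \<open>s\<close>, whose convolution with \<open>g\<close> is the delay of \<open>g\<close>.
\<close>
lemma ls_convolution_delay:
  assumes "0 \<le> s"
  shows "ls_convolution (delay s f) g u = delay s (ls_convolution f g) u"
proof (cases "s \<le> u")
  case True
  have "(\<lambda>y. indicator {0<..u} y * delay s f (u - y)) = (\<lambda>y. indicator {0<..u - s} y * f (u - s - y))"
    using assms by (auto simp: delay_def indicator_def algebra_simps fun_eq_iff)
  then show ?thesis using True by (simp add: ls_convolution_altdef delay_def)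
next
  case False
  have "(\<lambda>y. indicator {0<..u} y * delay s f (u - y)) = (\<lambda>y. 0)"
    using False by (auto simp: delay_def indicator_def fun_eq_iff)
  then show ?thesis using False by (simp add: ls_convolution_altdef delay_def)
qed

lemma ls_convolution_one_left:
  assumes "mono_rc g" "0 \<le> u"
  shows "ls_convolution (\<lambda>s. 1) g u = g u"
  using measure_stieltjes_Ioc[OF assms(1) order_refl assms(2)]
  by (simp add: ls_convolution_altdef)

lemma cadlag_delay_one: "cadlag (delay s (\<lambda>v. 1))"
proof (rule mono_rc_imp_cadlag)
  have "(delay s (\<lambda>v. 1) \<longlongrightarrow> delay s (\<lambda>v. 1) t) (at_right t)" for t
  proof (rule tendsto_eventually, cases "s \<le> t")
    case True
    then show "\<forall>\<^sub>F v in at_right t. delay s (\<lambda>v. 1) v = delay s (\<lambda>v. 1) t"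
      by (auto simp: eventually_at_filter delay_def)
  next
    case False
    then show "\<forall>\<^sub>F v in at_right t. delay s (\<lambda>v. 1) v = delay s (\<lambda>v. 1) t"
      by (intro eventually_at_rightI[of t s]) (auto simp: delay_def)
  qed
  moreover have "mono_on {0..} (delay s (\<lambda>v. 1))" by (auto simp: delay_def intro!: mono_onI)
  ultimately show "mono_rc (delay s (\<lambda>v. 1))" by (simp add: mono_rc_def continuous_within)
qed

text \<open>
  The function equal to \<open>x (k d)\<close> on \<open>[k d, (k + 1) d)\<close> for \<open>k < K\<close>, written as a combination of delayed
  constants in order to make it amenable to linearity.
\<close>
definition step_approx :: "(real \<Rightarrow> real) \<Rightarrow> real \<Rightarrow> nat \<Rightarrow> real \<Rightarrow> real" where
  "step_approx x d K v = x 0 + (\<Sum>k<K. (x (real (Suc k) * d) - x (real k * d)) * delay (real (Suc k) * d) (\<lambda>s. 1) v)"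

lemma step_approx_eq:
  assumes d: "0 < d" and v: "0 \<le> v" "v \<le> real K * d"
  obtains m where "real m * d \<le> v" "v < real m * d + d" "step_approx x d K v = x (real m * d)"
proof -
  define m where "m = nat \<lfloor>v / d\<rfloor>"
  have rm: "real m = of_int \<lfloor>v / d\<rfloor>" using d v by (simp add: m_def)
  have m: "real m \<le> v / d" "v / d < real m + 1" unfolding rm by linarith+
  have mv: "real m * d \<le> v" "v < real m * d + d" using m d by (auto simp: field_simps)
  have "v / d \<le> real K" using v d by (simp add: field_simps)
  then have mK: "m \<le> K" using m by linarith
  have "delay (real (Suc k) * d) (\<lambda>s. 1) v = (if k < m then 1 else 0)" for k
  proof -
    have "real (Suc k) * d \<le> v \<longleftrightarrow> real (Suc k) \<le> v / d" using d by (simp add: field_simps)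
    also have "\<dots> \<longleftrightarrow> k < m"
    proof
      assume "real (Suc k) \<le> v / d"
      then have "real (Suc k) < real (Suc m)" using m by simp
      then show "k < m" by simp
    next
      assume "k < m"
      then have "real (Suc k) \<le> real m" by (simp add: Suc_le_eq)
      then show "real (Suc k) \<le> v / d" using m by linarith
    qed
    finally show ?thesis by (simp add: delay_def)
  qed
  then have "step_approx x d K v = x 0 + (\<Sum>k<K. if k < m then x (real (Suc k) * d) - x (real k * d) else 0)"
    unfolding step_approx_def by (intro arg_cong2[where f = "(+)"] sum.cong) auto
  also have "(\<Sum>k<K. if k < m then x (real (Suc k) * d) - x (real k * d) else 0)
      = (\<Sum>k<m. x (real (Suc k) * d) - x (real k * d))"
    using mK by (intro sum.mono_neutral_cong_right) auto
  also have "x 0 + \<dots> = x (real m * d)"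
    using sum_lessThan_telescope[of "\<lambda>k. x (real k * d)" m] by simp
  finally show thesis using that mv by blast
qed

text \<open>For delayed constants both sides are the delay of \<open>g * h\<close>; linearity extends this to step functions.\<close>
lemma ls_convolution_assoc_step:
  assumes g: "mono_rc g" "0 \<le> g 0" and h: "mono_rc h" "0 \<le> h 0" and d: "0 \<le> d"
  shows "cadlag (step_approx x d K)"
    and "0 \<le> u \<Longrightarrow> ls_convolution (ls_convolution (step_approx x d K) g) h u
            = ls_convolution (step_approx x d K) (ls_convolution g h) u"
proof -
  define P where "P x \<longleftrightarrow> cadlag x \<and> (\<forall>u\<ge>0. ls_convolution (ls_convolution x g) h u
            = ls_convolution x (ls_convolution g h) u)" for x
  note gh = mono_rc_ls_convolution[OF g h]
  have delay: "P (delay s (\<lambda>s. 1))" if s: "0 \<le> s" for s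
    unfolding P_def
  proof (intro conjI allI impI cadlag_delay_one)
    fix u :: real assume u: "0 \<le> u"
    have dl: "ls_convolution (delay s (\<lambda>s. 1)) k u = delay s k u" if "mono_rc k" "0 \<le> u" for k u
      using that by (simp add: ls_convolution_delay[OF s] delay_def ls_convolution_one_left)
    have "ls_convolution (ls_convolution (delay s (\<lambda>s. 1)) g) h u = ls_convolution (delay s g) h u"
      by (intro ls_convolution_cong dl g u) auto
    also have "\<dots> = ls_convolution (delay s (\<lambda>s. 1)) (ls_convolution g h) u"
      unfolding ls_convolution_delay[OF s, of g h u] by (rule dl[OF gh u, symmetric])
    finally show "ls_convolution (ls_convolution (delay s (\<lambda>s. 1)) g) h u
        = ls_convolution (delay s (\<lambda>s. 1)) (ls_convolution g h) u" .
  qed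
  have lin: "P (\<lambda>v. c * x v + e * y v)" if "P x" "P y" for x y c e
  proof -
    have x: "cadlag x" and y: "cadlag y" using that by (auto simp: P_def)
    have "ls_convolution (ls_convolution (\<lambda>v. c * x v + e * y v) g) h u
            = ls_convolution (\<lambda>v. c * x v + e * y v) (ls_convolution g h) u" if u: "0 \<le> u" for u
    proof -
      have "ls_convolution (ls_convolution (\<lambda>v. c * x v + e * y v) g) h u
          = ls_convolution (\<lambda>v. c * ls_convolution x g v + e * ls_convolution y g v) h u"
        by (intro ls_convolution_cong ls_convolution_linear x y g u) auto
      also have "\<dots> = c * ls_convolution (ls_convolution x g) h u + e * ls_convolution (ls_convolution y g) h u"
        by (intro ls_convolution_linear cadlag_ls_convolution x y g h u)
      also have "\<dots> = ls_convolution (\<lambda>v. c * x v + e * y v) (ls_convolution g h) u"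
        using \<open>P x\<close> \<open>P y\<close> u by (simp add: ls_convolution_linear[OF x y gh u] P_def)
      finally show ?thesis .
    qed
    then show ?thesis using x y by (auto simp: P_def intro!: cadlag_add cadlag_cmult)
  qed
  have "P (step_approx x d K)"
  proof (induction K)
    case 0
    have "P (\<lambda>v. x 0)" unfolding P_def
    proof (intro conjI allI impI cadlag_const)
      fix u :: real assume u: "0 \<le> u"
      have c: "ls_convolution (\<lambda>v. x 0) k u = x 0 * k u" if "mono_rc k" "0 \<le> u" for k u
        using ls_convolution_cmult_left[OF cadlag_const that, of "x 0" 1] that
        by (simp add: ls_convolution_one_left)
      have "ls_convolution (ls_convolution (\<lambda>v. x 0) g) h u = ls_convolution (\<lambda>v. x 0 * g v) h u"
        by (intro ls_convolution_cong c g u) auto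
      then show "ls_convolution (ls_convolution (\<lambda>v. x 0) g) h u = ls_convolution (\<lambda>v. x 0) (ls_convolution g h) u"
        using u by (simp add: c[OF gh] ls_convolution_cmult_left[OF mono_rc_imp_cadlag[OF g(1)] h(1)])
    qed
    moreover have "step_approx x d 0 = (\<lambda>v. x 0)" by (simp add: step_approx_def fun_eq_iff)
    ultimately show ?case by simp
  next
    case (Suc K)
    have "P (\<lambda>v. 1 * step_approx x d K v + (x (real (Suc K) * d) - x (real K * d)) * delay (real (Suc K) * d) (\<lambda>s. 1) v)"
      using d by (intro lin Suc delay) auto
    then show ?case by (simp add: step_approx_def[abs_def] add.assoc)
  qed
  then show "cadlag (step_approx x d K)"
    "0 \<le> u \<Longrightarrow> ls_convolution (ls_convolution (step_approx x d K) g) h u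
            = ls_convolution (step_approx x d K) (ls_convolution g h) u"
    by (auto simp: P_def)
qed

text \<open>
  A continuous \<open>x\<close> is a locally uniform limit of step functions, for which the identity holds, and both
  sides are continuous in \<open>x\<close>.
\<close>
lemma ls_convolution_assoc:
  assumes x: "continuous_on {0..} x"
    and g: "mono_rc g" "0 \<le> g 0" "continuous_on {0..} g" and h: "mono_rc h" "0 \<le> h 0" and u: "0 \<le> u"
  shows "ls_convolution (ls_convolution x g) h u = ls_convolution x (ls_convolution g h) u"
proof -
  define U where "U = u + 1"
  have U: "0 < U" "0 \<le> U" "u \<in> {0..U}" using u by (auto simp: U_def)
  define X where "X n = step_approx x (U / real (Suc n)) (Suc n)" for n
  have d: "0 < U / real (Suc n)" "0 \<le> U / real (Suc n)" "real (Suc n) * (U / real (Suc n)) = U" for n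
    using U by auto
  have lim: "uniform_limit {0..U} X x sequentially"
  proof (rule uniform_limitI)
    fix e :: real assume e: "0 < e"
    obtain \<delta> where \<delta>: "0 < \<delta>" "\<And>v w. v \<in> {0..U} \<Longrightarrow> w \<in> {0..U} \<Longrightarrow> \<bar>v - w\<bar> \<le> \<delta> \<Longrightarrow> \<bar>x v - x w\<bar> \<le> e / 2"
      using uniform_modulus[OF x, of "e / 2" U] e by auto
    have "(\<lambda>n. U * (1 / real (Suc n))) \<longlonglongrightarrow> U * 0"
      by (intro tendsto_intros LIMSEQ_Suc lim_1_over_n)
    then have "\<forall>\<^sub>F n in sequentially. U * (1 / real (Suc n)) < \<delta>"
      using \<delta>(1) by (intro order_tendstoD(2)) auto
    then show "\<forall>\<^sub>F n in sequentially. \<forall>v\<in>{0..U}. dist (X n v) (x v) < e"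
    proof (rule eventually_mono, intro ballI)
      fix n v assume n: "U * (1 / real (Suc n)) < \<delta>" and v: "v \<in> {0..U}"
      have vU: "0 \<le> v" "v \<le> real (Suc n) * (U / real (Suc n))" using v unfolding d(3) by auto
      obtain m where m: "real m * (U / real (Suc n)) \<le> v" "v < real m * (U / real (Suc n)) + U / real (Suc n)"
        "X n v = x (real m * (U / real (Suc n)))"
        unfolding X_def by (rule step_approx_eq[OF d(1) vU])
      have "0 \<le> real m * (U / real (Suc n))" using d(2) by (intro mult_nonneg_nonneg) auto
      then have "\<bar>x (real m * (U / real (Suc n))) - x v\<bar> \<le> e / 2"
        using m n v by (intro \<delta>(2)) auto
      then show "dist (X n v) (x v) < e" using e by (simp add: m(3) dist_real_def)
    qed
  qed
  note gh = mono_rc_ls_convolution[OF g(1,2) h]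
  have cX: "cadlag (X n)" for n
    unfolding X_def by (rule ls_convolution_assoc_step(1)[OF g(1,2) h d(2)])
  have gg: "mono_rc g" and hh: "mono_rc h" using g h by auto
  have "uniform_limit {0..U} (\<lambda>n. ls_convolution (X n) g) (ls_convolution x g) sequentially"
    by (rule ls_convolution_uniform_limit[OF cX gg x gg U(2) lim uniform_limit_const])
  then have "uniform_limit {0..U} (\<lambda>n. ls_convolution (ls_convolution (X n) g) h)
      (ls_convolution (ls_convolution x g) h) sequentially"
    by (intro ls_convolution_uniform_limit[OF cadlag_ls_convolution[OF cX gg] hh
          continuous_on_ls_convolution[OF x gg g(3)] hh U(2)] uniform_limit_const)
  then have 1: "(\<lambda>n. ls_convolution (ls_convolution (X n) g) h u) \<longlonglongrightarrow> ls_convolution (ls_convolution x g) h u"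
    by (rule tendsto_uniform_limitI[OF _ U(3)])
  have "uniform_limit {0..U} (\<lambda>n. ls_convolution (X n) (ls_convolution g h)) (ls_convolution x (ls_convolution g h)) sequentially"
    by (rule ls_convolution_uniform_limit[OF cX gh x gh U(2) lim uniform_limit_const])
  then have 2: "(\<lambda>n. ls_convolution (X n) (ls_convolution g h) u) \<longlonglongrightarrow> ls_convolution x (ls_convolution g h) u"
    by (rule tendsto_uniform_limitI[OF _ U(3)])
  have "ls_convolution (ls_convolution (X n) g) h u = ls_convolution (X n) (ls_convolution g h) u" for n
    unfolding X_def by (rule ls_convolution_assoc_step(2)[OF g(1,2) h d(2) u])
  then show ?thesis using LIMSEQ_unique[OF 1] 2 by simp
qed


section \<open>Integrators of power type\<close>

lemma mono_rc_powr:
  assumes "0 < \<beta>"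
  shows "mono_rc (\<lambda>y. y powr \<beta>)" and "continuous_on {0..} (\<lambda>y::real. y powr \<beta>)"
proof -
  show c: "continuous_on {0..} (\<lambda>y::real. y powr \<beta>)"
    using assms by (intro continuous_on_powr') (auto intro: continuous_intros)
  show "mono_rc (\<lambda>y. y powr \<beta>)"
    using continuous_on_imp_cadlag[OF c] assms
    by (auto simp: mono_rc_def cadlag_def intro!: mono_onI powr_mono2)
qed

text \<open>
  Both measures assign \<open>b\<^sup>\<beta> - a\<^sup>\<beta>\<close> to \<open>(a, b]\<close>.  For \<open>\<beta> < 1\<close> the density is unbounded at 0, so the fundamental
  theorem of calculus is used in the form that asks for differentiability in the interior only.
\<close>
lemma stieltjes_powr:
  assumes \<beta>: "0 < \<beta>"
  shows "stieltjes (\<lambda>y. y powr \<beta>) = density lborel (\<lambda>y. ennreal (indicator {0<..} y * (\<beta> * y powr (\<beta> - 1))))"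
    (is "?M = density lborel ?h")
proof (rule measure_eqI_generator_eq[where \<Omega> = UNIV and E = "range (\<lambda>(a, b). {a<..b::real})"
      and A = "\<lambda>n. {- real n<..real n}"])
  have M: "emeasure ?M {a<..b} = ennreal (max 0 b powr \<beta> - max 0 a powr \<beta>)" if "a \<le> b" for a b :: real
    unfolding stieltjes_def
    using mono_rc_powr(1)[OF \<beta>] continuous_at_right_max0[of "\<lambda>y. y powr \<beta>"] \<beta>
    by (intro emeasure_interval_measure_Ioc[OF that] powr_mono2) (auto simp: mono_rc_def)
  have N: "emeasure (density lborel ?h) {a<..b} = ennreal (max 0 b powr \<beta> - max 0 a powr \<beta>)"
    if ab: "a \<le> b" for a b :: real
  proof -
    define a' b' where "a' = max 0 a" and "b' = max 0 b"
    have a'b': "0 \<le> a'" "a' \<le> b'" using ab by (auto simp: a'_def b'_def)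
    have "((\<lambda>y. \<beta> * y powr (\<beta> - 1)) has_integral (b' powr \<beta> - a' powr \<beta>)) {a'..b'}"
    proof (rule fundamental_theorem_of_calculus_interior[OF a'b'(2)])
      show "continuous_on {a'..b'} (\<lambda>y. y powr \<beta>)"
        using mono_rc_powr(2)[OF \<beta>] by (rule continuous_on_subset) (use a'b' in auto)
      fix y assume "y \<in> {a'<..<b'}"
      then have "0 < y" using a'b' by auto
      then show "((\<lambda>y. y powr \<beta>) has_vector_derivative \<beta> * y powr (\<beta> - 1)) (at y)"
        by (simp add: has_real_derivative_powr has_real_derivative_iff_has_vector_derivative[symmetric])
    qed
    from nn_integral_has_integral_lebesgue'[OF _ this] \<beta>
    have "(\<integral>\<^sup>+y. ennreal (\<beta> * y powr (\<beta> - 1)) * indicator {a'..b'} y \<partial>lborel) = ennreal (b' powr \<beta> - a' powr \<beta>)"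
      by simp
    moreover have "emeasure (density lborel ?h) {a<..b} =
        (\<integral>\<^sup>+y. ennreal (\<beta> * y powr (\<beta> - 1)) * indicator {a'..b'} y \<partial>lborel)"
    proof (subst emeasure_density, simp, simp, rule nn_integral_cong_AE)
      show "AE y in lborel. ?h y * indicator {a<..b} y = ennreal (\<beta> * y powr (\<beta> - 1)) * indicator {a'..b'} y"
        using AE_lborel_singleton[of a']
        by eventually_elim (auto simp: a'_def b'_def indicator_def max_def split: if_splits)
    qed
    ultimately show ?thesis by (simp add: a'_def b'_def)
  qed
  show "emeasure ?M X = emeasure (density lborel ?h) X" if "X \<in> range (\<lambda>(a, b). {a<..b::real})" for X
  proof -
    obtain a b where "X = {a<..b}" using \<open>X \<in> _\<close> by auto
    then show ?thesis by (cases "a \<le> b") (simp_all add: M N)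
  qed
  show "Int_stable (range (\<lambda>(a, b). {a<..b::real}))"
    by (auto simp: Int_stable_def Int_greaterThanAtMost)
  show "emeasure ?M {- real n<..real n} \<noteq> \<infinity>" for n by (simp add: M)
  show "(\<Union>n. {- real n<..real n}) = (UNIV :: real set)"
  proof (intro set_eqI iffI UNIV_I)
    fix x :: real
    obtain n where "\<bar>x\<bar> < real n" using reals_Archimedean2 by blast
    then show "x \<in> (\<Union>n. {- real n<..real n})" by (intro UN_I[of n]) auto
  qed
qed (auto simp: borel_sigma_sets_Ioc)

lemma ls_convolution_powr:
  assumes \<beta>: "0 < \<beta>" and w: "cadlag w" and u: "0 \<le> u"
  shows "ls_convolution w (\<lambda>y. y powr \<beta>) u = (LINT y:{0..u}|lborel. w (u - y) * (\<beta> * y powr (\<beta> - 1)))"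
proof (cases "u = 0")
  case True
  have "(\<lambda>y. indicator {0..u} y *\<^sub>R (w (u - y) * (\<beta> * y powr (\<beta> - 1)))) = (\<lambda>y. 0)"
    using True by (auto simp: indicator_def)
  then show ?thesis using True by (simp add: set_lebesgue_integral_def)
next
  case False
  then have u0: "0 < u" using u by simp
  let ?h = "\<lambda>y. indicator {0<..} y * (\<beta> * y powr (\<beta> - 1))"
  let ?F = "\<lambda>y. indicator {0<..u} y * w (u - y)"
  have "?F \<in> borel_measurable (stieltjes (\<lambda>y. y powr \<beta>))"
    using borel_measurable_integrable[OF cadlag_integrand(1)[OF w mono_rc_powr(1)[OF \<beta>] u0]] .
  then have F: "?F \<in> borel_measurable lborel" by (simp cong: measurable_cong_sets)
  have "ls_convolution w (\<lambda>y. y powr \<beta>) u = (\<integral>y. ?F y \<partial>density lborel ?h)"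
    by (simp add: ls_convolution_altdef stieltjes_powr[OF \<beta>])
  also have "\<dots> = (\<integral>y. ?h y *\<^sub>R ?F y \<partial>lborel)"
    using \<beta> by (intro integral_density F) auto
  also have "\<dots> = (\<integral>y. indicator {0..u} y *\<^sub>R (w (u - y) * (\<beta> * y powr (\<beta> - 1))) \<partial>lborel)"
    by (intro Bochner_Integration.integral_cong) (auto simp: indicator_def)
  finally show ?thesis by (simp add: set_lebesgue_integral_def)
qed

section \<open>Convolution powers\<close>

text \<open>The constant integrator 1 is the unit mass at 0.\<close>
lemma ls_convolution_one_right:
  assumes "cadlag f" "0 \<le> u"
  shows "ls_convolution f (\<lambda>s. 1) u = f u"
proof -
  have "mono_rc (\<lambda>s. 1)" by (auto simp: mono_rc_def intro!: mono_onI continuous_intros)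
  from riemann_sum_tendsto[OF assms(1) this assms(2)] show ?thesis
    by (simp add: riemann_sum_def LIMSEQ_const_iff)
qed

text \<open>\<open>f\<close> dominates the multiple \<open>f s\<close> of the constant 1 delayed by \<open>s\<close>.\<close>
lemma ls_convolution_lower_bound:
  assumes f: "mono_rc f" "0 \<le> f 0" and g: "mono_rc g" and s: "0 \<le> s" "s \<le> u" "0 \<le> g 0"
  shows "f s * g (u - s) \<le> ls_convolution f g u"
proof -
  have nonneg: "0 \<le> ls_convolution h g u" if "\<And>r. 0 \<le> r \<Longrightarrow> 0 \<le> h r" for h
  proof -
    have "0 \<le> h u * g 0" using that[of u] s by simp
    moreover have "0 \<le> (\<integral>y. indicator {0<..u} y * h (u - y) \<partial>stieltjes g)"
      by (rule Bochner_Integration.integral_nonneg) (simp add: indicator_def that)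
    ultimately show ?thesis by (simp add: ls_convolution_altdef)
  qed
  have fnn: "0 \<le> f r" if "0 \<le> r" for r using mono_rcD[OF f(1) order_refl that] f(2) by simp
  have u: "0 \<le> u" using s by simp
  note cf = mono_rc_imp_cadlag[OF f(1)] and cd = cadlag_delay_one[of s]
  have "0 \<le> ls_convolution (\<lambda>r. f r - f s * delay s (\<lambda>r. 1) r) g u"
    using fnn mono_rcD[OF f(1) s(1)] by (intro nonneg) (auto simp: delay_def)
  also have "\<dots> = ls_convolution f g u - f s * ls_convolution (delay s (\<lambda>r. 1)) g u"
    by (simp add: ls_convolution_minus[OF cf cadlag_cmult[OF cd] g u] ls_convolution_cmult_left[OF cd g u])
  also have "ls_convolution (delay s (\<lambda>r. 1)) g u = g (u - s)"
    using s by (simp add: ls_convolution_delay delay_def ls_convolution_one_left[OF g])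
  finally show ?thesis by simp
qed

text \<open>
  The 0-fold power is the constant 1, so the recursion starts at 0 already, which removes the case distinction
  at the first power.
\<close>
lemma conv_power_Suc:
  assumes "mono_rc g" "0 \<le> u"
  shows "conv_power g (Suc j) u = ls_convolution (conv_power g j) g u"
  using assms by (cases j) (simp_all add: ls_convolution_one_left)

lemma cadlag_conv_power:
  assumes "mono_rc g"
  shows "cadlag (conv_power g j)"
proof -
  have "cadlag (conv_power g (Suc i))" for i
    by (induction i) (use assms in \<open>auto intro: mono_rc_imp_cadlag cadlag_ls_convolution\<close>)
  then show ?thesis by (cases j) auto
qed

lemma mono_rc_conv_power:
  assumes "mono_rc g" "0 \<le> g 0"
  shows "mono_rc (conv_power g j)" "0 \<le> conv_power g j 0"
proof -
  have "mono_rc (conv_power g (Suc i)) \<and> 0 \<le> conv_power g (Suc i) 0" for i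
    by (induction i) (use assms in \<open>auto intro: mono_rc_ls_convolution\<close>)
  moreover have "mono_rc (\<lambda>s. 1)" by (auto simp: mono_rc_def intro!: mono_onI continuous_intros)
  ultimately show "mono_rc (conv_power g j)" "0 \<le> conv_power g j 0" by (cases j; auto)+
qed

section \<open>Limits of the convolution powers\<close>

text \<open>The case \<open>j = 0\<close> is separated because \<open>0 powr 0 = 0\<close>.\<close>
definition power_fun :: "real \<Rightarrow> nat \<Rightarrow> real \<Rightarrow> real" where
  "power_fun \<alpha> j u = (if j = 0 then 1 else u powr (\<alpha> * real j))"

text \<open>The constant \<open>\<Gamma>(\<alpha> + 1)\<^sup>j / \<Gamma>(j\<alpha> + 1)\<close>, the value at 1 of the \<open>j\<close>-fold convolution power of \<open>u\<^sup>\<alpha>\<close>.\<close>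
fun power_const :: "real \<Rightarrow> nat \<Rightarrow> real" where
  "power_const \<alpha> 0 = 1"
| "power_const \<alpha> (Suc j) = power_const \<alpha> j * ls_convolution (power_fun \<alpha> j) (power_fun \<alpha> 1) 1"

text \<open>
  The limit of the centred \<open>(i + 1)\<close>-st power, normalised by \<open>a(t) b(t)\<^sup>i\<close>, in the form in which the induction over the
  powers produces it.
\<close>
fun limit_rec :: "real \<Rightarrow> (real \<Rightarrow> real) \<Rightarrow> nat \<Rightarrow> real \<Rightarrow> real" where
  "limit_rec \<alpha> x 0 = x"
| "limit_rec \<alpha> x (Suc i) = (\<lambda>u. ls_convolution (limit_rec \<alpha> x i) (power_fun \<alpha> 1) u
      + ls_convolution x (\<lambda>s. power_const \<alpha> (Suc i) * power_fun \<alpha> (Suc i) s) u)"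

context
  fixes \<alpha> :: real
  assumes \<alpha>: "0 < \<alpha>"
begin

lemma power_fun_props:
  "mono_rc (power_fun \<alpha> j)" "continuous_on {0..} (power_fun \<alpha> j)" "0 \<le> power_fun \<alpha> j u" "power_fun \<alpha> j 1 = 1"
proof -
  show "mono_rc (power_fun \<alpha> j)" "continuous_on {0..} (power_fun \<alpha> j)"
    using mono_rc_powr[of "\<alpha> * real j"] \<alpha>
    by (cases "j = 0"; auto simp: power_fun_def[abs_def] mono_rc_def intro!: mono_onI continuous_intros)+
qed (auto simp: power_fun_def)

lemma cadlag_power_fun: "cadlag (power_fun \<alpha> j)"
  by (rule mono_rc_imp_cadlag[OF power_fun_props(1)])

lemma power_fun_mult:
  assumes "0 \<le> s" "0 \<le> u"
  shows "power_fun \<alpha> j (s * u) = power_fun \<alpha> j u * power_fun \<alpha> j s"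
  using assms by (simp add: power_fun_def powr_mult)

text \<open>By scaling, the convolution of power functions is homogeneous; its value at 1 is the constant.\<close>
lemma power_fun_convolution:
  assumes u: "0 \<le> u"
  shows "ls_convolution (power_fun \<alpha> j) (power_fun \<alpha> 1) u
       = ls_convolution (power_fun \<alpha> j) (power_fun \<alpha> 1) 1 * power_fun \<alpha> (Suc j) u"
proof (cases "u = 0")
  case True
  then show ?thesis by (simp add: power_fun_def)
next
  case False
  then have u0: "0 < u" using u by simp
  note c = cadlag_power_fun[of j] and m = power_fun_props(1)[of 1]
  have "ls_convolution (power_fun \<alpha> j) (power_fun \<alpha> 1) (1 * u)
      = ls_convolution (\<lambda>s. power_fun \<alpha> j u * power_fun \<alpha> j s) (\<lambda>s. power_fun \<alpha> 1 u * power_fun \<alpha> 1 s) 1"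
    by (subst ls_convolution_scale[OF c m _ u0]) (auto intro!: ls_convolution_cong power_fun_mult u)
  also have "\<dots> = power_fun \<alpha> j u * ls_convolution (power_fun \<alpha> j) (\<lambda>s. power_fun \<alpha> 1 u * power_fun \<alpha> 1 s) 1"
    by (rule ls_convolution_cmult_left[OF c mono_rc_cmult[OF m power_fun_props(3)]]) simp
  also have "ls_convolution (power_fun \<alpha> j) (\<lambda>s. power_fun \<alpha> 1 u * power_fun \<alpha> 1 s) 1
      = power_fun \<alpha> 1 u * ls_convolution (power_fun \<alpha> j) (power_fun \<alpha> 1) 1"
    by (rule ls_convolution_cmult_right[OF c m power_fun_props(3)]) simp
  also have "power_fun \<alpha> j u * (power_fun \<alpha> 1 u * ls_convolution (power_fun \<alpha> j) (power_fun \<alpha> 1) 1)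
      = ls_convolution (power_fun \<alpha> j) (power_fun \<alpha> 1) 1 * power_fun \<alpha> (Suc j) u"
    using u0 by (simp add: power_fun_def powr_add distrib_left)
  finally show ?thesis by simp
qed

lemma power_const_pos: "0 < power_const \<alpha> j"
proof (induction j)
  case (Suc j)
  have "0 < power_fun \<alpha> j (1/2) * power_fun \<alpha> 1 (1 - 1/2)" by (simp add: power_fun_def)
  also have "\<dots> \<le> ls_convolution (power_fun \<alpha> j) (power_fun \<alpha> 1) 1"
    by (intro ls_convolution_lower_bound power_fun_props) auto
  finally show ?case using Suc by simp
qed simp

lemma power_const_convolution:
  assumes "0 \<le> u"
  shows "ls_convolution (\<lambda>s. power_const \<alpha> j * power_fun \<alpha> j s) (power_fun \<alpha> 1) u
       = power_const \<alpha> (Suc j) * power_fun \<alpha> (Suc j) u"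
  unfolding ls_convolution_cmult_left[OF cadlag_power_fun power_fun_props(1) assms]
    power_fun_convolution[OF assms] by (simp add: mult.assoc)

lemma limit_path_eq:
  assumes "continuous_on {0..} x" "0 \<le> u"
  shows "limit_path \<alpha> x (Suc i) u = real (Suc i) * ls_convolution x (power_fun \<alpha> i) u"
proof (cases i)
  case 0
  then show ?thesis
    using ls_convolution_one_right[OF continuous_on_imp_cadlag[OF assms(1)] assms(2)]
    by (simp add: limit_path_def power_fun_def[abs_def])
next
  case (Suc k)
  have "0 < \<alpha> * real i" using \<alpha> Suc by simp
  from ls_convolution_powr[OF this continuous_on_imp_cadlag[OF assms(1)] assms(2)] Suc show ?thesis
    by (simp add: limit_path_def power_fun_def[abs_def])
qed

lemma continuous_on_limit_path:
  assumes "continuous_on {0..} x"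
  shows "continuous_on {0..} (limit_path \<alpha> x (Suc i))"
proof -
  have "continuous_on {0..} (\<lambda>u. real (Suc i) * ls_convolution x (power_fun \<alpha> i) u)"
    by (intro continuous_on_mult continuous_on_const continuous_on_ls_convolution assms power_fun_props)
  then show ?thesis
    by (rule continuous_on_cong[THEN iffD1, rotated 2]) (use limit_path_eq[OF assms] in auto)
qed

lemma scaled_power_fun:
  "mono_rc (\<lambda>s. power_const \<alpha> i * power_fun \<alpha> i s)" "continuous_on {0..} (\<lambda>s. power_const \<alpha> i * power_fun \<alpha> i s)"
  "0 \<le> power_const \<alpha> i * power_fun \<alpha> i u"
  using power_const_pos[of i] power_fun_props[of i]
  by (auto intro!: mono_rc_cmult continuous_on_mult continuous_on_const)

lemma continuous_on_limit_rec:
  assumes "continuous_on {0..} x"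
  shows "continuous_on {0..} (limit_rec \<alpha> x i)"
  by (induction i)
     (use assms in \<open>auto intro!: continuous_on_add continuous_on_ls_convolution power_fun_props
        scaled_power_fun simp del: power_const.simps\<close>)

text \<open>
  In the induction step each of the \<open>i + 1\<close> copies of \<open>x * c\<^sub>i u\<^sup>\<alpha>\<^sup>i\<close> is convolved with \<open>u\<^sup>\<alpha>\<close>, which gives
  \<open>x * c\<^sub>i\<^sub>+\<^sub>1 u\<^sup>\<alpha>\<^sup>(\<^sup>i\<^sup>+\<^sup>1\<^sup>)\<close> by associativity, and the second summand of the recursion adds one more copy.
\<close>
lemma limit_rec_eq:
  assumes x: "continuous_on {0..} x"
  shows "0 \<le> u \<Longrightarrow> limit_rec \<alpha> x i u = real (Suc i) * ls_convolution x (\<lambda>s. power_const \<alpha> i * power_fun \<alpha> i s) u"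
proof (induction i arbitrary: u)
  case 0
  then show ?case
    using ls_convolution_one_right[OF continuous_on_imp_cadlag[OF x] 0] by (simp add: power_fun_def[abs_def])
next
  case (Suc i)
  note u = Suc.prems and cx = continuous_on_imp_cadlag[OF x]
  let ?g = "\<lambda>i s. power_const \<alpha> i * power_fun \<alpha> i s"
  note g = scaled_power_fun[of i]
  have "ls_convolution (limit_rec \<alpha> x i) (power_fun \<alpha> 1) u
      = ls_convolution (\<lambda>v. real (Suc i) * ls_convolution x (?g i) v) (power_fun \<alpha> 1) u"
    by (intro ls_convolution_cong Suc.IH u) auto
  also have "\<dots> = real (Suc i) * ls_convolution (ls_convolution x (?g i)) (power_fun \<alpha> 1) u"
    by (intro ls_convolution_cmult_left cadlag_ls_convolution cx g power_fun_props u)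
  also have "ls_convolution (ls_convolution x (?g i)) (power_fun \<alpha> 1) u
      = ls_convolution x (ls_convolution (?g i) (power_fun \<alpha> 1)) u"
    by (intro ls_convolution_assoc x g power_fun_props u)
  also have "\<dots> = ls_convolution x (?g (Suc i)) u"
    by (intro ls_convolution_cong u refl power_const_convolution)
  finally show ?case by (simp add: distrib_right del: power_const.simps)
qed

end

text \<open>Between two points of a fine grid a monotone function is controlled by its values at these points.\<close>
lemma monotone_uniform_limit:
  assumes g: "\<And>n::nat. mono_on {0..} (g n)" and g': "continuous_on {0..} (g' :: real \<Rightarrow> real)" and U: "0 < U"
    and lim: "\<And>u. 0 \<le> u \<Longrightarrow> (\<lambda>n. g n u) \<longlonglongrightarrow> g' u"
  shows "uniform_limit {0..U} g g' sequentially"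
proof (rule uniform_limitI)
  fix e :: real assume e: "0 < e"
  obtain d where d: "0 < d" "\<And>x y. x \<in> {0..U} \<Longrightarrow> y \<in> {0..U} \<Longrightarrow> \<bar>x - y\<bar> \<le> d \<Longrightarrow> \<bar>g' x - g' y\<bar> \<le> e / 3"
    using uniform_modulus[OF g', of "e / 3" U] e by auto
  obtain K where "U / d < real K" using reals_Archimedean2 by blast
  then have K: "0 < real (Suc K)" "U / real (Suc K) \<le> d" using d(1) by (auto simp: field_simps)
  define s where "s k = real k * U / real (Suc K)" for k
  have s: "s k \<in> {0..U}" if "k \<le> Suc K" for k
    unfolding s_def using grid_in[OF less_imp_le[OF U] that] .
  have "\<forall>\<^sub>F n in sequentially. dist (g n (s k)) (g' (s k)) < e / 3" if "k \<le> Suc K" for k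
    by (rule tendstoD[OF lim]) (use s[OF that] e in auto)
  then have "\<forall>\<^sub>F n in sequentially. \<forall>k\<in>{..Suc K}. dist (g n (s k)) (g' (s k)) < e / 3"
    by (intro eventually_ball_finite) auto
  then show "\<forall>\<^sub>F n in sequentially. \<forall>u\<in>{0..U}. dist (g n u) (g' u) < e"
  proof eventually_elim
    case (elim n)
    have near: "g' (s i) - e / 3 < g n (s i)" "g n (s i) < g' (s i) + e / 3" if "i \<le> Suc K" for i
      using bspec[OF elim, of i] that unfolding dist_real_def atMost_iff by linarith+
    show ?case
    proof
      fix u assume u: "u \<in> {0..U}"
      define k where "k = nat \<lfloor>u * real (Suc K) / U\<rfloor>"
      have pos: "0 \<le> u * real (Suc K) / U" using u U by auto
      have rk: "real k \<le> u * real (Suc K) / U" "u * real (Suc K) / U < real k + 1"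
        using pos unfolding k_def by linarith+
      have below: "s k \<le> u" "u \<le> s (Suc k)" using rk U K(1) by (auto simp: s_def field_simps)
      have diff: "s (Suc k) - s k = U / real (Suc K)" 
        unfolding s_def diff_divide_distrib[symmetric] left_diff_distrib[symmetric] by simp
      have kK: "k \<le> Suc K"
      proof -
        have "u * real (Suc K) / U \<le> real (Suc K)" 
          using mult_right_mono[of u U "real (Suc K)"] u U by (simp add: field_simps del: of_nat_Suc)
        then show ?thesis using rk by linarith
      qed
      have lo: "g' u - e / 3 \<le> g' (s k)" "g n (s k) \<le> g n u" "g' (s k) - e / 3 < g n (s k)"
      proof -
        have "\<bar>u - s k\<bar> \<le> d" using below diff K by auto
        then show "g' u - e / 3 \<le> g' (s k)" using d(2)[OF u s[OF kK]] by linarith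
        show "g n (s k) \<le> g n u" using below u s[OF kK] by (intro mono_onD[OF g]) auto
        show "g' (s k) - e / 3 < g n (s k)" by (rule near(1)[OF kK])
      qed
      have hi: "g n u < g' u + e"
      proof (cases "k = Suc K")
        case True
        then have "u = s k" using below u U by (auto simp: s_def)
        then show ?thesis using near(2)[OF kK] e by simp
      next
        case False
        then have kS: "Suc k \<le> Suc K" using kK by simp
        have "\<bar>s (Suc k) - u\<bar> \<le> d" using below diff K by auto
        then have "g' (s (Suc k)) \<le> g' u + e / 3" using d(2)[OF s[OF kS] u] by linarith
        moreover have "g n u \<le> g n (s (Suc k))" using below u s[OF kS] by (intro mono_onD[OF g]) auto
        moreover have "g n (s (Suc k)) < g' (s (Suc k)) + e / 3" by (rule near(2)[OF kS])
        ultimately show ?thesis using e by linarith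
      qed
      show "dist (g n u) (g' u) < e" using lo hi e unfolding dist_real_def by linarith
    qed
  qed
qed

lemma uniform_limit_constants:
  "c \<longlonglongrightarrow> (l :: real) \<Longrightarrow> uniform_limit S (\<lambda>n u. c n) (\<lambda>u. l) sequentially"
  unfolding uniform_limit_iff tendsto_iff by (auto elim!: eventually_mono)

lemma uniform_limit_mult_const:
  fixes l :: "real \<Rightarrow> real"
  assumes "uniform_limit {0..U} f l sequentially" "continuous_on {0..} l" "c \<longlonglongrightarrow> k"
  shows "uniform_limit {0..U} (\<lambda>n u. f n u * c n) (\<lambda>u. l u * k) sequentially"
proof (rule uniform_lim_mult[OF assms(1) uniform_limit_constants[OF assms(3)]])
  have "continuous_on {0..U} l" using assms(2) by (rule continuous_on_subset) auto
  then show "bounded (l ` {0..U})" by (intro compact_imp_bounded compact_continuous_image) auto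
  show "bounded ((\<lambda>u. k) ` {0..U})" by (rule bounded_subset[of "{k}"]) auto
qed

text \<open>
  Telescoping \<open>P * p - B * b = (P - B) * p + B * (p - b)\<close> for the \<open>j\<close>-th powers \<open>P\<close> and \<open>B\<close>.  Commutativity turns the
  last term, whose integrator \<open>p - b\<close> is not monotone, into a convolution with the monotone integrator \<open>B\<close>.
  Only the powers of \<open>b\<close> are known to be monotone: \<open>p\<close> may be negative at 0.
\<close>
lemma conv_power_difference:
  assumes p: "mono_rc p" and b: "mono_rc b" "0 \<le> b 0" and u: "0 \<le> u"
  shows "conv_power p (Suc j) u - conv_power b (Suc j) u =
     ls_convolution (\<lambda>s. conv_power p j s - conv_power b j s) p u + ls_convolution (\<lambda>s. p s - b s) (conv_power b j) u"
proof -
  note cp = cadlag_conv_power[OF p, of j] and cb = cadlag_conv_power[OF b(1), of j]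
  note mb = mono_rc_conv_power(1)[OF b, of j]
  show ?thesis
    unfolding conv_power_Suc[OF p u] conv_power_Suc[OF b(1) u] ls_convolution_minus[OF cp cb p u]
      ls_convolution_minus[OF mono_rc_imp_cadlag[OF p] mono_rc_imp_cadlag[OF b(1)] mb u]
    using ls_convolution_commute[OF mb p u] ls_convolution_commute[OF mb b(1) u] by simp
qed

lemma ls_convolution_rescale:
  assumes f: "cadlag f" and g: "mono_rc g" and t: "0 < t" and k: "0 < k" and u: "0 \<le> u"
  shows "ls_convolution (\<lambda>s. f (s * t) / c) (\<lambda>s. g (s * t) / k) u = ls_convolution f g (u * t) / (c * k)"
proof -
  have "ls_convolution (\<lambda>s. 1 / c * f (s * t)) (\<lambda>s. 1 / k * g (s * t)) u
      = 1 / c * (1 / k * ls_convolution (\<lambda>s. f (s * t)) (\<lambda>s. g (s * t)) u)"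
    using k by (simp only: ls_convolution_cmult_left[OF cadlag_scale[OF f t] mono_rc_cmult[OF mono_rc_scale[OF g t]] u]
      ls_convolution_cmult_right[OF cadlag_scale[OF f t] mono_rc_scale[OF g t] _ u] zero_le_divide_1_iff less_imp_le)
  then show ?thesis using ls_convolution_scale[OF f g u t] by simp
qed

text \<open>
  By induction over the power, with \<open>conv_power_difference\<close>, scaling, and joint continuity of the convolution.
  The interval has to contain 1, because the normalisation \<open>conv_power b i (\<tau> n)\<close> is a value at \<open>u = 1\<close>.
\<close>
lemma conv_power_uniform_limit:
  fixes p :: "nat \<Rightarrow> real \<Rightarrow> real"
  assumes p: "\<And>n. mono_rc (p n)" and b: "mono_rc b" "0 \<le> b 0" and bpos: "\<And>t. 0 < t \<Longrightarrow> 0 < b t"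
    and \<alpha>: "0 < \<alpha>" and rv: "regularly_varying b \<alpha>"
    and \<tau>: "\<And>n. 0 < \<tau> n" "filterlim \<tau> at_top sequentially"
    and a: "\<And>n. 0 < a n" and binf: "filterlim (\<lambda>n. b (\<tau> n)) at_top sequentially" and ab: "(\<lambda>n. a n / b (\<tau> n)) \<longlonglongrightarrow> 0"
    and x: "continuous_on {0..} x"
    and lim: "\<And>U. 0 < U \<Longrightarrow> uniform_limit {0..U} (\<lambda>n u. (p n (u * \<tau> n) - b (u * \<tau> n)) / a n) x sequentially"
    and U: "1 \<le> U"
  shows "uniform_limit {0..U} (\<lambda>n u. (conv_power (p n) (Suc i) (u * \<tau> n) - conv_power b (Suc i) (u * \<tau> n)) /
           (a n * conv_power b i (\<tau> n))) (limit_path \<alpha> x (Suc i)) sequentially"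
proof -
  have U0: "0 < U" "0 \<le> U" using U by auto
  let ?D = "\<lambda>i n u. conv_power (p n) (Suc i) (u * \<tau> n) - conv_power b (Suc i) (u * \<tau> n)"
  define \<beta> where "\<beta> n = b (\<tau> n)" for n
  have \<beta>: "0 < \<beta> n" for n using bpos[OF \<tau>(1)] by (simp add: \<beta>_def)
  note cx = continuous_on_imp_cadlag[OF x]
  let ?pf = "power_fun \<alpha>" and ?kf = "\<lambda>j s. power_const \<alpha> j * power_fun \<alpha> j s"
  note pf = power_fun_props[OF \<alpha>] and kf = scaled_power_fun[OF \<alpha>]
  have B1: "uniform_limit {0..U} (\<lambda>n u. b (u * \<tau> n) / \<beta> n) (?pf 1) sequentially"
  proof (rule monotone_uniform_limit[OF _ pf(2) U0(1)])
    show "mono_on {0..} (\<lambda>u. b (u * \<tau> n) / \<beta> n)" for n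
      using \<beta>[of n] \<tau>(1)[of n] by (intro mono_onI divide_right_mono mono_rcD[OF b(1)]) auto
    fix u :: real assume u: "0 \<le> u"
    show "(\<lambda>n. b (u * \<tau> n) / \<beta> n) \<longlonglongrightarrow> ?pf 1 u"
    proof (cases "u = 0")
      case True
      then show ?thesis using tendsto_divide_0[OF tendsto_const filterlim_at_top_imp_at_infinity[OF binf]]
        by (simp add: power_fun_def \<beta>_def)
    next
      case False
      then have "((\<lambda>t. b (u * t) / b t) \<longlongrightarrow> u powr \<alpha>) at_top"
        using rv u by (simp add: regularly_varying_def)
      from filterlim_compose[OF this \<tau>(2)] show ?thesis by (simp add: power_fun_def \<beta>_def)
    qed
  qed
  have Bj: "uniform_limit {0..U} (\<lambda>n u. conv_power b j (u * \<tau> n) / \<beta> n ^ j) (?kf j) sequentially" for j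
  proof (induction j)
    case 0
    then show ?case by (simp add: power_fun_def uniform_limit_const)
  next
    case (Suc j)
    note cb = cadlag_conv_power[OF b(1), of j]
    have "uniform_limit {0..U} (\<lambda>n. ls_convolution (\<lambda>u. conv_power b j (u * \<tau> n) / \<beta> n ^ j) (\<lambda>u. b (u * \<tau> n) / \<beta> n))
        (ls_convolution (?kf j) (?pf 1)) sequentially"
    proof (rule ls_convolution_uniform_limit[OF _ _ kf(2) pf(1) U0(2) Suc B1])
      show "cadlag (\<lambda>u. conv_power b j (u * \<tau> n) / \<beta> n ^ j)" for n
        using cadlag_cmult[OF cadlag_scale[OF cb \<tau>(1)], of "1 / \<beta> n ^ j"] by simp
      show "mono_rc (\<lambda>u. b (u * \<tau> n) / \<beta> n)" for n
        using mono_rc_cmult[OF mono_rc_scale[OF b(1) \<tau>(1)], of "1 / \<beta> n"] less_imp_le[OF \<beta>[of n]] by simp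
    qed
    then show ?case
    proof (rule uniform_limit_cong'[THEN iffD1, rotated 2])
      fix n u assume "u \<in> {0..U}"
      then have u: "0 \<le> u" by simp
      then have "0 \<le> u * \<tau> n" using \<tau>(1)[of n] by simp
      then show "ls_convolution (\<lambda>u. conv_power b j (u * \<tau> n) / \<beta> n ^ j) (\<lambda>u. b (u * \<tau> n) / \<beta> n) u
          = conv_power b (Suc j) (u * \<tau> n) / \<beta> n ^ Suc j"
        by (simp only: ls_convolution_rescale[OF cb b(1) \<tau>(1) \<beta> u] conv_power_Suc[OF b(1)] power_Suc2)
    next
      fix u assume "u \<in> {0..U}"
      then show "ls_convolution (?kf j) (?pf 1) u = ?kf (Suc j) u"
        using power_const_convolution[OF \<alpha>, of u j] by simp
    qed
  qed
  have P1: "uniform_limit {0..U} (\<lambda>n u. p n (u * \<tau> n) / \<beta> n) (?pf 1) sequentially"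
  proof -
    have "uniform_limit {0..U} (\<lambda>n u. b (u * \<tau> n) / \<beta> n + (p n (u * \<tau> n) - b (u * \<tau> n)) / a n * (a n / \<beta> n))
        (\<lambda>u. ?pf 1 u + x u * 0) sequentially"
      using ab unfolding \<beta>_def[symmetric] by (intro uniform_limit_add B1 uniform_limit_mult_const lim U0 x)
    moreover have "b (u * \<tau> n) / \<beta> n + (p n (u * \<tau> n) - b (u * \<tau> n)) / a n * (a n / \<beta> n) = p n (u * \<tau> n) / \<beta> n" for n u
      using a[of n] \<beta>[of n] by (simp add: field_simps)
    ultimately show ?thesis by simp
  qed
  have D: "uniform_limit {0..U} (\<lambda>n u. ?D i n u / (a n * \<beta> n ^ i)) (limit_rec \<alpha> x i) sequentially" for i
  proof (induction i)
    case 0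
    then show ?case using lim[OF U0(1)] by simp
  next
    case (Suc i)
    define F where "F n s = conv_power (p n) (Suc i) s - conv_power b (Suc i) s" for n s
    define R where "R n s = p n s - b s" for n s
    have F: "cadlag (F n)" and R: "cadlag (R n)" for n
      unfolding F_def R_def by (intro cadlag_minus cadlag_conv_power mono_rc_imp_cadlag p b)+
    note mb = mono_rc_conv_power(1)[OF b, of "Suc i"]
    have quot: "cadlag (\<lambda>u. f (u * \<tau> n) / c)" if "cadlag f" for f n c
      using cadlag_cmult[OF cadlag_scale[OF that \<tau>(1)], of "1 / c"] by simp
    have mquot: "mono_rc (\<lambda>u. f (u * \<tau> n) / c)" if "mono_rc f" "0 < c" for f n c
      using mono_rc_cmult[OF mono_rc_scale[OF that(1) \<tau>(1)], of "1 / c"] that(2) by simp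
    have "uniform_limit {0..U} (\<lambda>n. ls_convolution (\<lambda>u. F n (u * \<tau> n) / (a n * \<beta> n ^ i)) (\<lambda>u. p n (u * \<tau> n) / \<beta> n))
        (ls_convolution (limit_rec \<alpha> x i) (?pf 1)) sequentially"
      using Suc by (intro ls_convolution_uniform_limit quot F mquot p \<beta> continuous_on_limit_rec \<alpha> x pf U0 P1) (simp add: F_def)
    moreover have "uniform_limit {0..U} (\<lambda>n. ls_convolution (\<lambda>u. R n (u * \<tau> n) / a n) (\<lambda>u. conv_power b (Suc i) (u * \<tau> n) / \<beta> n ^ Suc i))
        (ls_convolution x (?kf (Suc i))) sequentially"
      unfolding R_def[abs_def]
      by (intro ls_convolution_uniform_limit mquot mb zero_less_power \<beta> x kf U0 Bj lim)
         (use quot[OF R] in \<open>simp add: R_def\<close>)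
    ultimately have "uniform_limit {0..U} (\<lambda>n u. ls_convolution (\<lambda>u. F n (u * \<tau> n) / (a n * \<beta> n ^ i)) (\<lambda>u. p n (u * \<tau> n) / \<beta> n) u
          + ls_convolution (\<lambda>u. R n (u * \<tau> n) / a n) (\<lambda>u. conv_power b (Suc i) (u * \<tau> n) / \<beta> n ^ Suc i) u)
        (limit_rec \<alpha> x (Suc i)) sequentially"
      unfolding limit_rec.simps by (rule uniform_limit_add)
    then show ?case
    proof (rule uniform_limit_cong'[THEN iffD1, rotated 2])
      fix n u assume "u \<in> {0..U}"
      then have u: "0 \<le> u" by simp
      then have ut: "0 \<le> u * \<tau> n" using \<tau>(1)[of n] by simp
      have "ls_convolution (\<lambda>u. F n (u * \<tau> n) / (a n * \<beta> n ^ i)) (\<lambda>u. p n (u * \<tau> n) / \<beta> n) u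
          = ls_convolution (F n) (p n) (u * \<tau> n) / (a n * \<beta> n ^ Suc i)"
        by (simp only: ls_convolution_rescale[OF F p \<tau>(1) \<beta> u] power_Suc2 mult.assoc)
      moreover have "ls_convolution (\<lambda>u. R n (u * \<tau> n) / a n) (\<lambda>u. conv_power b (Suc i) (u * \<tau> n) / \<beta> n ^ Suc i) u
          = ls_convolution (R n) (conv_power b (Suc i)) (u * \<tau> n) / (a n * \<beta> n ^ Suc i)"
        by (simp only: ls_convolution_rescale[OF R mb \<tau>(1) zero_less_power[OF \<beta>] u])
      ultimately show "ls_convolution (\<lambda>u. F n (u * \<tau> n) / (a n * \<beta> n ^ i)) (\<lambda>u. p n (u * \<tau> n) / \<beta> n) u
          + ls_convolution (\<lambda>u. R n (u * \<tau> n) / a n) (\<lambda>u. conv_power b (Suc i) (u * \<tau> n) / \<beta> n ^ Suc i) u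
          = ?D (Suc i) n u / (a n * \<beta> n ^ Suc i)"
        unfolding conv_power_difference[OF p b ut] F_def[abs_def] R_def[abs_def] by (simp only: add_divide_distrib)
    qed simp
  qed
  have norm: "(\<lambda>n. \<beta> n ^ i / conv_power b i (\<tau> n)) \<longlonglongrightarrow> 1 / power_const \<alpha> i"
  proof -
    have "(\<lambda>n. conv_power b i (1 * \<tau> n) / \<beta> n ^ i) \<longlonglongrightarrow> ?kf i 1"
      by (rule tendsto_uniform_limitI[OF Bj]) (use U in auto)
    then have "(\<lambda>n. 1 / (conv_power b i (1 * \<tau> n) / \<beta> n ^ i)) \<longlonglongrightarrow> 1 / ?kf i 1"
      using power_const_pos[OF \<alpha>, of i] pf(4)[of i] by (intro tendsto_divide tendsto_const) auto
    then show ?thesis using pf(4)[of i] by simp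
  qed
  have "uniform_limit {0..U} (\<lambda>n u. ?D i n u / (a n * \<beta> n ^ i) * (\<beta> n ^ i / conv_power b i (\<tau> n))) (\<lambda>u. limit_rec \<alpha> x i u * (1 / power_const \<alpha> i)) sequentially"
    by (rule uniform_limit_mult_const[OF D continuous_on_limit_rec[OF \<alpha> x] norm])
  then show ?thesis
  proof (rule uniform_limit_cong'[THEN iffD1, rotated 2])
    fix n u
    have "\<beta> n ^ i \<noteq> 0" using \<beta>[of n] by simp
    then show "?D i n u / (a n * \<beta> n ^ i) * (\<beta> n ^ i / conv_power b i (\<tau> n))
        = ?D i n u / (a n * conv_power b i (\<tau> n))"
      by simp
  next
    fix u assume "u \<in> {0..U}"
    then have u: "0 \<le> u" by simp
    show "limit_rec \<alpha> x i u * (1 / power_const \<alpha> i) = limit_path \<alpha> x (Suc i) u"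
      using power_const_pos[OF \<alpha>, of i]
      by (simp add: limit_rec_eq[OF \<alpha> x u] limit_path_eq[OF \<alpha> x u] ls_convolution_cmult_right[OF cx pf(1) _ u])
  qed
qed

section \<open>Uniform distance and Skorokhod distance\<close>

lemma skorokhod_dist_terms:
  assumes "x \<in> skorokhod_space" "y \<in> skorokhod_space"
  defines "c \<equiv> \<lambda>n. (1/2::real) ^ Suc n *
      min 1 (skorokhod_dist_upto (real (Suc n)) (taper (real (Suc n)) x) (taper (real (Suc n)) y))"
  shows "0 \<le> c n" "c n \<le> (1/2) ^ Suc n" "summable c" "skorokhod_dist x y = suminf c"
proof -
  have c0: "0 \<le> c n" for n
  proof -
    obtain e where "skorokhod_admissible (real (Suc n)) (taper (real (Suc n)) x) (taper (real (Suc n)) y) e"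
      using admissible_nonempty[of x y "real (Suc n)"] assms(1,2) by (auto simp: skorokhod_space_def)
    then show ?thesis unfolding c_def using skorokhod_dist_upto_nonneg by (intro mult_nonneg_nonneg) auto
  qed
  have c1: "c n \<le> (1/2) ^ Suc n" for n
    unfolding c_def by (intro mult_left_le) auto
  show "0 \<le> c n" "c n \<le> (1/2) ^ Suc n" by (fact c0, fact c1)
  show "summable c"
    by (rule summable_comparison_test'[OF sums_summable[OF power_half_series], of 0]) (use c0 c1 in auto)
  show "skorokhod_dist x y = suminf c"
    using assms by (simp add: skorokhod_dist_def c_def)
qed

text \<open>The terms of the series beyond \<open>m\<close> sum to at most \<open>(1/2) ^ m\<close>.\<close>
lemma skorokhod_dist_le:
  assumes xy: "x \<in> skorokhod_space" "y \<in> skorokhod_space" and e: "0 \<le> e"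
    and le: "\<And>k. 1 \<le> k \<Longrightarrow> k \<le> m \<Longrightarrow> skorokhod_dist_upto (real k) (taper (real k) x) (taper (real k) y) \<le> e"
  shows "skorokhod_dist x y \<le> e + (1/2) ^ m"
proof -
  let ?c = "\<lambda>n. (1/2::real) ^ Suc n *
      min 1 (skorokhod_dist_upto (real (Suc n)) (taper (real (Suc n)) x) (taper (real (Suc n)) y))"
  let ?t = "\<lambda>n. if n < m then 0 else (1/2::real) ^ Suc n"
  have "(\<lambda>n. (1/2::real) ^ m * (1/2) ^ Suc n) sums ((1/2) ^ m * 1)"
    by (rule sums_mult[OF power_half_series])
  then have "(\<lambda>n. ?t (n + m)) sums ((1/2) ^ m)"
    by (simp add: power_add mult_ac)
  then have t: "?t sums ((1/2) ^ m)"
    using sums_iff_shift[of ?t m "(1/2) ^ m"] by simp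
  have b: "(\<lambda>n. e * (1/2) ^ Suc n + ?t n) sums (e * 1 + (1/2) ^ m)"
    by (intro sums_add sums_mult power_half_series t)
  have "?c n \<le> e * (1/2) ^ Suc n + ?t n" for n
  proof (cases "n < m")
    case True
    then have "min 1 (skorokhod_dist_upto (real (Suc n)) (taper (real (Suc n)) x) (taper (real (Suc n)) y)) \<le> e"
      using le[of "Suc n"] by auto
    then have "?c n \<le> (1/2) ^ Suc n * e" by (intro mult_left_mono) auto
    then show ?thesis using True by (simp add: mult.commute)
  next
    case False
    have "0 \<le> e * (1/2) ^ Suc n" using e by simp
    moreover have "?t n = (1/2) ^ Suc n" using False by simp
    ultimately show ?thesis using skorokhod_dist_terms(2)[OF xy, of n] by linarith
  qed
  then have "suminf ?c \<le> (\<Sum>n. e * (1/2) ^ Suc n + ?t n)"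
    by (intro suminf_le skorokhod_dist_terms(3)[OF xy] sums_summable[OF b])
  then show ?thesis using sums_unique[OF b] skorokhod_dist_terms(4)[OF xy] by simp
qed

lemma abs_taper_le: "\<bar>taper m x s - taper m y s\<bar> \<le> \<bar>x s - y s\<bar>"
proof -
  have "taper m x s - taper m y s = max 0 (min 1 (m - s)) * (x s - y s)"
    by (simp add: taper_def right_diff_distrib)
  then show ?thesis by (simp add: abs_mult mult_left_le_one_le)
qed

lemma skorokhod_dist_le_uniform:
  assumes xy: "x \<in> skorokhod_space" "y \<in> skorokhod_space" and e: "0 < e"
    and le: "\<And>s. s \<in> {0..real m} \<Longrightarrow> \<bar>x s - y s\<bar> \<le> e"
  shows "skorokhod_dist x y \<le> e + (1/2) ^ m"
proof (rule skorokhod_dist_le[OF xy less_imp_le[OF e]])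
  fix k assume k: "1 \<le> k" "k \<le> m"
  have "\<bar>taper (real k) x s - taper (real k) y s\<bar> \<le> e" if "s \<in> {0..real k}" for s
    using abs_taper_le[of "real k" x s y] le[of s] that k by auto
  then have "skorokhod_admissible (real k) (taper (real k) x) (taper (real k) y) e"
    unfolding skorokhod_admissible_def using e
    by (intro conjI bexI[OF _ id_time_change]) auto
  then show "skorokhod_dist_upto (real k) (taper (real k) x) (taper (real k) y) \<le> e"
    by (rule skorokhod_dist_upto_le)
qed

lemma half_power_less:
  assumes "(0::real) < e" obtains m where "(1/2) ^ m < e"
  using real_arch_pow_inv[OF assms, of "1/2"] by auto

lemma uniform_limit_imp_skorokhod:
  assumes x: "x \<in> skorokhod_space" and X: "\<And>n::nat. X n \<in> skorokhod_space"
    and lim: "\<And>U. 0 \<le> U \<Longrightarrow> uniform_limit {0..U} X x sequentially"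
  shows "limitin J1_topology X x sequentially"
proof -
  interpret Metric_space skorokhod_space skorokhod_dist by (rule skorokhod_metric)
  show ?thesis unfolding J1_topology_def limitin_metric
  proof (intro conjI x allI impI)
    fix e :: real assume e: "0 < e"
    obtain m where m: "(1/2::real) ^ m < e / 2" using half_power_less[of "e / 2"] e by auto
    have "\<forall>\<^sub>F n in sequentially. \<forall>s\<in>{0..real m}. dist (X n s) (x s) < e / 2"
      using e by (intro uniform_limitD[OF lim]) auto
    then show "\<forall>\<^sub>F n in sequentially. X n \<in> skorokhod_space \<and> skorokhod_dist (X n) x < e"
    proof eventually_elim
      case (elim n)
      have "skorokhod_dist (X n) x \<le> e / 2 + (1/2) ^ m"
        using elim e by (intro skorokhod_dist_le_uniform X x) (auto simp: dist_real_def intro!: less_imp_le)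
      then show ?case using X m by simp
    qed
  qed
qed

text \<open>
  The time change moves every point by a small amount only, which hardly changes the value of a continuous
  function.  The horizon \<open>U + 2\<close> keeps \<open>s\<close> and its image in the region where the taper is 1.
\<close>
lemma skorokhod_close_to_continuous:
  assumes x: "x \<in> skorokhod_space" "continuous_on {0..} x" and e: "0 < e" and U: "0 \<le> U"
  obtains \<delta> where "0 < \<delta>" "\<And>y s. y \<in> skorokhod_space \<Longrightarrow> skorokhod_dist x y < \<delta> \<Longrightarrow> s \<in> {0..U} \<Longrightarrow> \<bar>y s - x s\<bar> \<le> e"
proof -
  obtain n where "U + 2 < real n" using reals_Archimedean2 by blast
  then have n: "U + 2 < real (Suc n)" by simp
  let ?m = "real (Suc n)"
  obtain d where d: "0 < d" "\<And>v w. v \<in> {0..?m} \<Longrightarrow> w \<in> {0..?m} \<Longrightarrow> \<bar>v - w\<bar> \<le> d \<Longrightarrow> \<bar>x v - x w\<bar> \<le> e / 2"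
    using uniform_modulus[OF x(2), of "e / 2" ?m] e by auto
  define \<eta> where "\<eta> = min 1 (min d (e / 2))"
  have \<eta>: "0 < \<eta>" "\<eta> \<le> 1" "\<eta> \<le> d" "\<eta> \<le> e / 2" using d e by (auto simp: \<eta>_def)
  show thesis
  proof (rule that[of "(1/2) ^ Suc n * \<eta>"])
    show "0 < (1/2) ^ Suc n * \<eta>" using \<eta> by simp
    fix y s assume y: "y \<in> skorokhod_space" and xy: "skorokhod_dist x y < (1/2) ^ Suc n * \<eta>" and s: "s \<in> {0..U}"
    note t = skorokhod_dist_terms[OF x(1) y]
    have "(1/2) ^ Suc n * min 1 (skorokhod_dist_upto ?m (taper ?m x) (taper ?m y)) \<le> skorokhod_dist x y"
      unfolding t(4) using sum_le_suminf[OF t(3), of "{n}"] t(1) by simp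
    then have "(1/2) ^ Suc n * min 1 (skorokhod_dist_upto ?m (taper ?m x) (taper ?m y)) < (1/2) ^ Suc n * \<eta>"
      using xy by linarith
    then have "min 1 (skorokhod_dist_upto ?m (taper ?m x) (taper ?m y)) < \<eta>"
      by (subst (asm) mult_less_cancel_left_pos) auto
    then have lt: "skorokhod_dist_upto ?m (taper ?m y) (taper ?m x) < \<eta>"
      using \<eta>(2) unfolding skorokhod_dist_upto_commute[of ?m "taper ?m y"] by linarith
    obtain e0 where "skorokhod_admissible ?m (taper ?m y) (taper ?m x) e0"
      using admissible_nonempty[of y x ?m] x y by (auto simp: skorokhod_space_def)
    then obtain e' where e': "e' < \<eta>" "skorokhod_admissible ?m (taper ?m y) (taper ?m x) e'"
      using skorokhod_dist_upto_lessD lt by blast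
    have sm: "s \<in> {0..?m}" using s n by auto
    then obtain l where l: "l \<in> time_changes ?m" "\<bar>l s - s\<bar> \<le> e'" "\<bar>taper ?m y s - taper ?m x (l s)\<bar> \<le> e'"
      using e'(2) unfolding skorokhod_admissible_def by blast
    have ls: "l s \<in> {0..?m}" using time_change_in[OF l(1) sm] .
    have "1 \<le> ?m - s" "1 \<le> ?m - l s" using s n l(2) e' \<eta> by auto
    then have "taper ?m y s = y s" "taper ?m x (l s) = x (l s)" by (simp_all add: taper_def min_absorb1)
    then have "\<bar>y s - x (l s)\<bar> \<le> e / 2" using l(3) e' \<eta> by simp
    moreover have "\<bar>x (l s) - x s\<bar> \<le> e / 2" using l(2) e' \<eta> by (intro d(2) ls sm) auto
    ultimately show "\<bar>y s - x s\<bar> \<le> e" by linarith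
  qed
qed

section \<open>Discretisation of cadlag functions\<close>

definition grid_step :: "nat \<Rightarrow> (nat \<Rightarrow> real) \<Rightarrow> real \<Rightarrow> real" where
  "grid_step n c u = c (nat \<lfloor>real n * u\<rfloor>)"

lemma cadlag_grid_step:
  assumes n: "0 < n"
  shows "cadlag (grid_step n c)"
  unfolding cadlag_def
proof (intro conjI allI impI)
  fix t :: real assume "0 \<le> t"
  let ?r = "(of_int \<lfloor>real n * t\<rfloor> + 1) / real n"
  have r: "t < ?r" using n floor_correct[of "real n * t"] by (simp add: field_simps)
  have "grid_step n c u = grid_step n c t" if "u \<in> {t<..<?r}" for u
  proof -
    have "real n * t \<le> real n * u" "real n * u < of_int \<lfloor>real n * t\<rfloor> + 1"
      using that n by (auto simp: field_simps)
    then have "\<lfloor>real n * u\<rfloor> = \<lfloor>real n * t\<rfloor>" by (intro floor_unique) linarith+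
    then show ?thesis by (simp add: grid_step_def)
  qed
  then have "\<forall>\<^sub>F u in at_right t. grid_step n c u = grid_step n c t"
    using r by (intro eventually_at_rightI[of t ?r]) auto
  then show "continuous (at_right t) (grid_step n c)"
    by (auto simp: continuous_within intro: tendsto_eventually)
next
  fix t :: real assume "0 < t"
  let ?l = "(of_int \<lceil>real n * t\<rceil> - 1) / real n"
  have l: "?l < t" using n ceiling_correct[of "real n * t"] by (simp add: field_simps)
  have "grid_step n c u = c (nat (\<lceil>real n * t\<rceil> - 1))" if "u \<in> {?l<..<t}" for u
  proof -
    have "real n * u < real n * t" "of_int \<lceil>real n * t\<rceil> - 1 < real n * u"
      using that n by (auto simp: field_simps)
    then have "\<lfloor>real n * u\<rfloor> = \<lceil>real n * t\<rceil> - 1" by (intro floor_unique) (simp, linarith)+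
    then show ?thesis by (simp add: grid_step_def)
  qed
  then have "\<forall>\<^sub>F u in at_left t. grid_step n c u = c (nat (\<lceil>real n * t\<rceil> - 1))"
    using l by (intro eventually_at_leftI[of ?l t]) auto
  then show "\<exists>l. (grid_step n c \<longlongrightarrow> l) (at_left t)" by (blast intro: tendsto_eventually)
qed

text \<open>Time changes between intervals with different end points, as needed to build a time change piece by piece.\<close>
definition time_change_between :: "real \<Rightarrow> real \<Rightarrow> real \<Rightarrow> real \<Rightarrow> (real \<Rightarrow> real) \<Rightarrow> bool" where
  "time_change_between p q u v l \<longleftrightarrow>
     strict_mono_on {p..q} l \<and> continuous_on {p..q} l \<and> l p = u \<and> l q = v"

lemma time_change_between_linear:
  assumes "p < q" "u < v"
  shows "time_change_between p q u v (\<lambda>s. u + (s - p) * ((v - u) / (q - p)))"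
proof -
  have "0 < (v - u) / (q - p)" using assms by simp
  then have "strict_mono_on {p..q} (\<lambda>s. u + (s - p) * ((v - u) / (q - p)))"
    by (intro strict_mono_onI add_strict_left_mono mult_strict_right_mono) auto
  then show ?thesis using assms
    by (auto simp: time_change_between_def intro!: continuous_intros)
qed

lemma time_change_between_glue:
  assumes 1: "time_change_between p q u v l1" and 2: "time_change_between q r v w l2" and pq: "p \<le> q" "q \<le> r"
  shows "time_change_between p r u w (\<lambda>s. if s \<le> q then l1 s else l2 s)"
proof -
  have m1: "strict_mono_on {p..q} l1" "continuous_on {p..q} l1" "l1 p = u" "l1 q = v"
    and m2: "strict_mono_on {q..r} l2" "continuous_on {q..r} l2" "l2 q = v" "l2 r = w"
    using 1 2 by (auto simp: time_change_between_def)
  have "strict_mono_on {p..r} (\<lambda>s. if s \<le> q then l1 s else l2 s)"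
  proof (rule strict_mono_onI)
    fix a b assume ab: "a \<in> {p..r}" "b \<in> {p..r}" "a < b"
    consider "b \<le> q" | "a \<le> q" "q < b" | "q < a" by linarith
    then show "(if a \<le> q then l1 a else l2 a) < (if b \<le> q then l1 b else l2 b)"
    proof cases
      case 1
      then show ?thesis using strict_mono_onD[OF m1(1), of a b] ab by auto
    next
      case 2
      have "l1 a \<le> v" using strict_mono_onD[OF m1(1), of a q] 2 ab pq m1(4) by (cases "a = q") auto
      moreover have "v < l2 b" using strict_mono_onD[OF m2(1), of q b] 2 ab pq m2(3) by auto
      ultimately show ?thesis using 2 by auto
    next
      case 3
      then show ?thesis using strict_mono_onD[OF m2(1), of a b] ab by auto
    qed
  qed
  moreover have "continuous_on ({p..q} \<union> {q..r}) (\<lambda>s. if s \<le> q then l1 s else l2 s)"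
    by (rule continuous_on_If) (use m1 m2 in auto)
  moreover have "{p..q} \<union> {q..r} = {p..r}" using pq by auto
  moreover have "(if r \<le> q then l1 r else l2 r) = w"
    using pq m1 m2 by (cases "r = q") auto
  ultimately show ?thesis using pq m1 by (simp add: time_change_between_def)
qed

lemma time_change_between_range:
  assumes "time_change_between p q u v l" "s \<in> {p..q}"
  shows "u \<le> l s" "l s \<le> v" "s < q \<Longrightarrow> l s < v"
proof -
  have m: "strict_mono_on {p..q} l" "l p = u" "l q = v"
    using assms by (auto simp: time_change_between_def)
  show "u \<le> l s" using strict_mono_onD[OF m(1), of p s] m assms(2) by (cases "p = s") auto
  show "s < q \<Longrightarrow> l s < v" using strict_mono_onD[OF m(1), of s q] m assms(2) by auto
  show "l s \<le> v" using strict_mono_onD[OF m(1), of s q] m assms(2) by (cases "s = q") auto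
qed

text \<open>Surjectivity is the intermediate value theorem.\<close>
lemma time_change_between_imp_time_change:
  assumes "time_change_between 0 m 0 m l" "0 \<le> m"
  shows "l \<in> time_changes m"
proof -
  have m: "strict_mono_on {0..m} l" "continuous_on {0..m} l" "l 0 = 0" "l m = m"
    using assms by (auto simp: time_change_between_def)
  have "{0..m} \<subseteq> l ` {0..m}"
  proof
    fix y assume "y \<in> {0..m}"
    then show "y \<in> l ` {0..m}" using IVT'[of l 0 y m] m assms(2) by force
  qed
  moreover have "l ` {0..m} \<subseteq> {0..m}"
    using time_change_between_range[OF assms(1)] by auto
  ultimately show ?thesis using m by (auto simp: time_changes_def)
qed

definition grid_up :: "nat \<Rightarrow> real \<Rightarrow> real" where
  "grid_up n v = of_int \<lceil>real n * v\<rceil> / real n"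

lemma grid_up_bounds:
  assumes "0 < n"
  shows "v \<le> grid_up n v" "grid_up n v < v + 1 / real n"
proof -
  have "real n * v \<le> of_int \<lceil>real n * v\<rceil>" "of_int \<lceil>real n * v\<rceil> < real n * v + 1" by linarith+
  then show "v \<le> grid_up n v" "grid_up n v < v + 1 / real n"
    using assms by (auto simp: grid_up_def field_simps)
qed

lemma grid_up_mono: "u \<le> v \<Longrightarrow> grid_up n u \<le> grid_up n v"
  unfolding grid_up_def by (intro divide_right_mono) (auto intro!: ceiling_mono mult_left_mono)

text \<open>
  Property \<open>P u v\<close> says that on \<open>[u, v]\<close> the discretisation can be matched to \<open>f\<close> by a time change, for all fine
  grids.  Where the oscillation of \<open>f\<close> on \<open>[u, v)\<close> is small, the linear time change from the grid points
  \<open>\<lceil>nu\<rceil>/n\<close> and \<open>\<lceil>nv\<rceil>/n\<close> to \<open>u\<close> and \<open>v\<close> does it: rounding a point between these down to the grid leaves it in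
  \<open>[u, v)\<close>.  Time changes of adjacent intervals can be glued, and a cadlag function has small oscillation on a
  short interval to either side of each point, so Bolzano's bisection principle yields the whole interval.
\<close>
lemma cadlag_grid_matching:
  assumes f: "cadlag f" and m: "0 \<le> m" and e: "0 < e"
  obtains n0 where "\<And>n. n0 \<le> n \<Longrightarrow> \<exists>l. time_change_between (grid_up n 0) (grid_up n m) 0 m l \<and>
     (\<forall>s\<in>{grid_up n 0..grid_up n m}. \<bar>l s - s\<bar> \<le> 1 / real n \<and>
        (s < grid_up n m \<longrightarrow> \<bar>grid_step n (\<lambda>k. f (real k / real n)) s - f (l s)\<bar> \<le> e))"
proof -
  define M where "M n u v l \<longleftrightarrow> time_change_between (grid_up n u) (grid_up n v) u v l \<and>
     (\<forall>s\<in>{grid_up n u..grid_up n v}. \<bar>l s - s\<bar> \<le> 1 / real n \<and>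
        (s < grid_up n v \<longrightarrow> \<bar>grid_step n (\<lambda>k. f (real k / real n)) s - f (l s)\<bar> \<le> e))" for n u v l
  define P where "P u v \<longleftrightarrow> (\<exists>n0. \<forall>n\<ge>n0. \<exists>l. M n u v l)" for u v
  have glue: "P u w" if uv: "P u v" and vw: "P v w" and le: "u \<le> v" "v \<le> w" for u v w
  proof -
    obtain n1 n2 where n1: "\<forall>n\<ge>n1. \<exists>l. M n u v l" and n2: "\<forall>n\<ge>n2. \<exists>l. M n v w l"
      using uv vw unfolding P_def by blast
    have "\<exists>l. M n u w l" if n: "max n1 n2 \<le> n" for n
    proof -
      obtain l1 l2 where l: "M n u v l1" "M n v w l2" using n1 n2 n by fastforce
      let ?l = "\<lambda>s. if s \<le> grid_up n v then l1 s else l2 s"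
      have "time_change_between (grid_up n u) (grid_up n w) u w ?l"
        using l le by (intro time_change_between_glue[where v = v] grid_up_mono) (auto simp: M_def)
      moreover have "\<bar>?l s - s\<bar> \<le> 1 / real n \<and>
          (s < grid_up n w \<longrightarrow> \<bar>grid_step n (\<lambda>k. f (real k / real n)) s - f (?l s)\<bar> \<le> e)"
        if s: "s \<in> {grid_up n u..grid_up n w}" for s
      proof -
        consider "s < grid_up n v" | "s = grid_up n v" | "grid_up n v < s" by linarith
        then show ?thesis
        proof cases
          case 1
          then show ?thesis using l(1) s unfolding M_def by auto
        next
          case 2
          have "l1 (grid_up n v) = l2 (grid_up n v)"
            using l by (auto simp: M_def time_change_between_def)
          then have "?l s = l2 s" using 2 by simp
          then show ?thesis using l(2) s 2 unfolding M_def by auto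
        next
          case 3
          then show ?thesis using l(2) s unfolding M_def by auto
        qed
      qed
      ultimately have "M n u w ?l" unfolding M_def by blast
      then show ?thesis by blast
    qed
    then show ?thesis unfolding P_def by blast
  qed
  have refl: "P u u" if "0 \<le> u" for u
    unfolding P_def
  proof (intro exI[of _ 1] allI impI)
    fix n :: nat assume "1 \<le> n"
    then have "\<bar>u - grid_up n u\<bar> \<le> 1 / real n" using grid_up_bounds[of n u] by auto
    then have "M n u u (\<lambda>s. u)" by (auto simp: M_def time_change_between_def strict_mono_on_def)
    then show "\<exists>l. M n u u l" by blast
  qed
  have osc: "P u v" if u: "0 \<le> u" "u < v"
      and small: "\<And>a b. u \<le> a \<Longrightarrow> a < v \<Longrightarrow> u \<le> b \<Longrightarrow> b < v \<Longrightarrow> \<bar>f a - f b\<bar> \<le> e" for u v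
  proof -
    obtain n0 where "1 / (v - u) < real n0" using reals_Archimedean2 by blast
    then have n0: "1 / (v - u) < real (Suc n0)" by simp
    have "\<exists>l. M n u v l" if "Suc n0 \<le> n" for n
    proof -
      have n: "0 < n" using that by simp
      have "real (Suc n0) \<le> real n" using that by (simp only: of_nat_le_iff)
      then have "1 / (v - u) < real n" using n0 by linarith
      then have "1 / real n < v - u" using u n by (simp add: field_simps)
      then have pq: "grid_up n u < grid_up n v" using grid_up_bounds[OF n, of u] grid_up_bounds[OF n, of v] by linarith
      define p q where "p = grid_up n u" and "q = grid_up n v"
      define l where "l = (\<lambda>s. u + (s - p) * ((v - u) / (q - p)))"
      have tc: "time_change_between p q u v l"
        unfolding l_def using pq u by (intro time_change_between_linear) (auto simp: p_def q_def)
      have "\<bar>l s - s\<bar> \<le> 1 / real n" if s: "s \<in> {p..q}" for s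
      proof -
        \<comment> \<open>The displacement interpolates linearly between the displacements at the two ends.\<close>
        define \<theta> where "\<theta> = (s - p) / (q - p)"
        have qp: "0 < q - p" using pq by (simp add: p_def q_def)
        have \<theta>: "0 \<le> \<theta>" "\<theta> \<le> 1" using s qp by (auto simp: \<theta>_def)
        have s': "s = p + \<theta> * (q - p)" "l s = u + \<theta> * (v - u)" using qp by (auto simp: \<theta>_def l_def)
        have "s - l s = (1 - \<theta>) * (p - u) + \<theta> * (q - v)" 
        proof -
          have "s - l s = (p + \<theta> * (q - p)) - (u + \<theta> * (v - u))" using s' by linarith
          then show ?thesis by (simp add: algebra_simps)
        qed
        moreover have "0 \<le> p - u" "p - u \<le> 1 / real n" "0 \<le> q - v" "q - v \<le> 1 / real n"
          using grid_up_bounds[OF n, of u] grid_up_bounds[OF n, of v] by (auto simp: p_def q_def)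
        moreover from this \<theta> have "(1 - \<theta>) * (p - u) + \<theta> * (q - v) \<le> (1 - \<theta>) * (1 / real n) + \<theta> * (1 / real n)"
          by (intro add_mono mult_left_mono) auto
        moreover have "(1 - \<theta>) * (1 / real n) + \<theta> * (1 / real n) = 1 / real n"
          unfolding distrib_right[symmetric] by simp
        moreover have "0 \<le> (1 - \<theta>) * (p - u) + \<theta> * (q - v)"
          using \<theta> calculation(2,4) by (intro add_nonneg_nonneg mult_nonneg_nonneg) auto
        ultimately show ?thesis by linarith
      qed
      moreover have "\<bar>grid_step n (\<lambda>k. f (real k / real n)) s - f (l s)\<bar> \<le> e" if s: "s \<in> {p..q}" "s < q" for s
      proof -
        have "of_int \<lceil>real n * u\<rceil> \<le> real n * s" "real n * s < of_int \<lceil>real n * v\<rceil>"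
          using s n by (auto simp: p_def q_def grid_up_def field_simps)
        then have "\<lceil>real n * u\<rceil> \<le> \<lfloor>real n * s\<rfloor>" "\<lfloor>real n * s\<rfloor> < \<lceil>real n * v\<rceil>"
          by (auto simp: le_floor_iff floor_less_iff)
        then have fl: "real n * u \<le> of_int \<lfloor>real n * s\<rfloor>" "of_int \<lfloor>real n * s\<rfloor> < real n * v"
          by (auto simp: ceiling_le_iff less_ceiling_iff)
        have "0 \<le> real n * u" using u by simp
        then have "0 \<le> \<lfloor>real n * s\<rfloor>" using fl(1) by linarith
        then have r: "real (nat \<lfloor>real n * s\<rfloor>) = of_int \<lfloor>real n * s\<rfloor>" by simp
        have "u \<le> real (nat \<lfloor>real n * s\<rfloor>) / real n" "real (nat \<lfloor>real n * s\<rfloor>) / real n < v"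
          unfolding r using fl n by (auto simp: field_simps)
        then show ?thesis unfolding grid_step_def
          using time_change_between_range[OF tc s(1)] s(2) by (intro small) auto
      qed
      ultimately have "M n u v l" using tc unfolding M_def p_def q_def by blast
      then show ?thesis by blast
    qed
    then show ?thesis unfolding P_def by blast
  qed
  have "P (max 0 0) (max 0 m)"
  proof (rule Bolzano[of 0 m "\<lambda>u v. P (max 0 u) (max 0 v)", OF m])
    fix a b c assume "P (max 0 a) (max 0 b)" "P (max 0 b) (max 0 c)" "a \<le> b" "b \<le> c"
    then show "P (max 0 a) (max 0 c)" by (auto intro: glue)
  next
    fix t assume t: "0 \<le> t" "t \<le> m"
    have "(f \<longlongrightarrow> f t) (at_right t)" using f t by (auto simp: cadlag_def continuous_within)
    then have "\<forall>\<^sub>F s in at_right t. dist (f s) (f t) < e / 2" by (rule tendstoD) (use e in simp)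
    then obtain r where r: "t < r" "\<And>s. t < s \<Longrightarrow> s < r \<Longrightarrow> dist (f s) (f t) < e / 2"
      unfolding eventually_at_right_field by blast
    obtain L q where q: "q < t" "\<And>s. 0 \<le> s \<Longrightarrow> q < s \<Longrightarrow> s < t \<Longrightarrow> dist (f s) L < e / 2"
    proof (cases "t = 0")
      case True
      then show thesis using that[of "-1" 0] by auto
    next
      case False
      then obtain L where "(f \<longlongrightarrow> L) (at_left t)" using f t unfolding cadlag_def by force
      then have "\<forall>\<^sub>F s in at_left t. dist (f s) L < e / 2" by (rule tendstoD) (use e in simp)
      then show thesis using that unfolding eventually_at_left_field by blast
    qed
    have left: "P (max 0 u) t" if u: "q < u" "u \<le> t" for u
    proof (cases "max 0 u = t")
      case True
      then show ?thesis using refl[OF t(1)] by simp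
    next
      case False
      then have lt: "max 0 u < t" using u t by auto
      show ?thesis
      proof (rule osc[OF _ lt])
        fix a b assume ab: "max 0 u \<le> a" "a < t" "max 0 u \<le> b" "b < t"
        then have "0 \<le> a" "q < a" "0 \<le> b" "q < b" using u by auto
        then have "dist (f a) L < e / 2" "dist (f b) L < e / 2" using q(2) ab by blast+
        then show "\<bar>f a - f b\<bar> \<le> e" unfolding dist_real_def by linarith
      qed simp
    qed
    have right: "P t v" if v: "t \<le> v" "v < r" for v
    proof (cases "v = t")
      case True
      then show ?thesis using refl[OF t(1)] by simp
    next
      case False
      then have lt: "t < v" using v by simp
      have near: "dist (f s) (f t) < e / 2" if "t \<le> s" "s < v" for s
        using r(2)[of s] that v e by (cases "s = t") auto
      show ?thesis
      proof (rule osc[OF t(1) lt])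
        fix a b assume "t \<le> a" "a < v" "t \<le> b" "b < v"
        then have "dist (f a) (f t) < e / 2" "dist (f b) (f t) < e / 2" using near by auto
        then show "\<bar>f a - f b\<bar> \<le> e" unfolding dist_real_def by linarith
      qed
    qed
    show "\<exists>d>0. \<forall>u v. u \<le> t \<and> t \<le> v \<and> v - u < d \<longrightarrow> P (max 0 u) (max 0 v)"
    proof (intro exI[of _ "min (t - q) (r - t)"] conjI allI impI)
      fix u v assume uv: "u \<le> t \<and> t \<le> v \<and> v - u < min (t - q) (r - t)"
      have "max 0 v = v" using uv t by simp
      then show "P (max 0 u) (max 0 v)"
        using glue[OF left right, of u v] uv t by auto
    qed (use q r in auto)
  qed
  then have "P 0 m" using m by simp
  then show thesis using that unfolding P_def M_def by blast
qed

lemma cadlag_restrict: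
  assumes "cadlag g"
  shows "cadlag (restrict g {0..})"
    unfolding cadlag_def
  proof (intro conjI allI impI)
    fix t :: real assume t: "0 \<le> t"
    have "\<forall>\<^sub>F s in at_right t. restrict g {0..} s = g s"
      using t by (auto simp: eventually_at_filter)
    then show "continuous (at_right t) (restrict g {0..})"
      using assms t by (auto simp: cadlag_def continuous_within tendsto_cong)
  next
    fix t :: real assume t: "0 < t"
    obtain l where l: "(g \<longlongrightarrow> l) (at_left t)" using assms t unfolding cadlag_def by blast
    have "\<forall>\<^sub>F s in at_left t. restrict g {0..} s = g s"
      using t by (intro eventually_at_leftI[of 0 t]) auto
    then have "(restrict g {0..} \<longlongrightarrow> l) (at_left t)" using l by (simp add: tendsto_cong)
    then show "\<exists>l. (restrict g {0..} \<longlongrightarrow> l) (at_left t)" ..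
  qed

text \<open>
  The horizons \<open>k\<close> are integers and hence grid points, so the matching time change is a time change of \<open>[0, k]\<close>.
  The matching leaves out the right end point, where the taper vanishes.
\<close>
lemma grid_step_tendsto_skorokhod:
  assumes f: "cadlag f"
  shows "limitin J1_topology (\<lambda>n. restrict (grid_step (Suc n) (\<lambda>k. f (real k / real (Suc n)))) {0..})
           (restrict f {0..}) sequentially"
proof -
  interpret Metric_space skorokhod_space skorokhod_dist by (rule skorokhod_metric)
  let ?F = "\<lambda>n. restrict (grid_step n (\<lambda>k. f (real k / real n))) {0..}"
  have fD: "restrict f {0..} \<in> skorokhod_space" using cadlag_restrict[OF f] by (simp add: skorokhod_space_def)
  have FD: "?F n \<in> skorokhod_space" if "0 < n" for n
    using cadlag_restrict[OF cadlag_grid_step[OF that]] by (simp add: skorokhod_space_def)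
  have ev: "\<forall>\<^sub>F n in sequentially. skorokhod_dist_upto (real k) (taper (real k) (?F n)) (taper (real k) (restrict f {0..})) \<le> e"
    if e: "0 < e" for e k
  proof -
    have e2: "0 < e / 2" using e by simp
    have k0: "0 \<le> real k" by simp
    obtain B where B: "\<forall>s\<in>{0..real k}. \<bar>f s\<bar> \<le> B" using cadlag_bounded[OF f k0] ..
    have B0: "0 \<le> B" using bspec[OF B, of 0] by simp
    obtain n0 where n0: "\<And>n. n0 \<le> n \<Longrightarrow> \<exists>l. time_change_between (grid_up n 0) (grid_up n (real k)) 0 (real k) l \<and>
     (\<forall>s\<in>{grid_up n 0..grid_up n (real k)}. \<bar>l s - s\<bar> \<le> 1 / real n \<and>
        (s < grid_up n (real k) \<longrightarrow> \<bar>grid_step n (\<lambda>k. f (real k / real n)) s - f (l s)\<bar> \<le> e / 2))"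
      using cadlag_grid_matching[OF f k0 e2] by blast
    have "\<forall>\<^sub>F n in sequentially. 1 / real n < e / (2 * (B + 1))"
      using lim_1_over_n e B0 by (intro order_tendstoD(2)) auto
    then show ?thesis using eventually_ge_at_top[of "max 1 n0"]
    proof eventually_elim
      case (elim n)
      then have n: "0 < n" "n0 \<le> n" by auto
      have up: "grid_up n 0 = 0" "grid_up n (real k) = real k"
        using n ceiling_of_nat[of "n * k", where 'a = real] by (auto simp: grid_up_def)
      obtain l where tc: "time_change_between 0 (real k) 0 (real k) l"
        and l: "\<And>s. s \<in> {0..real k} \<Longrightarrow> \<bar>l s - s\<bar> \<le> 1 / real n"
          "\<And>s. s \<in> {0..real k} \<Longrightarrow> s < real k \<Longrightarrow> \<bar>grid_step n (\<lambda>k. f (real k / real n)) s - f (l s)\<bar> \<le> e / 2"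
        using n0[OF n(2)] unfolding up by blast
      have "1 / real n * (B + 1) < e / 2" using elim B0 by (simp add: field_simps)
      moreover have "1 / real n * 1 \<le> 1 / real n * (B + 1)" "1 / real n * B \<le> 1 / real n * (B + 1)"
        using B0 by (intro mult_left_mono; simp)+
      ultimately have small: "1 / real n \<le> e / 2" "1 / real n * B \<le> e / 2" by linarith+
      have "\<bar>l s - s\<bar> \<le> e \<and> \<bar>taper (real k) (?F n) s - taper (real k) (restrict f {0..}) (l s)\<bar> \<le> e"
        if s: "s \<in> {0..real k}" for s
      proof (cases "s = real k")
        case True
        then have "l s = real k" using tc by (simp add: time_change_between_def)
        then show ?thesis using True e by (simp add: taper_def)
      next
        case False
        then have sk: "s < real k" using s by simp
        note ls = time_change_between_range(1,2)[OF tc s]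
        define \<phi> where "\<phi> r = max 0 (min 1 (real k - r))" for r
        define x y where "x = grid_step n (\<lambda>k. f (real k / real n)) s" and "y = f (l s)"
        have "taper (real k) (?F n) s - taper (real k) (restrict f {0..}) (l s) = \<phi> s * (x - y) + (\<phi> s - \<phi> (l s)) * y"
          using s ls by (simp add: taper_def \<phi>_def x_def y_def algebra_simps)
        also have "\<bar>\<dots>\<bar> \<le> 1 * (e / 2) + 1 / real n * B"
        proof (rule order_trans[OF abs_triangle_ineq add_mono])
          have "\<bar>\<phi> s\<bar> \<le> 1" by (simp add: \<phi>_def)
          moreover have "\<bar>x - y\<bar> \<le> e / 2" unfolding x_def y_def by (rule l(2)[OF s sk])
          ultimately show "\<bar>\<phi> s * (x - y)\<bar> \<le> 1 * (e / 2)" unfolding abs_mult by (intro mult_mono) auto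
          have "\<bar>\<phi> s - \<phi> (l s)\<bar> \<le> \<bar>l s - s\<bar>" by (auto simp: \<phi>_def)
          moreover have "\<bar>y\<bar> \<le> B" using B ls by (simp add: y_def)
          ultimately show "\<bar>(\<phi> s - \<phi> (l s)) * y\<bar> \<le> 1 / real n * B"
            unfolding abs_mult using l(1)[OF s] by (intro mult_mono) auto
        qed
        finally show ?thesis using small l(1)[OF s] e by linarith
      qed
      then have "skorokhod_admissible (real k) (taper (real k) (?F n)) (taper (real k) (restrict f {0..})) e"
        unfolding skorokhod_admissible_def using e time_change_between_imp_time_change[OF tc k0] by blast
      then show ?case by (rule skorokhod_dist_upto_le)
    qed
  qed
  have "limitin J1_topology ?F (restrict f {0..}) sequentially"
    unfolding J1_topology_def limitin_metric
  proof (intro conjI fD allI impI)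
    fix e :: real assume e: "0 < e"
    obtain m where m: "(1/2::real) ^ m < e / 2" using half_power_less[of "e / 2"] e by auto
    have "\<forall>\<^sub>F n in sequentially. \<forall>k\<in>{1..m}. skorokhod_dist_upto (real k) (taper (real k) (?F n)) (taper (real k) (restrict f {0..})) \<le> e / 2"
      using ev[of "e / 2"] e by (intro eventually_ball_finite) auto
    then show "\<forall>\<^sub>F n in sequentially. ?F n \<in> skorokhod_space \<and> skorokhod_dist (?F n) (restrict f {0..}) < e"
      using eventually_gt_at_top[of 0]
    proof eventually_elim
      case (elim n)
      have "skorokhod_dist (?F n) (restrict f {0..}) \<le> e / 2 + (1/2) ^ m"
        using elim e FD fD by (intro skorokhod_dist_le) auto
      then show ?case using FD[OF elim(2)] m by simp
    qed
  qed
  then show ?thesis by (rule limitin_sequentially_offset[where k = 1, simplified])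
qed

section \<open>Borel measurability in the product space\<close>

lemma space_borel_of [simp]: "space (borel_of T) = topspace T"
  by (simp add: borel_of_def space_measure_of_conv)

lemma measurable_borel_ofI:
  assumes "\<And>\<omega>. \<omega> \<in> space M \<Longrightarrow> f \<omega> \<in> topspace T"
    and "\<And>U. openin T U \<Longrightarrow> f -` U \<inter> space M \<in> sets M"
  shows "f \<in> M \<rightarrow>\<^sub>M borel_of T"
  unfolding borel_of_def
  using assms by (intro measurable_measure_of) (auto dest: openin_subset)

lemma openin_in_borel_of: "openin T U \<Longrightarrow> U \<in> sets (borel_of T)"
  unfolding borel_of_def by (subst sets_measure_of) (auto dest: openin_subset)

lemma continuous_map_measurable:
  assumes "continuous_map S T f"
  shows "f \<in> borel_of S \<rightarrow>\<^sub>M borel_of T"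
proof (rule measurable_borel_ofI)
  show "f x \<in> topspace T" if "x \<in> space (borel_of S)" for x
    using that continuous_map_funspace[OF assms] by (auto simp: Pi_iff)
  fix U assume "openin T U"
  then have "openin S {x \<in> topspace S. f x \<in> U}" using assms by (simp add: continuous_map)
  moreover have "{x \<in> topspace S. f x \<in> U} = f -` U \<inter> space (borel_of S)" by auto
  ultimately show "f -` U \<inter> space (borel_of S) \<in> sets (borel_of S)"
    using openin_in_borel_of by metis
qed

lemma sets_borel_of_euclidean [measurable_cong]: "sets (borel_of euclidean) = sets borel"
  by (simp add: borel_of_def borel_def)

text \<open>
  With \<open>V m\<close> a union of balls of radius \<open>r m\<close> that stay inside \<open>U\<close> when their radius is doubled, the limit
  lies in \<open>U\<close> if and only if, for some \<open>m\<close>, the sequence is eventually in \<open>V m\<close>.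
\<close>
lemma measurable_limit_metrizable:
  assumes T: "metrizable_space T" and Y: "\<And>n::nat. Y n \<in> M \<rightarrow>\<^sub>M borel_of T"
    and lim: "\<And>\<omega>. \<omega> \<in> space M \<Longrightarrow> limitin T (\<lambda>n. Y n \<omega>) (Z \<omega>) sequentially"
  shows "Z \<in> M \<rightarrow>\<^sub>M borel_of T"
proof -
  obtain S d where ms: "Metric_space S d" and T: "T = Metric_space.mtopology S d"
    using T unfolding metrizable_space_def by blast
  interpret Metric_space S d by (rule ms)
  show ?thesis
  proof (rule measurable_borel_ofI)
    show "Z \<omega> \<in> topspace T" if "\<omega> \<in> space M" for \<omega>
      using lim[OF that] by (rule limitin_topspace)
    fix U assume U: "openin T U"
    define r where "r m = 1 / real (Suc m)" for m
    have r: "0 < r m" for m by (simp add: r_def)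
    define V where "V m = (\<Union>x\<in>{x \<in> S. mball x (2 * r m) \<subseteq> U}. mball x (r m))" for m
    have V: "openin T (V m)" for m unfolding V_def T by auto
    have iff: "Z \<omega> \<in> U \<longleftrightarrow> (\<exists>m N. \<forall>n\<ge>N. Y n \<omega> \<in> V m)" if \<omega>: "\<omega> \<in> space M" for \<omega>
    proof
      assume ZU: "Z \<omega> \<in> U"
      then obtain e where e: "0 < e" "mball (Z \<omega>) e \<subseteq> U"
        using U unfolding T openin_mtopology by blast
      have ZS: "Z \<omega> \<in> S" using ZU openin_subset[OF U] by (auto simp: T)
      obtain m where "2 / e < real m" using reals_Archimedean2 by blast
      then have "2 / e < real (Suc m)" by simp
      then have "2 * r m \<le> e" using e(1) by (simp add: r_def field_simps)
      then have "mball (Z \<omega>) (2 * r m) \<subseteq> U" using e(2) mball_subset_concentric by blast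
      then have "mball (Z \<omega>) (r m) \<subseteq> V m" unfolding V_def using ZS by blast
      moreover have "\<exists>N. \<forall>n\<ge>N. Y n \<omega> \<in> mball (Z \<omega>) (r m)"
        using lim[OF \<omega>] r[of m] unfolding T limitin_metric eventually_sequentially
        by (metis commute in_mball)
      ultimately show "\<exists>m N. \<forall>n\<ge>N. Y n \<omega> \<in> V m" by blast
    next
      assume "\<exists>m N. \<forall>n\<ge>N. Y n \<omega> \<in> V m"
      then obtain m N where N: "\<And>n. N \<le> n \<Longrightarrow> Y n \<omega> \<in> V m" by blast
      have ZS: "Z \<omega> \<in> S" using limitin_topspace[OF lim[OF \<omega>]] by (simp add: T)
      obtain N' where N': "\<And>n. N' \<le> n \<Longrightarrow> Y n \<omega> \<in> S \<and> d (Y n \<omega>) (Z \<omega>) < r m"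
        using lim[OF \<omega>] r[of m] unfolding T limitin_metric eventually_sequentially by blast
      let ?y = "Y (max N N') \<omega>"
      obtain x where x: "x \<in> S" "mball x (2 * r m) \<subseteq> U" "?y \<in> mball x (r m)"
        using N[of "max N N'"] unfolding V_def by auto
      have "d x (Z \<omega>) \<le> d x ?y + d ?y (Z \<omega>)" using x ZS by (intro triangle) auto
      also have "\<dots> < 2 * r m" using x(3) N'[of "max N N'"] by auto
      finally show "Z \<omega> \<in> U" using x ZS by auto
    qed
    have "Z -` U \<inter> space M = (\<Union>m. \<Union>N. \<Inter>n\<in>{N..}. Y n -` V m \<inter> space M)"
      using iff by (auto simp: set_eq_iff) blast+
    moreover have "Y n -` V m \<inter> space M \<in> sets M" for n m
      using measurable_sets[OF Y openin_in_borel_of[OF V]] .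
    then have "(\<Inter>n\<in>{N..}. Y n -` V m \<inter> space M) \<in> sets M" for m N
      by (intro sets.countable_INT') auto
    then have "(\<Union>N. \<Inter>n\<in>{N..}. Y n -` V m \<inter> space M) \<in> sets M" for m
      by (intro sets.countable_UN) blast
    then have "(\<Union>m. \<Union>N. \<Inter>n\<in>{N..}. Y n -` V m \<inter> space M) \<in> sets M"
      by (intro sets.countable_UN) blast
    ultimately show "Z -` U \<inter> space M \<in> sets M" by argo
  qed
qed

abbreviation J1_product :: "(nat \<Rightarrow> real \<Rightarrow> real) topology" where
  "J1_product \<equiv> product_topology (\<lambda>j. J1_topology) {1..}"

lemma topspace_J1 [simp]: "topspace J1_topology = skorokhod_space"
proof -
  interpret Metric_space skorokhod_space skorokhod_dist by (rule skorokhod_metric)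
  show ?thesis by (simp add: J1_topology_def)
qed

lemma metrizable_J1_product: "metrizable_space J1_product"
proof -
  have "metrizable_space J1_topology"
    unfolding J1_topology_def metrizable_space_def using skorokhod_metric by blast
  then show ?thesis unfolding metrizable_space_product_topology by simp
qed

lemma restrict_in_skorokhod: "cadlag f \<Longrightarrow> restrict f {0..} \<in> skorokhod_space"
  by (simp add: skorokhod_space_def cadlag_restrict)

text \<open>On \<open>[0, m]\<close> a step function depends on \<open>n m + 1\<close> coordinates.\<close>
lemma continuous_map_grid_step:
  assumes n: "0 < n"
  shows "continuous_map euclidean J1_product (\<lambda>v. \<lambda>j\<in>{1..}. restrict (grid_step n (v j)) {0..})"
  unfolding continuous_map_componentwise
proof (intro conjI ballI)
  show "(\<lambda>v. \<lambda>j\<in>{1..}. restrict (grid_step n (v j)) {0..}) ` topspace euclidean \<subseteq> extensional {1..}"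
    by auto
  interpret Metric_space skorokhod_space skorokhod_dist by (rule skorokhod_metric)
  fix j :: nat assume "j \<in> {1..}"
  have "continuous_map euclidean mtopology (\<lambda>v. restrict (grid_step n (v j)) {0..})"
    unfolding continuous_map_to_metric
  proof (intro ballI allI impI)
    fix v :: "nat \<Rightarrow> nat \<Rightarrow> real" and e :: real assume e: "0 < e"
    obtain m where m: "(1/2::real) ^ m < e / 2" using half_power_less[of "e / 2"] e by auto
    let ?U = "\<Inter>k\<in>{..n * m}. {w :: nat \<Rightarrow> nat \<Rightarrow> real. \<bar>w j k - v j k\<bar> < e / 2}"
    have proj: "continuous_on UNIV (\<lambda>w :: nat \<Rightarrow> nat \<Rightarrow> real. w j k)" for k
      by (rule continuous_on_compose2[OF continuous_on_product_coordinates[where i = k]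
            continuous_on_product_coordinates[where i = j]]) auto
    have "open {w :: nat \<Rightarrow> nat \<Rightarrow> real. \<bar>w j k - v j k\<bar> < e / 2}" for k
      by (intro open_Collect_less continuous_intros proj)
    then have U: "open ?U" by (intro open_INT) auto
    have "restrict (grid_step n (w j)) {0..} \<in> mball (restrict (grid_step n (v j)) {0..}) e" if w: "w \<in> ?U" for w
    proof -
      have D: "restrict (grid_step n (u j)) {0..} \<in> skorokhod_space" for u :: "nat \<Rightarrow> nat \<Rightarrow> real"
        by (intro restrict_in_skorokhod cadlag_grid_step n)
      have "skorokhod_dist (restrict (grid_step n (v j)) {0..}) (restrict (grid_step n (w j)) {0..}) \<le> e / 2 + (1/2) ^ m"
      proof (rule skorokhod_dist_le_uniform[OF D D])
        fix s assume s: "s \<in> {0..real m}"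
        have "real n * s \<le> real (n * m)" using s by (auto intro!: mult_left_mono)
        then have "\<lfloor>real n * s\<rfloor> \<le> int (n * m)" by linarith
        then have "nat \<lfloor>real n * s\<rfloor> \<in> {..n * m}" by (simp add: nat_le_iff)
        then have "\<bar>w j (nat \<lfloor>real n * s\<rfloor>) - v j (nat \<lfloor>real n * s\<rfloor>)\<bar> < e / 2" using w by blast
        then show "\<bar>restrict (grid_step n (v j)) {0..} s - restrict (grid_step n (w j)) {0..} s\<bar> \<le> e / 2"
          using s by (simp add: grid_step_def abs_minus_commute)
      qed (use e in simp)
      then show ?thesis using D m by simp
    qed
    then show "\<exists>U. openin euclidean U \<and> v \<in> U \<and>
        (\<forall>w\<in>U. restrict (grid_step n (w j)) {0..} \<in> mball (restrict (grid_step n (v j)) {0..}) e)"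
      using U e by (intro exI[of _ ?U]) auto
  qed
  then show "continuous_map euclidean J1_topology (\<lambda>v. (\<lambda>j\<in>{1..}. restrict (grid_step n (v j)) {0..}) j)"
    using \<open>j \<in> {1..}\<close> by (simp add: J1_topology_def)
qed

text \<open>
  Pointwise in \<open>\<omega>\<close> the path is a limit of grid step functions, which are continuous images of a measurable family
  of reals.
\<close>
lemma measurable_J1_product:
  assumes cad: "\<And>\<omega> j. \<omega> \<in> space M \<Longrightarrow> 1 \<le> j \<Longrightarrow> cadlag (Y \<omega> j)"
    and meas: "\<And>j u. 1 \<le> j \<Longrightarrow> 0 \<le> u \<Longrightarrow> (\<lambda>\<omega>. Y \<omega> j u) \<in> borel_measurable M"
  shows "(\<lambda>\<omega>. \<lambda>j\<in>{1..}. restrict (Y \<omega> j) {0..}) \<in> M \<rightarrow>\<^sub>M borel_of J1_product"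
proof -
  define v where "v n \<omega> j k = (if j = 0 then 0 else Y \<omega> j (real k / real (Suc n)))" for n \<omega> and j k :: nat
  define G where "G n = (\<lambda>v :: nat \<Rightarrow> nat \<Rightarrow> real. \<lambda>j\<in>{1..}. restrict (grid_step (Suc n) (v j)) {0..})" for n
  have vm: "v n \<in> borel_measurable M" for n
  proof (rule measurable_coordinatewise_then_product, rule measurable_coordinatewise_then_product)
    fix j k
    show "(\<lambda>\<omega>. v n \<omega> j k) \<in> borel_measurable M"
      using meas[of j "real k / real (Suc n)"] by (cases "j = 0") (simp_all add: v_def[abs_def])
  qed
  have G: "(\<lambda>\<omega>. G n (v n \<omega>)) \<in> M \<rightarrow>\<^sub>M borel_of J1_product" for n
  proof (rule measurable_compose[of "v n" M "borel_of euclidean" "G n"])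
    show "v n \<in> M \<rightarrow>\<^sub>M borel_of euclidean"
      using vm[of n] by (simp cong: measurable_cong_sets add: sets_borel_of_euclidean)
    show "G n \<in> borel_of euclidean \<rightarrow>\<^sub>M borel_of J1_product"
      unfolding G_def by (rule continuous_map_measurable[OF continuous_map_grid_step]) simp
  qed
  have "limitin J1_product (\<lambda>n. G n (v n \<omega>)) (\<lambda>j\<in>{1..}. restrict (Y \<omega> j) {0..}) sequentially"
    if \<omega>: "\<omega> \<in> space M" for \<omega>
    unfolding limitin_componentwise
  proof (intro conjI ballI always_eventually allI)
    show "G n (v n \<omega>) \<in> topspace J1_product" for n
      unfolding G_def by (auto intro!: restrict_in_skorokhod cadlag_grid_step)
    fix j :: nat assume j: "j \<in> {1..}"
    have "v n \<omega> j = (\<lambda>k. Y \<omega> j (real k / real (Suc n)))" for n using j by (auto simp: v_def)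
    then show "limitin J1_topology (\<lambda>n. G n (v n \<omega>) j) ((\<lambda>j\<in>{1..}. restrict (Y \<omega> j) {0..}) j) sequentially"
      using grid_step_tendsto_skorokhod[OF cad[OF \<omega>, of j]] j by (simp add: G_def)
  qed simp
  then show ?thesis by (rule measurable_limit_metrizable[OF metrizable_J1_product G])
qed

section \<open>An extended continuous mapping theorem\<close>

text \<open>
  The setting: \<open>\<rho> t p\<close> is the normalisation of the path \<open>p\<close> at time \<open>t\<close>, the laws of \<open>\<rho> t X\<close> converge to that of
  \<open>Z\<close>, and \<open>Z\<close> takes its values in \<open>C\<close>.
\<close>
context
  fixes S C :: "'s set" and d :: "'s \<Rightarrow> 's \<Rightarrow> real" and P :: "'p set" and \<rho> :: "real \<Rightarrow> 'p \<Rightarrow> 's"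
    and M :: "'w measure" and X :: "'w \<Rightarrow> 'p" and N :: "'v measure" and Z :: "'v \<Rightarrow> 's"
  assumes S: "Metric_space S d" and M: "prob_space M" and N: "prob_space N"
    and X: "\<And>\<omega>. \<omega> \<in> space M \<Longrightarrow> X \<omega> \<in> P"
    and \<rho>: "\<And>t p. 0 < t \<Longrightarrow> p \<in> P \<Longrightarrow> \<rho> t p \<in> S"
    and C: "C \<subseteq> S" "AE \<omega> in N. Z \<omega> \<in> C"
    and meas: "\<And>f. continuous_map (Metric_space.mtopology S d) euclideanreal f \<Longrightarrow>
        (\<forall>\<^sub>F t in at_top. (\<lambda>\<omega>. f (\<rho> t (X \<omega>))) \<in> borel_measurable M) \<and> (\<lambda>\<omega>. f (Z \<omega>)) \<in> borel_measurable N"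
    and conv: "\<And>f. continuous_map (Metric_space.mtopology S d) euclideanreal f \<Longrightarrow> bounded (f ` S) \<Longrightarrow>
        ((\<lambda>t. \<integral>\<omega>. f (\<rho> t (X \<omega>)) \<partial>M) \<longlongrightarrow> (\<integral>\<omega>. f (Z \<omega>) \<partial>N)) at_top"
begin

text \<open>
  The envelope \<open>H m x\<close>, the supremum of \<open>K t p - (m + 1) d(x, \<rho> t p)\<close> (truncated
  below at \<open>- B\<close>) over \<open>t \<ge> m + 1\<close> and all \<open>p\<close>, is Lipschitz in
  \<open>x\<close> and dominates \<open>K t p\<close> at \<open>x = \<rho> t p\<close>.  Weak convergence applies to it and bounds the upper limit by the
  integral of \<open>H m Z\<close>.  As \<open>m\<close> grows, only points \<open>\<rho> t p\<close> close to \<open>x\<close> with large \<open>t\<close> contribute, so the upper limit of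
  \<open>H m x\<close> is at most \<open>h x\<close>.
\<close>
lemma extended_mapping_upper:
  fixes K :: "real \<Rightarrow> 'p \<Rightarrow> real"
  assumes K: "\<forall>\<^sub>F t in at_top. (\<lambda>\<omega>. K t (X \<omega>)) \<in> borel_measurable M" "\<And>t p. 0 < t \<Longrightarrow> p \<in> P \<Longrightarrow> \<bar>K t p\<bar> \<le> B"
    and h: "(\<lambda>\<omega>. h (Z \<omega>)) \<in> borel_measurable N" "\<And>x. x \<in> C \<Longrightarrow> \<bar>h x\<bar> \<le> B"
    and cont: "\<And>x e. x \<in> C \<Longrightarrow> 0 < e \<Longrightarrow> \<exists>\<delta>>0. \<exists>T. \<forall>t\<ge>T. \<forall>p\<in>P. d x (\<rho> t p) < \<delta> \<longrightarrow> K t p \<le> h x + e"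
    and e: "0 < e"
  shows "\<forall>\<^sub>F t in at_top. (\<integral>\<omega>. K t (X \<omega>) \<partial>M) \<le> (\<integral>\<omega>. h (Z \<omega>) \<partial>N) + e"
proof -
  interpret Metric_space S d by (rule S)
  interpret M: prob_space M by (rule M)
  interpret N: prob_space N by (rule N)
  obtain p0 where p0: "p0 \<in> P" using X M.not_empty by blast
  have B0: "0 \<le> B" using K(2)[of 1 p0] p0 by simp
  define G where "G m x q = max (- B) (K (fst q) (snd q) - real (Suc m) * d x (\<rho> (fst q) (snd q)))"
    for m :: nat and x and q :: "real \<times> 'p"
  define Q where "Q m = {real (Suc m)..} \<times> P" for m
  define H where "H m x = (SUP q\<in>Q m. G m x q)" for m x
  have Q: "0 < fst q" "snd q \<in> P" "real (Suc m) \<le> fst q" if "q \<in> Q m" for q m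
    using that by (auto simp: Q_def)
  have Qne: "Q m \<noteq> {}" for m using p0 by (auto simp: Q_def)
  have G: "- B \<le> G m x q" "G m x q \<le> B" if "q \<in> Q m" for m x q
  proof -
    have "K (fst q) (snd q) \<le> B" using K(2)[OF Q(1,2)[OF that]] by linarith
    moreover have "0 \<le> real (Suc m) * d x (\<rho> (fst q) (snd q))" by simp
    ultimately have "K (fst q) (snd q) - real (Suc m) * d x (\<rho> (fst q) (snd q)) \<le> B" by linarith
    then show "- B \<le> G m x q" "G m x q \<le> B" using B0 by (auto simp: G_def)
  qed
  have bdd: "bdd_above (G m x ` Q m)" for m x
    using G(2) by (auto intro!: bdd_aboveI)
  have GH: "G m x q \<le> H m x" if "q \<in> Q m" for m x q
    unfolding H_def by (rule cSUP_upper[OF that bdd])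
  have HB: "\<bar>H m x\<bar> \<le> B" for m x
  proof -
    obtain q where q: "q \<in> Q m" using Qne by blast
    have "- B \<le> H m x" using G(1)[OF q] GH[OF q] by (rule order_trans)
    moreover have "H m x \<le> B" unfolding H_def using G(2) by (intro cSUP_least Qne) auto
    ultimately show ?thesis by linarith
  qed
  have lip: "H m x \<le> H m y + real (Suc m) * d x y" if xy: "x \<in> S" "y \<in> S" for m x y
    unfolding H_def[of m x]
  proof (rule cSUP_least[OF Qne])
    fix q assume q: "q \<in> Q m"
    have "d y (\<rho> (fst q) (snd q)) \<le> d x (\<rho> (fst q) (snd q)) + d x y"
      using triangle[OF xy(2,1) \<rho>[OF Q(1,2)[OF q]]] commute[of x y] by linarith
    then have "real (Suc m) * d y (\<rho> (fst q) (snd q)) \<le> real (Suc m) * (d x (\<rho> (fst q) (snd q)) + d x y)"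
      by (intro mult_left_mono) auto
    moreover have "0 \<le> real (Suc m) * d x y" by simp
    ultimately have "G m x q \<le> G m y q + real (Suc m) * d x y"
      unfolding G_def distrib_left by linarith
    then show "G m x q \<le> H m y + real (Suc m) * d x y" using GH[OF q, of y] by linarith
  qed
  have Hc: "continuous_map mtopology euclideanreal (H m)" for m
    unfolding continuous_map_from_metric
  proof (intro conjI ballI allI impI)
    fix x U assume x: "x \<in> S" and U: "openin euclideanreal U \<and> H m x \<in> U"
    then obtain r where r: "0 < r" "\<And>y. dist y (H m x) < r \<Longrightarrow> y \<in> U"
      unfolding open_openin[symmetric] open_dist by blast
    have "H m y \<in> U" if y: "y \<in> S" "d x y < r / real (Suc m)" for y
    proof (rule r(2))
      have "real (Suc m) * d x y < r" using y by (simp add: field_simps del: of_nat_Suc)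
      then show "dist (H m y) (H m x) < r"
        using lip[OF x y(1), of m] lip[OF y(1) x, of m] commute[of x y] by (simp add: dist_real_def)
    qed
    then show "\<exists>r>0. \<forall>y. y \<in> S \<and> d x y < r \<longrightarrow> H m y \<in> U"
      using r(1) by (intro exI[of _ "r / real (Suc m)"]) auto
  qed auto
  have HZ: "\<forall>\<^sub>F m in sequentially. H m x \<le> h x + \<epsilon>" if x: "x \<in> C" and \<epsilon>: "0 < \<epsilon>" for x \<epsilon>
  proof -
    obtain \<delta> T where \<delta>: "0 < \<delta>" "\<And>t p. T \<le> t \<Longrightarrow> p \<in> P \<Longrightarrow> d x (\<rho> t p) < \<delta> \<Longrightarrow> K t p \<le> h x + \<epsilon>"
      using cont[OF x \<epsilon>] by blast
    have hB: "- B \<le> h x" using h(2)[OF x] by linarith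
    obtain m0 where m0: "max T (2 * B / \<delta>) < real m0" using reals_Archimedean2 by blast
    show ?thesis
    proof (rule eventually_sequentiallyI[of m0])
      fix m assume "m0 \<le> m"
      then have m: "T \<le> real (Suc m)" "2 * B / \<delta> \<le> real (Suc m)" using m0 by auto
      show "H m x \<le> h x + \<epsilon>" unfolding H_def
      proof (rule cSUP_least[OF Qne])
        fix q assume q: "q \<in> Q m"
        have Kq: "K (fst q) (snd q) - real (Suc m) * d x (\<rho> (fst q) (snd q)) \<le> h x + \<epsilon>"
        proof (cases "d x (\<rho> (fst q) (snd q)) < \<delta>")
          case True
          have "0 \<le> real (Suc m) * d x (\<rho> (fst q) (snd q))" by simp
          moreover have "K (fst q) (snd q) \<le> h x + \<epsilon>" using \<delta>(2)[of "fst q" "snd q"] Q[OF q] m True by linarith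
          ultimately show ?thesis by linarith
        next
          case False
          have "2 * B \<le> real (Suc m) * \<delta>" using m(2) \<delta>(1) by (simp add: field_simps)
          also have "\<dots> \<le> real (Suc m) * d x (\<rho> (fst q) (snd q))" using False by (intro mult_left_mono) auto
          finally show ?thesis using K(2)[OF Q(1,2)[OF q]] hB \<epsilon> by linarith
        qed
        then show "G m x q \<le> h x + \<epsilon>" unfolding G_def using hB \<epsilon> by simp
      qed
    qed
  qed
  have Hm: "(\<lambda>\<omega>. H m (Z \<omega>)) \<in> borel_measurable N" for m using meas[OF Hc] by blast
  have "(\<lambda>m. \<integral>\<omega>. max (H m (Z \<omega>)) (h (Z \<omega>)) \<partial>N) \<longlonglongrightarrow> (\<integral>\<omega>. h (Z \<omega>) \<partial>N)"
  proof (rule integral_dominated_convergence[where w = "\<lambda>_. B"])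
    show "AE \<omega> in N. (\<lambda>m. max (H m (Z \<omega>)) (h (Z \<omega>))) \<longlonglongrightarrow> h (Z \<omega>)"
      using C(2)
    proof eventually_elim
      case (elim \<omega>)
      show ?case
      proof (rule tendstoI)
        fix \<epsilon> :: real assume \<epsilon>: "0 < \<epsilon>"
        have "\<forall>\<^sub>F m in sequentially. H m (Z \<omega>) \<le> h (Z \<omega>) + \<epsilon> / 2" using HZ[OF elim, of "\<epsilon> / 2"] \<epsilon> by simp
        then show "\<forall>\<^sub>F m in sequentially. dist (max (H m (Z \<omega>)) (h (Z \<omega>))) (h (Z \<omega>)) < \<epsilon>"
          by eventually_elim (use \<epsilon> in \<open>auto simp: dist_real_def max_def\<close>)
      qed
    qed
    show "AE \<omega> in N. norm (max (H m (Z \<omega>)) (h (Z \<omega>))) \<le> B" for m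
      using C(2)
    proof eventually_elim
      case (elim \<omega>)
      show ?case using h(2)[OF elim] HB[of m "Z \<omega>"] by (simp add: max_def)
    qed
  qed (use Hm h(1) in auto)
  then have "\<forall>\<^sub>F m in sequentially. (\<integral>\<omega>. max (H m (Z \<omega>)) (h (Z \<omega>)) \<partial>N) < (\<integral>\<omega>. h (Z \<omega>) \<partial>N) + e / 2"
    using e by (intro order_tendstoD(2)) auto
  then obtain m where m: "(\<integral>\<omega>. max (H m (Z \<omega>)) (h (Z \<omega>)) \<partial>N) < (\<integral>\<omega>. h (Z \<omega>) \<partial>N) + e / 2"
    by (meson eventually_happens sequentially_bot)
  have iN: "integrable N f" if "f \<in> borel_measurable N" "AE \<omega> in N. \<bar>f \<omega>\<bar> \<le> B" for f :: "_ \<Rightarrow> real"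
    using that by (intro N.integrable_const_bound[where B = B]) auto
  have hZB: "AE \<omega> in N. \<bar>h (Z \<omega>)\<bar> \<le> B" using C(2) by eventually_elim (rule h(2))
  have "(\<integral>\<omega>. H m (Z \<omega>) \<partial>N) \<le> (\<integral>\<omega>. max (H m (Z \<omega>)) (h (Z \<omega>)) \<partial>N)"
    using HB Hm h(1) hZB by (intro Bochner_Integration.integral_mono Bochner_Integration.integrable_max iN) auto
  with m have mZ: "(\<integral>\<omega>. H m (Z \<omega>) \<partial>N) < (\<integral>\<omega>. h (Z \<omega>) \<partial>N) + e / 2" by linarith
  have "((\<lambda>t. \<integral>\<omega>. H m (\<rho> t (X \<omega>)) \<partial>M) \<longlongrightarrow> (\<integral>\<omega>. H m (Z \<omega>) \<partial>N)) at_top"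
    using HB by (intro conv Hc) (auto intro!: boundedI)
  then have "\<forall>\<^sub>F t in at_top. (\<integral>\<omega>. H m (\<rho> t (X \<omega>)) \<partial>M) < (\<integral>\<omega>. h (Z \<omega>) \<partial>N) + e"
    using mZ e by (intro order_tendstoD(2)) auto
  moreover have "\<forall>\<^sub>F t in at_top. (\<lambda>\<omega>. H m (\<rho> t (X \<omega>))) \<in> borel_measurable M" using meas[OF Hc] by blast
  ultimately show ?thesis using K(1) eventually_ge_at_top[of "real (Suc m)"]
  proof eventually_elim
    case (elim t)
    have t0: "0 < t" using elim(4) by linarith
    have "(\<integral>\<omega>. K t (X \<omega>) \<partial>M) \<le> (\<integral>\<omega>. H m (\<rho> t (X \<omega>)) \<partial>M)"
    proof (rule Bochner_Integration.integral_mono)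
      show "integrable M (\<lambda>\<omega>. K t (X \<omega>))"
        using elim(3) K(2)[OF t0 X] by (intro M.integrable_const_bound[where B = B] AE_I2) auto
      show "integrable M (\<lambda>\<omega>. H m (\<rho> t (X \<omega>)))"
        using elim(2) HB by (intro M.integrable_const_bound[where B = B] AE_I2) auto
      fix \<omega> assume \<omega>: "\<omega> \<in> space M"
      have q: "(t, X \<omega>) \<in> Q m" using X[OF \<omega>] elim(4) by (simp add: Q_def)
      have "K t (X \<omega>) \<le> G m (\<rho> t (X \<omega>)) (t, X \<omega>)"
        using mdist_zero[OF \<rho>[OF t0 X[OF \<omega>]]] by (simp add: G_def)
      also have "\<dots> \<le> H m (\<rho> t (X \<omega>))" by (rule GH[OF q])
      finally show "K t (X \<omega>) \<le> H m (\<rho> t (X \<omega>))" .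
    qed
    then show ?case using elim(1) by linarith
  qed
qed

text \<open>The extended continuous mapping theorem, from the one-sided version for \<open>K\<close> and \<open>- K\<close>.\<close>
lemma extended_mapping:
  fixes K :: "real \<Rightarrow> 'p \<Rightarrow> real"
  assumes K: "\<forall>\<^sub>F t in at_top. (\<lambda>\<omega>. K t (X \<omega>)) \<in> borel_measurable M" "\<And>t p. 0 < t \<Longrightarrow> p \<in> P \<Longrightarrow> \<bar>K t p\<bar> \<le> B"
    and h: "(\<lambda>\<omega>. h (Z \<omega>)) \<in> borel_measurable N" "\<And>x. x \<in> C \<Longrightarrow> \<bar>h x\<bar> \<le> B"
    and cont: "\<And>x e. x \<in> C \<Longrightarrow> 0 < e \<Longrightarrow> \<exists>\<delta>>0. \<exists>T. \<forall>t\<ge>T. \<forall>p\<in>P. d x (\<rho> t p) < \<delta> \<longrightarrow> \<bar>K t p - h x\<bar> \<le> e"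
  shows "((\<lambda>t. \<integral>\<omega>. K t (X \<omega>) \<partial>M) \<longlongrightarrow> (\<integral>\<omega>. h (Z \<omega>) \<partial>N)) at_top"
proof (rule tendstoI)
  fix e :: real assume "0 < e"
  then have e: "0 < e / 2" by simp
  have le: "\<exists>\<delta>>0. \<exists>T. \<forall>t\<ge>T. \<forall>p\<in>P. d x (\<rho> t p) < \<delta> \<longrightarrow> K t p \<le> h x + \<epsilon>"
    and ge: "\<exists>\<delta>>0. \<exists>T. \<forall>t\<ge>T. \<forall>p\<in>P. d x (\<rho> t p) < \<delta> \<longrightarrow> - K t p \<le> - h x + \<epsilon>"
    if "x \<in> C" "0 < \<epsilon>" for x \<epsilon>
  proof -
    obtain \<delta> T where *: "0 < \<delta>" "\<forall>t\<ge>T. \<forall>p\<in>P. d x (\<rho> t p) < \<delta> \<longrightarrow> \<bar>K t p - h x\<bar> \<le> \<epsilon>"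
      using cont[OF \<open>x \<in> C\<close> \<open>0 < \<epsilon>\<close>] by blast
    show "\<exists>\<delta>>0. \<exists>T. \<forall>t\<ge>T. \<forall>p\<in>P. d x (\<rho> t p) < \<delta> \<longrightarrow> K t p \<le> h x + \<epsilon>"
      "\<exists>\<delta>>0. \<exists>T. \<forall>t\<ge>T. \<forall>p\<in>P. d x (\<rho> t p) < \<delta> \<longrightarrow> - K t p \<le> - h x + \<epsilon>"
      using * by (intro exI[of _ \<delta>] conjI exI[of _ T]; force)+
  qed
  have mK: "\<forall>\<^sub>F t in at_top. (\<lambda>\<omega>. - K t (X \<omega>)) \<in> borel_measurable M"
    using K(1) by eventually_elim simp
  have "\<forall>\<^sub>F t in at_top. (\<integral>\<omega>. K t (X \<omega>) \<partial>M) \<le> (\<integral>\<omega>. h (Z \<omega>) \<partial>N) + e / 2"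
    by (rule extended_mapping_upper[where K = K and h = h, OF K h le e])
  moreover have "\<forall>\<^sub>F t in at_top. (\<integral>\<omega>. - K t (X \<omega>) \<partial>M) \<le> (\<integral>\<omega>. - h (Z \<omega>) \<partial>N) + e / 2"
    by (rule extended_mapping_upper[where K = "\<lambda>t p. - K t p" and h = "\<lambda>x. - h x", OF mK _ _ _ ge e])
       (use K(2) h in auto)
  ultimately show "\<forall>\<^sub>F t in at_top. dist (\<integral>\<omega>. K t (X \<omega>) \<partial>M) (\<integral>\<omega>. h (Z \<omega>) \<partial>N) < e"
  proof eventually_elim
    case (elim t)
    then show ?case using \<open>0 < e\<close> unfolding dist_real_def Bochner_Integration.integral_minus by linarith
  qed
qed

end

section \<open>Random elements and exceptional null sets\<close>

lemma measurable_ls_convolution: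
  assumes F: "\<And>\<omega>. \<omega> \<in> space M \<Longrightarrow> cadlag (F \<omega>)" and G: "\<And>\<omega>. \<omega> \<in> space M \<Longrightarrow> mono_rc (G \<omega>)"
    and mF: "\<And>s. 0 \<le> s \<Longrightarrow> (\<lambda>\<omega>. F \<omega> s) \<in> borel_measurable M"
    and mG: "\<And>s. 0 \<le> s \<Longrightarrow> (\<lambda>\<omega>. G \<omega> s) \<in> borel_measurable M" and u: "0 \<le> u"
  shows "(\<lambda>\<omega>. ls_convolution (F \<omega>) (G \<omega>) u) \<in> borel_measurable M"
proof (rule borel_measurable_LIMSEQ_real)
  show "(\<lambda>n. riemann_sum (F \<omega>) (G \<omega>) (Suc n) u) \<longlonglongrightarrow> ls_convolution (F \<omega>) (G \<omega>) u"
    if "\<omega> \<in> space M" for \<omega>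
    by (rule riemann_sum_tendsto[OF F[OF that] G[OF that] u])
  fix n
  have "(\<lambda>\<omega>. F \<omega> (u - real k * u / real (Suc n)) *
      (G \<omega> (real (Suc k) * u / real (Suc n)) - G \<omega> (real k * u / real (Suc n)))) \<in> borel_measurable M"
    if "k \<in> {..<Suc n}" for k
  proof -
    have "k \<le> Suc n" using that by simp
    then have "0 \<le> u - real k * u / real (Suc n)" using grid_diff_in[OF u, of k "Suc n"] unfolding atLeastAtMost_iff by blast
    moreover have "0 \<le> real (Suc k) * u / real (Suc n)" "0 \<le> real k * u / real (Suc n)"
      using u by (intro divide_nonneg_nonneg mult_nonneg_nonneg; simp)+
    ultimately show ?thesis by (intro borel_measurable_times borel_measurable_diff mF mG)
  qed
  then have "(\<lambda>\<omega>. \<Sum>k<Suc n. F \<omega> (u - real k * u / real (Suc n)) *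
      (G \<omega> (real (Suc k) * u / real (Suc n)) - G \<omega> (real k * u / real (Suc n)))) \<in> borel_measurable M"
    by (rule borel_measurable_sum)
  moreover have "(\<lambda>\<omega>. F \<omega> u * G \<omega> 0) \<in> borel_measurable M"
    by (intro borel_measurable_times mF mG u order_refl)
  ultimately show "(\<lambda>\<omega>. riemann_sum (F \<omega>) (G \<omega>) (Suc n) u) \<in> borel_measurable M"
    unfolding riemann_sum_def by (rule borel_measurable_add[rotated])
qed

lemma measurable_conv_power:
  assumes X: "\<And>\<omega>. \<omega> \<in> space M \<Longrightarrow> mono_rc (X \<omega>)"
    and mX: "\<And>s. 0 \<le> s \<Longrightarrow> (\<lambda>\<omega>. X \<omega> s) \<in> borel_measurable M"
  shows "0 \<le> u \<Longrightarrow> (\<lambda>\<omega>. conv_power (X \<omega>) j u) \<in> borel_measurable M"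
proof (induction j arbitrary: u)
  case (Suc j)
  have "(\<lambda>\<omega>. ls_convolution (conv_power (X \<omega>) j) (X \<omega>) u) \<in> borel_measurable M"
    by (intro measurable_ls_convolution cadlag_conv_power X mX Suc)
  then show ?case
    by (rule measurable_cong[THEN iffD1, rotated]) (use conv_power_Suc[OF X] Suc.prems in simp)
qed simp

text \<open>Preimages under \<open>f\<close> and \<open>g\<close> differ by subsets of a null set, which are measurable in the completion.\<close>
lemma measurable_completion_AE_cong:
  assumes g: "g \<in> borel_measurable M" and ae: "AE \<omega> in M. f \<omega> = (g \<omega> :: real)"
  shows "f \<in> borel_measurable (completion M)"
proof -
  obtain E where E: "\<And>\<omega>. \<omega> \<in> space M - E \<Longrightarrow> f \<omega> = g \<omega>" "E \<in> null_sets M" using AE_E3[OF ae] by blast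
  have Es: "E \<in> sets M" using E(2) by auto
  show ?thesis
  proof (rule measurableI)
    fix A :: "real set" assume A: "A \<in> sets borel"
    have "f -` A \<inter> space M = (g -` A \<inter> space M - E) \<union> (f -` A \<inter> space M \<inter> E)"
      using E(1) by auto
    moreover have "g -` A \<inter> space M - E \<in> sets (completion M)"
      using measurable_sets[OF g A] Es by (intro sets_completionI_sets) auto
    moreover have "f -` A \<inter> space M \<inter> E \<in> sets (completion M)"
    proof (rule completion.complete)
      show "E \<in> null_sets (completion M)" using E(2) by (simp add: null_sets_completionI)
    qed auto
    ultimately show "f -` A \<inter> space (completion M) \<in> sets (completion M)"
      unfolding space_completion by (metis sets.Un)
  qed simp
qed

lemma measurable_imp_random_element: "Y \<in> M \<rightarrow>\<^sub>M borel_of T \<Longrightarrow> random_element M T Y"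
  unfolding random_element_def by (rule bexI[of _ Y]) auto

lemma random_element_cong_AE:
  assumes "random_element M T Y" "AE \<omega> in M. Z \<omega> = Y \<omega>"
  shows "random_element M T Z"
proof -
  obtain Y' where Y': "Y' \<in> M \<rightarrow>\<^sub>M borel_of T" "AE \<omega> in M. Y \<omega> = Y' \<omega>"
    using assms(1) unfolding random_element_def by blast
  have "AE \<omega> in M. Z \<omega> = Y' \<omega>" using assms(2) Y'(2) by eventually_elim simp
  then show ?thesis using Y'(1) unfolding random_element_def by blast
qed

lemma random_element_measurable:
  assumes Y: "random_element M T Y" and f: "continuous_map T euclideanreal f"
  shows "(\<lambda>\<omega>. f (Y \<omega>)) \<in> borel_measurable (completion M)"
proof -
  obtain Y' where Y': "Y' \<in> M \<rightarrow>\<^sub>M borel_of T" "AE \<omega> in M. Y \<omega> = Y' \<omega>"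
    using Y unfolding random_element_def by blast
  have "(\<lambda>\<omega>. f (Y' \<omega>)) \<in> M \<rightarrow>\<^sub>M borel_of euclideanreal"
    using Y'(1) continuous_map_measurable[OF f] by (rule measurable_compose)
  then have "(\<lambda>\<omega>. f (Y' \<omega>)) \<in> borel_measurable M"
    by (simp cong: measurable_cong_sets add: sets_borel_of_euclidean)
  moreover have "AE \<omega> in M. f (Y \<omega>) = f (Y' \<omega>)" using Y'(2) by eventually_elim simp
  ultimately show ?thesis by (rule measurable_completion_AE_cong)
qed

lemma random_element_integral_cong:
  assumes Y: "random_element M T Y" and Z: "AE \<omega> in M. Z \<omega> = Y \<omega>" and f: "continuous_map T euclideanreal f"
  shows "(\<integral>\<omega>. f (Z \<omega>) \<partial>completion M) = (\<integral>\<omega>. f (Y \<omega>) \<partial>completion M)"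
proof (rule integral_cong_AE)
  show "AE \<omega> in completion M. f (Z \<omega>) = f (Y \<omega>)"
    using AE_completion[OF Z] by eventually_elim simp
qed (intro random_element_measurable[OF _ f] Y random_element_cong_AE[OF Y Z])+

text \<open>The Hoelder bounds for the countably many horizons \<open>n + 1\<close> hold simultaneously outside one null set.\<close>
lemma locally_hoelder_imp_continuous:
  assumes "locally_hoelder N W"
  shows "AE \<omega> in N. continuous_on {0..} (\<lambda>u. W u \<omega>)"
proof -
  obtain \<gamma> where \<gamma>: "0 < \<gamma>" and V: "\<And>T. 0 < T \<Longrightarrow> \<exists>V. AE \<omega> in N. \<forall>x\<in>{0..T}. \<forall>y\<in>{0..T}.
             \<bar>W x \<omega> - W y \<omega>\<bar> \<le> V \<omega> * \<bar>x - y\<bar> powr \<gamma>"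
    using assms unfolding locally_hoelder_def by blast
  have "\<forall>n. \<exists>V. AE \<omega> in N. \<forall>x\<in>{0..real (Suc n)}. \<forall>y\<in>{0..real (Suc n)}. \<bar>W x \<omega> - W y \<omega>\<bar> \<le> V \<omega> * \<bar>x - y\<bar> powr \<gamma>"
    by (intro allI V) simp
  from choice[OF this] obtain V where "\<forall>n. AE \<omega> in N. \<forall>x\<in>{0..real (Suc n)}. \<forall>y\<in>{0..real (Suc n)}.
      \<bar>W x \<omega> - W y \<omega>\<bar> \<le> V n \<omega> * \<bar>x - y\<bar> powr \<gamma>"
    by (rule exE)
  then have "AE \<omega> in N. \<forall>n. \<forall>x\<in>{0..real (Suc n)}. \<forall>y\<in>{0..real (Suc n)}.
      \<bar>W x \<omega> - W y \<omega>\<bar> \<le> V n \<omega> * \<bar>x - y\<bar> powr \<gamma>"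
    unfolding AE_all_countable .
  then show ?thesis
  proof eventually_elim
    case (elim \<omega>)
    show ?case
    proof (rule continuous_on_half_line)
      fix U :: real
      obtain n where "U < real n" using reals_Archimedean2 by blast
      then have n: "U \<le> real (Suc n)" by simp
      show "continuous_on {0..U} (\<lambda>u. W u \<omega>)"
        unfolding continuous_on_def
      proof
        fix x assume x: "x \<in> {0..U}"
        have "((\<lambda>y. \<bar>y - x\<bar>) \<longlongrightarrow> \<bar>x - x\<bar>) (at x within {0..U})" by (intro tendsto_intros)
        have ev: "\<forall>\<^sub>F y in at x within {0..U}. 0 \<le> \<bar>y - x\<bar>" by simp
        from \<open>((\<lambda>y. \<bar>y - x\<bar>) \<longlongrightarrow> _) _\<close>
        have "((\<lambda>y. \<bar>y - x\<bar> powr \<gamma>) \<longlongrightarrow> \<bar>x - x\<bar> powr \<gamma>) (at x within {0..U})"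
          by (rule tendsto_powr'[OF _ tendsto_const disjI2[OF conjI[OF \<gamma> ev]]])
        then have "((\<lambda>y. V n \<omega> * \<bar>y - x\<bar> powr \<gamma>) \<longlongrightarrow> V n \<omega> * \<bar>x - x\<bar> powr \<gamma>) (at x within {0..U})"
          by (rule tendsto_mult_left)
        then have "((\<lambda>y. V n \<omega> * \<bar>y - x\<bar> powr \<gamma>) \<longlongrightarrow> 0) (at x within {0..U})" by simp
        moreover have "\<forall>\<^sub>F y in at x within {0..U}. norm (W y \<omega> - W x \<omega>) \<le> V n \<omega> * \<bar>y - x\<bar> powr \<gamma>"
          unfolding eventually_at_filter
        proof (intro always_eventually allI impI)
          fix y assume "y \<in> {0..U}"
          then have "y \<in> {0..real (Suc n)}" "x \<in> {0..real (Suc n)}" using x n by auto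
          then show "norm (W y \<omega> - W x \<omega>) \<le> V n \<omega> * \<bar>y - x\<bar> powr \<gamma>"
            unfolding real_norm_def using spec[OF elim, of n] by blast
        qed
        ultimately have "((\<lambda>y. W y \<omega> - W x \<omega>) \<longlongrightarrow> 0) (at x within {0..U})"
          by (rule Lim_null_comparison[rotated])
        then show "((\<lambda>y. W y \<omega>) \<longlongrightarrow> W x \<omega>) (at x within {0..U})"
          by (rule LIM_zero_cancel)
      qed
    qed
  qed
qed

section \<open>Weak convergence of the convolution powers\<close>

definition scaled_path :: "(real \<Rightarrow> real) \<Rightarrow> (real \<Rightarrow> real) \<Rightarrow> real \<Rightarrow> (real \<Rightarrow> real) \<Rightarrow> real \<Rightarrow> real" where
  "scaled_path a b t p = (\<lambda>u\<in>{0..}. (p (u * t) - b (u * t)) / a t)"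

definition scaled_powers :: "(real \<Rightarrow> real) \<Rightarrow> (real \<Rightarrow> real) \<Rightarrow> real \<Rightarrow> (real \<Rightarrow> real) \<Rightarrow> nat \<Rightarrow> real \<Rightarrow> real" where
  "scaled_powers a b t p = (\<lambda>j\<in>{1..}. \<lambda>u\<in>{0..}. (conv_power p j (u * t) - conv_power b j (u * t)) /
                (a t * conv_power b (j - 1) t))"

definition limit_paths :: "real \<Rightarrow> (real \<Rightarrow> real) \<Rightarrow> nat \<Rightarrow> real \<Rightarrow> real" where
  "limit_paths \<alpha> x = (\<lambda>j\<in>{1..}. \<lambda>u\<in>{0..}. limit_path \<alpha> x j u)"

lemma cadlag_quotient:
  "cadlag f \<Longrightarrow> cadlag g \<Longrightarrow> 0 < t \<Longrightarrow> cadlag (\<lambda>u. (f (u * t) - g (u * t)) / c)"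
  using cadlag_cmult[OF cadlag_scale[OF cadlag_minus], of f g t "1 / c"] by simp

lemma scaled_path_in_space:
  "mono_rc p \<Longrightarrow> mono_rc b \<Longrightarrow> 0 < t \<Longrightarrow> scaled_path a b t p \<in> skorokhod_space"
  unfolding scaled_path_def by (intro restrict_in_skorokhod cadlag_quotient mono_rc_imp_cadlag)

lemma scaled_powers_in_space:
  "mono_rc p \<Longrightarrow> mono_rc b \<Longrightarrow> 0 < t \<Longrightarrow> scaled_powers a b t p \<in> topspace J1_product"
  unfolding scaled_powers_def by (auto intro!: restrict_in_skorokhod cadlag_quotient cadlag_conv_power)

lemma limit_paths_in_space:
  assumes "0 < \<alpha>" "continuous_on {0..} x"
  shows "limit_paths \<alpha> x \<in> topspace J1_product"
proof -
  have "restrict (limit_path \<alpha> x j) {0..} \<in> skorokhod_space" if "1 \<le> j" for j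
    using that continuous_on_limit_path[OF assms, of "j - 1"]
    by (intro restrict_in_skorokhod continuous_on_imp_cadlag) simp
  then show ?thesis by (auto simp: limit_paths_def)
qed

text \<open>The path-level statement in the form that \<open>extended_mapping\<close> needs: continuous convergence at continuous paths.\<close>
lemma scaled_powers_limit:
  assumes b: "mono_rc b" "0 \<le> b 0" and bpos: "\<And>t. 0 < t \<Longrightarrow> 0 < b t"
    and \<alpha>: "0 < \<alpha>" and rv: "regularly_varying b \<alpha>" and a: "\<And>t. 0 < t \<Longrightarrow> 0 < a t"
    and binf: "filterlim b at_top at_top" and ab: "((\<lambda>t. a t / b t) \<longlongrightarrow> 0) at_top"
    and x: "x \<in> skorokhod_space" "continuous_on {0..} x"
    and t: "\<And>n. 0 < t n" "filterlim t at_top sequentially" and p: "\<And>n. mono_rc (p n)"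
    and lim: "(\<lambda>n. skorokhod_dist x (scaled_path a b (t n) (p n))) \<longlonglongrightarrow> 0"
  shows "limitin J1_product (\<lambda>n. scaled_powers a b (t n) (p n)) (limit_paths \<alpha> x) sequentially"
  unfolding limitin_componentwise
proof (intro conjI ballI always_eventually allI)
  show "limit_paths \<alpha> x \<in> extensional {1..}" by (simp add: limit_paths_def)
  show "scaled_powers a b (t n) (p n) \<in> topspace J1_product" for n
    by (rule scaled_powers_in_space[OF p b(1) t(1)])
  fix j :: nat assume j: "j \<in> {1..}"
  then obtain i where i: "j = Suc i" by (cases j) auto
  let ?D = "\<lambda>n u. (conv_power (p n) (Suc i) (u * t n) - conv_power b (Suc i) (u * t n)) / (a (t n) * conv_power b i (t n))"
  have close: "uniform_limit {0..U} (\<lambda>n u. (p n (u * t n) - b (u * t n)) / a (t n)) x sequentially"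
    if U: "0 < U" for U
  proof (rule uniform_limitI)
    fix e :: real assume e: "0 < e"
    obtain \<delta> where \<delta>: "0 < \<delta>" "\<And>y s. y \<in> skorokhod_space \<Longrightarrow> skorokhod_dist x y < \<delta> \<Longrightarrow> s \<in> {0..U} \<Longrightarrow> \<bar>y s - x s\<bar> \<le> e / 2"
      using skorokhod_close_to_continuous[OF x, of "e / 2" U] e U by auto
    have "\<forall>\<^sub>F n in sequentially. skorokhod_dist x (scaled_path a b (t n) (p n)) < \<delta>"
      using lim \<delta>(1) by (rule order_tendstoD(2))
    then show "\<forall>\<^sub>F n in sequentially. \<forall>u\<in>{0..U}. dist ((p n (u * t n) - b (u * t n)) / a (t n)) (x u) < e"
    proof eventually_elim
      case (elim n)
      show ?case
      proof
        fix u assume u: "u \<in> {0..U}"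
        have "\<bar>scaled_path a b (t n) (p n) u - x u\<bar> \<le> e / 2"
          by (rule \<delta>(2)[OF scaled_path_in_space[OF p b(1) t(1)] elim u])
        then show "dist ((p n (u * t n) - b (u * t n)) / a (t n)) (x u) < e"
          using u e by (simp add: scaled_path_def dist_real_def)
      qed
    qed
  qed
  have unif: "uniform_limit {0..U} (\<lambda>n u. ?D n u) (limit_path \<alpha> x (Suc i)) sequentially" for U
  proof -
    have "uniform_limit {0..max 1 U} (\<lambda>n u. ?D n u) (limit_path \<alpha> x (Suc i)) sequentially"
      by (rule conv_power_uniform_limit[OF p b bpos \<alpha> rv t a[OF t(1)] filterlim_compose[OF binf t(2)]
            filterlim_compose[OF ab t(2)] x(2) close]) auto
    then show ?thesis by (rule uniform_limit_on_subset) auto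
  qed
  have "limitin J1_topology (\<lambda>n. \<lambda>u\<in>{0..}. ?D n u) (restrict (limit_path \<alpha> x (Suc i)) {0..}) sequentially"
  proof (rule uniform_limit_imp_skorokhod)
    show "restrict (limit_path \<alpha> x (Suc i)) {0..} \<in> skorokhod_space"
      by (intro restrict_in_skorokhod continuous_on_imp_cadlag continuous_on_limit_path \<alpha> x)
    show "(\<lambda>u\<in>{0..}. ?D n u) \<in> skorokhod_space" for n
      by (intro restrict_in_skorokhod cadlag_quotient cadlag_conv_power p b t)
    fix U :: real
    show "uniform_limit {0..U} (\<lambda>n. \<lambda>u\<in>{0..}. ?D n u) (restrict (limit_path \<alpha> x (Suc i)) {0..}) sequentially"
      using unif[of U] by (rule uniform_limit_cong'[THEN iffD1, rotated 2]) auto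
  qed
  then show "limitin J1_topology (\<lambda>n. scaled_powers a b (t n) (p n) j) (limit_paths \<alpha> x j) sequentially"
    by (simp add: scaled_powers_def limit_paths_def i)
qed

lemma limit_path_cong:
  assumes "\<And>s. 0 \<le> s \<Longrightarrow> x s = y s" "0 \<le> u"
  shows "limit_path \<alpha> x j u = limit_path \<alpha> y j u"
proof -
  have "(LINT v:{0..u}|lborel. x (u - v) * c v) = (LINT v:{0..u}|lborel. y (u - v) * c v)" for c
    by (rule set_lebesgue_integral_cong) (use assms in auto)
  then show ?thesis using assms by (simp add: limit_path_def)
qed

theorem theorem2p1:
  fixes M :: "'w measure" and N :: "'v measure"
    and X :: "real \<Rightarrow> 'w \<Rightarrow> real" and W :: "real \<Rightarrow> 'v \<Rightarrow> real"
    and a b :: "real \<Rightarrow> real" and \<alpha> :: real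
  assumes "prob_space M" and "prob_space N"
    and "\<forall>t\<ge>0. X t \<in> borel_measurable M"
    and "\<forall>u\<ge>0. W u \<in> borel_measurable N"
    and "AE \<omega> in M. mono_on {0..} (\<lambda>t. X t \<omega>) \<and> (\<forall>t\<ge>0. continuous (at_right t) (\<lambda>s. X s \<omega>))"
    and "\<forall>t>0. 0 < a t" and "filterlim a at_top at_top"
    and "\<forall>t>0. 0 < b t" and "mono_on {0..} b" and "\<forall>t\<ge>0. continuous (at_right t) b"
    and "0 < \<alpha>" and "regularly_varying b \<alpha>"
    and "filterlim (\<lambda>t. b t / a t) at_top at_top"
    and "locally_hoelder N W"
    and "converges_weakly J1_topology
           M (\<lambda>t \<omega>. \<lambda>u\<in>{0..}. (X (u * t) \<omega> - b (u * t)) / a t)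
           N (\<lambda>\<omega>. \<lambda>u\<in>{0..}. W u \<omega>) at_top"
  shows "converges_weakly (product_topology (\<lambda>j::nat. J1_topology) {1..})
           M (\<lambda>t \<omega>. \<lambda>j\<in>{1..}. \<lambda>u\<in>{0..}.
                (conv_power (\<lambda>s. X s \<omega>) j (u * t) - conv_power b j (u * t)) /
                (a t * conv_power b (j - 1) t))
           N (\<lambda>\<omega>. \<lambda>j\<in>{1..}. \<lambda>u\<in>{0..}. limit_path \<alpha> (\<lambda>s. W s \<omega>) j u) at_top"
proof -
  note \<alpha> = \<open>0 < \<alpha>\<close> and rv = \<open>regularly_varying b \<alpha>\<close>
  have a: "0 < a t" and bpos: "0 < b t" if "0 < t" for t using assms(6,8) that by auto
  have b: "mono_rc b" using assms(9,10) by (simp add: mono_rc_def)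
  have b0: "0 \<le> b 0"
  proof (rule tendsto_lowerbound)
    show "(b \<longlongrightarrow> b 0) (at_right 0)" using assms(10) by (simp add: continuous_within)
    show "\<forall>\<^sub>F t in at_right 0. 0 \<le> b t"
      using bpos by (auto simp: eventually_at_filter intro!: always_eventually less_imp_le)
  qed simp
  have binf: "filterlim b at_top at_top"
  proof (rule filterlim_cong[THEN iffD1, OF refl refl])
    show "filterlim (\<lambda>t. b t / a t * a t) at_top at_top"
      by (rule filterlim_at_top_mult_at_top[OF assms(13,7)])
    show "\<forall>\<^sub>F t in at_top. b t / a t * a t = b t"
      using eventually_gt_at_top[of 0] by eventually_elim (use a in force)
  qed
  have ab: "((\<lambda>t. a t / b t) \<longlongrightarrow> 0) at_top"
    using tendsto_inverse_0_at_top[OF assms(13)] by simp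
  \<comment> \<open>Setting \<open>X\<close> and \<open>W\<close> to 0 on null sets makes every path monotone, respectively continuous, so that the
    pathwise results apply without exception.\<close>
  obtain E where E: "\<And>\<omega>. \<omega> \<in> space M - E \<Longrightarrow> mono_rc (\<lambda>t. X t \<omega>)" "E \<in> null_sets M"
    using AE_E3[OF assms(5)] unfolding mono_rc_def by blast
  define X' where "X' \<omega> t = (if \<omega> \<in> E then 0 else X t \<omega>)" for \<omega> t
  have X'_mono: "mono_rc (X' \<omega>)" if "\<omega> \<in> space M" for \<omega>
    using E(1)[of \<omega>] that by (cases "\<omega> \<in> E") (auto simp: X'_def[abs_def] mono_rc_def intro!: mono_onI continuous_intros)
  have X'_meas: "(\<lambda>\<omega>. X' \<omega> t) \<in> borel_measurable M" if "0 \<le> t" for t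
    unfolding X'_def using assms(3) that E(2) by (intro measurable_If_set) auto
  have X'_AE: "AE \<omega> in M. X' \<omega> = (\<lambda>t. X t \<omega>)"
    using AE_not_in[OF E(2)] by eventually_elim (simp add: X'_def[abs_def])
  obtain E' where E': "\<And>\<omega>. \<omega> \<in> space N - E' \<Longrightarrow> continuous_on {0..} (\<lambda>u. W u \<omega>)" "E' \<in> null_sets N"
    using AE_E3[OF locally_hoelder_imp_continuous[OF assms(14)]] by blast
  define W' where "W' \<omega> u = (if \<omega> \<in> E' then 0 else W u \<omega>)" for \<omega> u
  have W'_cont: "continuous_on {0..} (W' \<omega>)" if "\<omega> \<in> space N" for \<omega>
    using E'(1)[of \<omega>] that by (cases "\<omega> \<in> E'") (auto simp: W'_def[abs_def])
  have W'_meas: "(\<lambda>\<omega>. W' \<omega> u) \<in> borel_measurable N" if "0 \<le> u" for u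
    unfolding W'_def using assms(4) that E'(2) by (intro measurable_If_set) auto
  have W'_AE: "AE \<omega> in N. W' \<omega> = (\<lambda>u. W u \<omega>)"
    using AE_not_in[OF E'(2)] by eventually_elim (simp add: W'_def[abs_def])
  have powers_meas: "(\<lambda>\<omega>. scaled_powers a b t (X' \<omega>)) \<in> M \<rightarrow>\<^sub>M borel_of J1_product" if t: "0 < t" for t
    unfolding scaled_powers_def
  proof (rule measurable_J1_product)
    show "cadlag (\<lambda>u. (conv_power (X' \<omega>) j (u * t) - conv_power b j (u * t)) / (a t * conv_power b (j - 1) t))"
      if "\<omega> \<in> space M" for \<omega> j
      by (intro cadlag_quotient cadlag_conv_power X'_mono that b t)
    show "(\<lambda>\<omega>. (conv_power (X' \<omega>) j (u * t) - conv_power b j (u * t)) / (a t * conv_power b (j - 1) t)) \<in> borel_measurable M"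
      if "0 \<le> u" for j u
      using that t
      by (intro borel_measurable_divide borel_measurable_diff borel_measurable_const
          measurable_conv_power X'_mono X'_meas) auto
  qed
  have limit_meas: "(\<lambda>\<omega>. limit_paths \<alpha> (W' \<omega>)) \<in> N \<rightarrow>\<^sub>M borel_of J1_product"
    unfolding limit_paths_def
  proof (rule measurable_J1_product)
    fix j :: nat assume "1 \<le> j"
    then obtain i where i: "j = Suc i" by (cases j) auto
    show "cadlag (limit_path \<alpha> (W' \<omega>) j)" if "\<omega> \<in> space N" for \<omega>
      unfolding i by (intro continuous_on_imp_cadlag continuous_on_limit_path \<alpha> W'_cont that)
    fix u :: real assume u: "0 \<le> u"
    have "(\<lambda>\<omega>. real (Suc i) * ls_convolution (W' \<omega>) (power_fun \<alpha> i) u) \<in> borel_measurable N"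
      by (intro borel_measurable_times borel_measurable_const measurable_ls_convolution
          continuous_on_imp_cadlag W'_cont W'_meas power_fun_props(1) \<alpha> u)
    then show "(\<lambda>\<omega>. limit_path \<alpha> (W' \<omega>) j u) \<in> borel_measurable N"
      unfolding i by (rule measurable_cong[THEN iffD1, rotated]) (simp add: limit_path_eq[OF \<alpha> W'_cont u])
  qed
  have powers_re: "random_element M J1_product (\<lambda>\<omega>. scaled_powers a b t (X' \<omega>))" if "0 < t" for t
    by (rule measurable_imp_random_element[OF powers_meas[OF that]])
  have limit_re: "random_element N J1_product (\<lambda>\<omega>. limit_paths \<alpha> (W' \<omega>))"
    by (rule measurable_imp_random_element[OF limit_meas])
  define Y where "Y t \<omega> = scaled_powers a b t (\<lambda>s. X s \<omega>)" for t \<omega>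
  define L where "L \<omega> = limit_paths \<alpha> (\<lambda>s. W s \<omega>)" for \<omega>
  have Y_AE: "AE \<omega> in M. Y t \<omega> = scaled_powers a b t (X' \<omega>)" for t
    using X'_AE by eventually_elim (simp add: Y_def)
  have L_AE: "AE \<omega> in N. L \<omega> = limit_paths \<alpha> (W' \<omega>)"
    using W'_AE by eventually_elim (simp add: L_def)
  define Z where "Z \<omega> = restrict (W' \<omega>) {0..}" for \<omega>
  note hyp = assms(15)[unfolded converges_weakly_def]
  have path_AE: "AE \<omega> in M. scaled_path a b t (X' \<omega>) = (\<lambda>u\<in>{0..}. (X (u * t) \<omega> - b (u * t)) / a t)" for t
    using X'_AE by eventually_elim (simp add: scaled_path_def)
  have Z_AE: "AE \<omega> in N. Z \<omega> = (\<lambda>u\<in>{0..}. W u \<omega>)"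
    using W'_AE by eventually_elim (simp add: Z_def)
  have path_re: "\<forall>\<^sub>F t in at_top. random_element M J1_topology (\<lambda>\<omega>. \<lambda>u\<in>{0..}. (X (u * t) \<omega> - b (u * t)) / a t)"
    and Z_re: "random_element N J1_topology (\<lambda>\<omega>. \<lambda>u\<in>{0..}. W u \<omega>)"
    using hyp by blast+
  define C where "C = {x \<in> skorokhod_space. continuous_on {0..} x}"
  have topJ: "J1_topology = Metric_space.mtopology skorokhod_space skorokhod_dist" by (simp add: J1_topology_def)
  have main: "((\<lambda>t. \<integral>\<omega>. f (scaled_powers a b t (X' \<omega>)) \<partial>completion M) \<longlongrightarrow>
      (\<integral>\<omega>. f (limit_paths \<alpha> (Z \<omega>)) \<partial>completion N)) at_top"
    if f: "continuous_map J1_product euclideanreal f" "bounded (f ` topspace J1_product)" for f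
  proof -
    obtain B where B: "\<And>y. y \<in> topspace J1_product \<Longrightarrow> \<bar>f y\<bar> \<le> B"
      using f(2) unfolding bounded_iff by auto
    show ?thesis
    proof (rule extended_mapping[where d = skorokhod_dist and S = skorokhod_space and P = "{p. mono_rc p}" and C = C
          and \<rho> = "scaled_path a b" and K = "\<lambda>t p. f (scaled_powers a b t p)" and h = "\<lambda>x. f (limit_paths \<alpha> x)" and B = B
          and X = X' and Z = Z, folded topJ])
      show "Metric_space skorokhod_space skorokhod_dist" by (rule skorokhod_metric)
      show "prob_space (completion M)" "prob_space (completion N)"
        using assms(1,2) by (auto intro: prob_space.prob_space_completion)
      show "X' \<omega> \<in> {p. mono_rc p}" if "\<omega> \<in> space (completion M)" for \<omega> using X'_mono that by simp
      show "scaled_path a b t p \<in> skorokhod_space" if "0 < t" "p \<in> {p. mono_rc p}" for t p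
        using that b by (simp add: scaled_path_in_space)
      show "C \<subseteq> skorokhod_space" by (auto simp: C_def)
      have "Z \<omega> \<in> C" if "\<omega> \<in> space N" for \<omega>
      proof -
        have "continuous_on {0..} (restrict (W' \<omega>) {0..})"
          using W'_cont[OF that] by (rule continuous_on_cong[THEN iffD1, rotated 2]) auto
        then show ?thesis
          using restrict_in_skorokhod[OF continuous_on_imp_cadlag[OF W'_cont[OF that]]] by (simp add: C_def Z_def)
      qed
      then show "AE \<omega> in completion N. Z \<omega> \<in> C" by (intro AE_I2) simp
      show "(\<forall>\<^sub>F t in at_top. (\<lambda>\<omega>. g (scaled_path a b t (X' \<omega>))) \<in> borel_measurable (completion M)) \<and>
          (\<lambda>\<omega>. g (Z \<omega>)) \<in> borel_measurable (completion N)"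
        if g: "continuous_map J1_topology euclideanreal g" for g
      proof
        show "\<forall>\<^sub>F t in at_top. (\<lambda>\<omega>. g (scaled_path a b t (X' \<omega>))) \<in> borel_measurable (completion M)"
          using path_re by eventually_elim (rule random_element_measurable[OF random_element_cong_AE[OF _ path_AE] g])
        show "(\<lambda>\<omega>. g (Z \<omega>)) \<in> borel_measurable (completion N)"
          by (rule random_element_measurable[OF random_element_cong_AE[OF Z_re Z_AE] g])
      qed
      show "((\<lambda>t. \<integral>\<omega>. g (scaled_path a b t (X' \<omega>)) \<partial>completion M) \<longlongrightarrow> (\<integral>\<omega>. g (Z \<omega>) \<partial>completion N)) at_top"
        if g: "continuous_map J1_topology euclideanreal g" "bounded (g ` skorokhod_space)" for g
      proof (rule tendsto_cong[THEN iffD2])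
        show "\<forall>\<^sub>F t in at_top. (\<integral>\<omega>. g (scaled_path a b t (X' \<omega>)) \<partial>completion M) =
            (\<integral>\<omega>. g (\<lambda>u\<in>{0..}. (X (u * t) \<omega> - b (u * t)) / a t) \<partial>completion M)"
          using path_re by eventually_elim (rule random_element_integral_cong[OF _ path_AE g(1)])
        show "((\<lambda>t. \<integral>\<omega>. g (\<lambda>u\<in>{0..}. (X (u * t) \<omega> - b (u * t)) / a t) \<partial>completion M) \<longlongrightarrow> (\<integral>\<omega>. g (Z \<omega>) \<partial>completion N)) at_top"
          unfolding random_element_integral_cong[OF Z_re Z_AE g(1)] using hyp g by simp
      qed
      show "\<forall>\<^sub>F t in at_top. (\<lambda>\<omega>. f (scaled_powers a b t (X' \<omega>))) \<in> borel_measurable (completion M)"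
        using eventually_gt_at_top[of 0] by eventually_elim (rule random_element_measurable[OF powers_re f(1)])
      show "\<bar>f (scaled_powers a b t p)\<bar> \<le> B" if "0 < t" "p \<in> {p. mono_rc p}" for t p
        using that b by (intro B scaled_powers_in_space) auto
      have "limit_paths \<alpha> (Z \<omega>) = limit_paths \<alpha> (W' \<omega>)" for \<omega>
        by (auto simp: limit_paths_def Z_def intro!: restrict_ext limit_path_cong)
      then show "(\<lambda>\<omega>. f (limit_paths \<alpha> (Z \<omega>))) \<in> borel_measurable (completion N)"
        using random_element_measurable[OF limit_re f(1)] by simp
      show "\<bar>f (limit_paths \<alpha> x)\<bar> \<le> B" if "x \<in> C" for x
        using that by (intro B limit_paths_in_space \<alpha>) (simp add: C_def)
      fix x and e :: real assume x: "x \<in> C" and e: "0 < e"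
      show "\<exists>\<delta>>0. \<exists>T. \<forall>t\<ge>T. \<forall>p\<in>{p. mono_rc p}. skorokhod_dist x (scaled_path a b t p) < \<delta> \<longrightarrow>
          \<bar>f (scaled_powers a b t p) - f (limit_paths \<alpha> x)\<bar> \<le> e"
      \<comment> \<open>Otherwise there is a sequence along which the normalised paths converge to \<open>x\<close> but the images stay away.\<close>
      proof (rule ccontr)
        assume contra: "\<not> ?thesis"
        have "\<exists>t p. real (Suc n) \<le> t \<and> mono_rc p \<and> skorokhod_dist x (scaled_path a b t p) < 1 / real (Suc n) \<and>
            e < \<bar>f (scaled_powers a b t p) - f (limit_paths \<alpha> x)\<bar>" for n
        proof -
          have "0 < 1 / real (Suc n)" by simp
          then show ?thesis using contra by (metis mem_Collect_eq not_le)
        qed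
        then obtain t p where tp: "\<And>n. real (Suc n) \<le> t n" "\<And>n. mono_rc (p n)"
          "\<And>n. skorokhod_dist x (scaled_path a b (t n) (p n)) < 1 / real (Suc n)"
          "\<And>n. e < \<bar>f (scaled_powers a b (t n) (p n)) - f (limit_paths \<alpha> x)\<bar>"
          by metis
        have t0: "0 < t n" for n using tp(1)[of n] by simp
        have tinf: "filterlim t at_top sequentially"
        proof (rule filterlim_at_top_mono[OF filterlim_real_sequentially])
          show "\<forall>\<^sub>F n in sequentially. real n \<le> t n"
            using tp(1) by (intro always_eventually allI) (simp add: order_trans[OF _ tp(1)])
        qed
        have "(\<lambda>n. skorokhod_dist x (scaled_path a b (t n) (p n))) \<longlonglongrightarrow> 0"
        proof (rule tendsto_sandwich[OF _ _ tendsto_const LIMSEQ_Suc[OF lim_1_over_n]])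
          interpret Metric_space skorokhod_space skorokhod_dist by (rule skorokhod_metric)
          show "\<forall>\<^sub>F n in sequentially. 0 \<le> skorokhod_dist x (scaled_path a b (t n) (p n))" by simp
          show "\<forall>\<^sub>F n in sequentially. skorokhod_dist x (scaled_path a b (t n) (p n)) \<le> 1 / real (Suc n)"
            using tp(3) by (intro always_eventually allI less_imp_le)
        qed
        then have "limitin J1_product (\<lambda>n. scaled_powers a b (t n) (p n)) (limit_paths \<alpha> x) sequentially"
          using x by (intro scaled_powers_limit b b0 bpos \<alpha> rv a binf ab t0 tinf tp(2)) (auto simp: C_def)
        from continuous_map_limit[OF f(1) this]
        have "(\<lambda>n. f (scaled_powers a b (t n) (p n))) \<longlonglongrightarrow> f (limit_paths \<alpha> x)"
          by (simp add: o_def)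
        then have "\<forall>\<^sub>F n in sequentially. dist (f (scaled_powers a b (t n) (p n))) (f (limit_paths \<alpha> x)) < e"
          using e by (rule tendstoD)
        then obtain n where "dist (f (scaled_powers a b (t n) (p n))) (f (limit_paths \<alpha> x)) < e"
          by (meson eventually_happens sequentially_bot)
        then show False using tp(4)[of n] by (simp add: dist_real_def)
      qed
    qed
  qed
  have "converges_weakly J1_product M Y N L at_top"
    unfolding converges_weakly_def
  proof (intro conjI allI impI)
    show "\<forall>\<^sub>F t in at_top. random_element M J1_product (Y t)"
      using eventually_gt_at_top[of 0] by eventually_elim (rule random_element_cong_AE[OF powers_re Y_AE])
    show "random_element N J1_product L" by (rule random_element_cong_AE[OF limit_re L_AE])
    fix f :: "(nat \<Rightarrow> real \<Rightarrow> real) \<Rightarrow> real"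
    assume f: "continuous_map J1_product euclideanreal f \<and> bounded (f ` topspace J1_product)"
    have "limit_paths \<alpha> (Z \<omega>) = limit_paths \<alpha> (W' \<omega>)" for \<omega>
      by (auto simp: limit_paths_def Z_def intro!: restrict_ext limit_path_cong)
    then have "(\<integral>\<omega>. f (L \<omega>) \<partial>completion N) = (\<integral>\<omega>. f (limit_paths \<alpha> (Z \<omega>)) \<partial>completion N)"
      using random_element_integral_cong[OF limit_re L_AE] f by simp
    moreover have "\<forall>\<^sub>F t in at_top. (\<integral>\<omega>. f (Y t \<omega>) \<partial>completion M) = (\<integral>\<omega>. f (scaled_powers a b t (X' \<omega>)) \<partial>completion M)"
      using eventually_gt_at_top[of 0]
      by eventually_elim (rule random_element_integral_cong[OF powers_re Y_AE], use f in auto)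
    ultimately show "((\<lambda>t. \<integral>\<omega>. f (Y t \<omega>) \<partial>completion M) \<longlongrightarrow> (\<integral>\<omega>. f (L \<omega>) \<partial>completion N)) at_top"
      using main[of f] f by (simp add: tendsto_cong)
  qed
  then show ?thesis unfolding Y_def[abs_def] L_def[abs_def] scaled_powers_def limit_paths_def .
qed

end
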